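(* Let $(M,g)$ be an oriented Riemannian manifold of even dimension $n=2m\ge4$, and let $\mathbf S_\rho$ be the bundle associated to an irreducible unitary $SO(n)$-module $V_\rho$. Then the curvature endomorphism $R^{\mathrm{pf}}_\rho$ of $\mathbf S_\rho$ does not depend on the Einstein tensor; precisely, with respect to any local oriented orthonormal frame $(e_1,\dots,e_n)$, $$R^{\mathrm{pf}}_\rho=\frac12\sum_{i,j,k,l}W_{ijkl}\,\pi_\rho(\mathrm{pf}_{ij}e_{kl})+\frac{\pi_\rho(\mathrm{pf})\,\kappa}{n-1},$$ where $W_{ijkl}$ is the conformal Weyl tensor and $\kappa$ the scalar curvature.
   Context: Lie algebra: $\mathfrak{so}(n)$ is spanned by $e_{ij}:=e_i\wedge e_j$ acting by $e_{ij}(u)=\langle e_i,u\rangle e_j-\langle e_j,u\rangle e_i$. Weights $\rho=(\rho^1,\dots,\rho^m)=\sum_i\rho^i\mu_i$ are taken with respect to the basis $\mu_i(-\sqrt{-1}\,e_{2j-1,2j})=\delta_{ij}$; $(\pi_\rho,V_\rho)$ is the irreducible unitary representation of $SO(n)$ with highest weight $\rho$ (lexicographic order), extended to $U(\mathfrak{so}(n,\mathbb C))$. Central elements act by scalars. Pfaffian elements ($n=2m$): $\mathrm{pf}:=\frac{1}{(\sqrt{-1})^m2^mm!}\sum_{\sigma\in\mathfrak S_{2m}}\mathrm{sgn}(\sigma)e_{\sigma(1)\sigma(2)}\cdots e_{\sigma(2m-1)\sigma(2m)}$, which is central with $\pi_\rho(\mathrm{pf})=(\rho^1+m-1)(\rho^2+m-2)\cdots(\rho^{m-1}+1)\rho^m$;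 $\mathrm{pf}_{ii}:=\mathrm{pf}$; for $i<j$, $\mathrm{pf}_{ij}:=(-1)^{i+j}\frac{2m}{(\sqrt{-1})^m2^mm!}\sum_{\sigma}\mathrm{sgn}(\sigma)e_{\sigma(1)\sigma(2)}\cdots e_{\sigma(2m-1)\sigma(2m)}$, where $\sigma$ runs over permutations of $\{1,\dots,2m\}\setminus\{i,j\}$, i.e. the product has $m-1$ factors whose indices are the images under $\sigma$ of the elements of that set in increasing order; and $\mathrm{pf}_{ij}:=-\mathrm{pf}_{ji}$ for $i>j$. Geometry: $\mathbf S_\rho=\mathbf{SO}(M)\times_{\pi_\rho}V_\rho$, where $\mathbf{SO}(M)$ is the oriented orthonormal frame bundle; $\nabla$ is the covariant derivative on $\mathbf S_\rho$ induced by the Levi-Civita connection $\nabla^T$. A local frame $e=(e_1,\dots,e_n)$ identifies $\mathbf S_\rho$ locally with $V_\rho$, and $\pi_\rho(\cdot)$ acts through this identification. $\nabla^2_{X,Y}:=\nabla_X\nabla_Y-\nabla_{\nabla^T_XY}$ and $R_\rho(X,Y):=\nabla^2_{X,Y}-\nabla^2_{Y,X}$. The curvature endomorphism is $R^{\mathrm{pf}}_\rho:=\sum_{i,j}\pi_\rho(\mathrm{pf}_{ij})R_\rho(e_i,e_j)$. Curvature: $R_{ijkl}:=g(R_T(e_i,e_j)e_k,e_l)$ with $R_T$ the Riemannian curvature of $\nabla^T$ (so $R_\rho(e_i,e_j)=\frac12\sum_{k,l}R_{ijkl}\pi_\rho(e_{kl})$), $R_{ij}:=\sum_kR_{ikkj}$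 the Ricci tensor, $\kappa:=\sum_iR_{ii}$. Set $S_{ijkl}:=\frac{\kappa}{n(n-1)}(\delta_{il}\delta_{jk}-\delta_{ik}\delta_{jl})$; $E_{ij}:=\frac1{n-2}(\frac\kappa n\delta_{ij}-R_{ij})$ (called the Einstein tensor); $K_{ijkl}:=E_{ik}\delta_{jl}+E_{jl}\delta_{ik}-E_{il}\delta_{jk}-E_{jk}\delta_{il}$; and the conformal Weyl tensor $W_{ijkl}:=R_{ijkl}-K_{ijkl}-S_{ijkl}$. *)

theory Defs
  imports "HOL-Analysis.Analysis" "HOL-Combinatorics.Permutations"
begin

section \<open>Smooth manifolds\<close>

text \<open>On an open set this is the class of infinitely differentiable maps.\<close>

coinductive smooth_on ::
  "'a::real_normed_vector set \<Rightarrow> ('a \<Rightarrow> 'b::real_normed_vector) \<Rightarrow> bool" for S where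
  "f differentiable_on S \<Longrightarrow>
   (\<And>v. smooth_on S (\<lambda>x. frechet_derivative f (at x) v)) \<Longrightarrow> smooth_on S f"

type_synonym ('a, 'n) chart = "'a set \<times> ('a \<Rightarrow> real^'n)"

definition smooth_atlas :: "('a::topological_space, 'n::finite) chart set \<Rightarrow> bool" where
  "smooth_atlas A \<longleftrightarrow>
     (\<Union>(V, \<phi>)\<in>A. V) = UNIV \<and>
     (\<forall>(V, \<phi>)\<in>A. open V \<and> open (\<phi> ` V) \<and> homeomorphism V (\<phi> ` V) \<phi> (inv_into V \<phi>)) \<and>
     (\<forall>(V, \<phi>)\<in>A. \<forall>(W, \<theta>)\<in>A. smooth_on (\<phi> ` (V \<inter> W)) (\<theta> \<circ> inv_into V \<phi>))"

definition oriented_atlas :: "('a::topological_space, 'n::finite) chart set \<Rightarrow> bool" where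
  "oriented_atlas A \<longleftrightarrow> smooth_atlas A \<and>
     (\<forall>(V, \<phi>)\<in>A. \<forall>(W, \<theta>)\<in>A. \<forall>y\<in>\<phi> ` (V \<inter> W).
        det (matrix (frechet_derivative (\<theta> \<circ> inv_into V \<phi>) (at y))) > 0)"

definition msmooth ::
  "('a::topological_space, 'n::finite) chart set \<Rightarrow> 'a set \<Rightarrow> ('a \<Rightarrow> 'b::real_normed_vector) \<Rightarrow> bool"
where
  "msmooth A U f \<longleftrightarrow> open U \<and>
     (\<forall>(V, \<phi>)\<in>A. smooth_on (\<phi> ` (U \<inter> V)) (f \<circ> inv_into V \<phi>))"

definition msmooth_at ::
  "('a::topological_space, 'n::finite) chart set \<Rightarrow> 'a \<Rightarrow> ('a \<Rightarrow> 'b::real_normed_vector) \<Rightarrow> bool"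
where
  "msmooth_at A p f \<longleftrightarrow> (\<exists>U. p \<in> U \<and> msmooth A U f)"

text \<open>
  Tangent vectors at a point are derivations on functions that are smooth near the point.  As
  functions are total, a derivation is set to 0 on all other functions, which makes equality of
  tangent vectors equality of derivations.  The value of a derivation depends only on the germ: if
  two functions agree near the point, apply the Leibniz rule to their difference multiplied by the
  indicator function of the set on which they differ.
\<close>

type_synonym 'a tvec = "('a \<Rightarrow> real) \<Rightarrow> real"

type_synonym 'a vfield = "'a \<Rightarrow> 'a tvec"

definition tangent_space :: "('a::topological_space, 'n::finite) chart set \<Rightarrow> 'a \<Rightarrow> 'a tvec set" where
  "tangent_space A p = {v.
     (\<forall>f h. msmooth_at A p f \<and> msmooth_at A p h \<longrightarrow>
        v (\<lambda>q. f q + h q) = v f + v h \<and>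
        v (\<lambda>q. f q * h q) = v f * h p + f p * v h) \<and>
     (\<forall>c f. msmooth_at A p f \<longrightarrow> v (\<lambda>q. c * f q) = c * v f) \<and>
     (\<forall>f. \<not> msmooth_at A p f \<longrightarrow> v f = 0)}"

definition vector_field_on ::
  "('a::topological_space, 'n::finite) chart set \<Rightarrow> 'a set \<Rightarrow> 'a vfield \<Rightarrow> bool" where
  "vector_field_on A U X \<longleftrightarrow> open U \<and> (\<forall>p\<in>U. X p \<in> tangent_space A p) \<and>
     (\<forall>V f. V \<subseteq> U \<and> msmooth A V f \<longrightarrow> msmooth A V (\<lambda>p. X p f))"

definition lie_bracket ::
  "('a::topological_space, 'n::finite) chart set \<Rightarrow> 'a vfield \<Rightarrow> 'a vfield \<Rightarrow> 'a vfield" where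
  "lie_bracket A X Y p f =
     (if msmooth_at A p f then X p (\<lambda>q. Y q f) - Y p (\<lambda>q. X q f) else 0)"


section \<open>Riemannian geometry\<close>

definition riemannian_metric ::
  "('a::topological_space, 'n::finite) chart set \<Rightarrow> ('a \<Rightarrow> 'a tvec \<Rightarrow> 'a tvec \<Rightarrow> real) \<Rightarrow> bool" where
  "riemannian_metric A g \<longleftrightarrow>
     (\<forall>p. \<forall>u\<in>tangent_space A p. \<forall>v\<in>tangent_space A p.
        g p u v = g p v u \<and>
        (\<forall>w\<in>tangent_space A p. \<forall>a b. g p (\<lambda>f. a * u f + b * w f) v = a * g p u v + b * g p w v) \<and>
        (u \<noteq> (\<lambda>f. 0) \<longrightarrow> g p u u > 0)) \<and>
     (\<forall>U X Y. vector_field_on A U X \<and> vector_field_on A U Y \<longrightarrow> msmooth A U (\<lambda>p. g p (X p) (Y p)))"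

definition oriented_riemannian_manifold ::
  "('a::topological_space, 'n::finite) chart set \<Rightarrow> ('a \<Rightarrow> 'a tvec \<Rightarrow> 'a tvec \<Rightarrow> real) \<Rightarrow> bool" where
  "oriented_riemannian_manifold A g \<longleftrightarrow> oriented_atlas A \<and> riemannian_metric A g"

text \<open>
  \<open>nabla p v Y\<close> is the covariant derivative at \<open>p\<close> of the vector field \<open>Y\<close> in the direction of the
  tangent vector \<open>v\<close>; it is constrained only for fields \<open>Y\<close> that are smooth near \<open>p\<close>.
\<close>

definition affine_connection ::
  "('a::topological_space, 'n::finite) chart set \<Rightarrow> ('a \<Rightarrow> 'a tvec \<Rightarrow> 'a vfield \<Rightarrow> 'a tvec) \<Rightarrow> bool" where
  "affine_connection A nabla \<longleftrightarrow>
     (\<forall>U X Y. vector_field_on A U X \<and> vector_field_on A U Y \<longrightarrow>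
        vector_field_on A U (\<lambda>p. nabla p (X p) Y)) \<and>
     (\<forall>U Y p. vector_field_on A U Y \<and> p \<in> U \<longrightarrow>
        (\<forall>v\<in>tangent_space A p.
           nabla p v Y \<in> tangent_space A p \<and>
           (\<forall>w\<in>tangent_space A p. \<forall>a b.
              nabla p (\<lambda>f. a * v f + b * w f) Y = (\<lambda>f. a * nabla p v Y f + b * nabla p w Y f)) \<and>
           (\<forall>Z. vector_field_on A U Z \<longrightarrow>
              nabla p v (\<lambda>q f. Y q f + Z q f) = (\<lambda>f. nabla p v Y f + nabla p v Z f)) \<and>
           (\<forall>h. msmooth A U h \<longrightarrow>
              nabla p v (\<lambda>q f. h q * Y q f) = (\<lambda>f. v h * Y p f + h p * nabla p v Y f))))"

definition levi_civita ::
  "('a::topological_space, 'n::finite) chart set \<Rightarrow> ('a \<Rightarrow> 'a tvec \<Rightarrow> 'a tvec \<Rightarrow> real) \<Rightarrow>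
   ('a \<Rightarrow> 'a tvec \<Rightarrow> 'a vfield \<Rightarrow> 'a tvec) \<Rightarrow> bool" where
  "levi_civita A g nabla \<longleftrightarrow> affine_connection A nabla \<and>
     (\<forall>U Y Z p. vector_field_on A U Y \<and> vector_field_on A U Z \<and> p \<in> U \<longrightarrow>
        (\<forall>v\<in>tangent_space A p.
           v (\<lambda>q. g q (Y q) (Z q)) = g p (nabla p v Y) (Z p) + g p (Y p) (nabla p v Z)) \<and>
        (\<lambda>f. nabla p (Y p) Z f - nabla p (Z p) Y f) = lie_bracket A Y Z p)"

definition riemann_curvature ::
  "('a::topological_space, 'n::finite) chart set \<Rightarrow> ('a \<Rightarrow> 'a tvec \<Rightarrow> 'a vfield \<Rightarrow> 'a tvec) \<Rightarrow>
   'a vfield \<Rightarrow> 'a vfield \<Rightarrow> 'a vfield \<Rightarrow> 'a vfield" where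
  "riemann_curvature A nabla X Y Z p f =
     nabla p (X p) (\<lambda>q. nabla q (Y q) Z) f - nabla p (Y p) (\<lambda>q. nabla q (X q) Z) f
     - nabla p (lie_bracket A X Y p) Z f"

definition oriented_orthonormal_basis ::
  "('a::topological_space, 'n::finite) chart set \<Rightarrow> ('a \<Rightarrow> 'a tvec \<Rightarrow> 'a tvec \<Rightarrow> real) \<Rightarrow>
   'a \<Rightarrow> ('n \<Rightarrow> 'a tvec) \<Rightarrow> bool" where
  "oriented_orthonormal_basis A g p b \<longleftrightarrow>
     (\<forall>i. b i \<in> tangent_space A p) \<and>
     (\<forall>i j. g p (b i) (b j) = (if i = j then 1 else 0)) \<and>
     (\<forall>v\<in>tangent_space A p. \<exists>c. v = (\<lambda>f. \<Sum>i\<in>UNIV. c i * b i f)) \<and>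
     (\<forall>(V, \<phi>)\<in>A. p \<in> V \<longrightarrow> det (\<chi> a i. b i (\<lambda>q. \<phi> q $ a)) > 0)"

definition local_frame ::
  "('a::topological_space, 'n::finite) chart set \<Rightarrow> ('a \<Rightarrow> 'a tvec \<Rightarrow> 'a tvec \<Rightarrow> real) \<Rightarrow>
   'a set \<Rightarrow> ('n \<Rightarrow> 'a vfield) \<Rightarrow> bool" where
  "local_frame A g U e \<longleftrightarrow> open U \<and> (\<forall>i. vector_field_on A U (e i)) \<and>
     (\<forall>p\<in>U. oriented_orthonormal_basis A g p (\<lambda>i. e i p))"

definition curv_comp ::
  "('a::topological_space, 'n::finite) chart set \<Rightarrow> ('a \<Rightarrow> 'a tvec \<Rightarrow> 'a tvec \<Rightarrow> real) \<Rightarrow>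
   ('a \<Rightarrow> 'a tvec \<Rightarrow> 'a vfield \<Rightarrow> 'a tvec) \<Rightarrow> ('n \<Rightarrow> 'a vfield) \<Rightarrow> 'a \<Rightarrow> 'n \<Rightarrow> 'n \<Rightarrow> 'n \<Rightarrow> 'n \<Rightarrow> real" where
  "curv_comp A g nabla e p i j k l =
     g p (riemann_curvature A nabla (e i) (e j) (e k) p) (e l p)"

definition kdelta :: "'n \<Rightarrow> 'n \<Rightarrow> real" where
  "kdelta i j = (if i = j then 1 else 0)"

definition ricci :: "('n::finite \<Rightarrow> 'n \<Rightarrow> 'n \<Rightarrow> 'n \<Rightarrow> real) \<Rightarrow> 'n \<Rightarrow> 'n \<Rightarrow> real" where
  "ricci R i j = (\<Sum>k\<in>UNIV. R i k k j)"

definition scalar_curv :: "('n::finite \<Rightarrow> 'n \<Rightarrow> 'n \<Rightarrow> 'n \<Rightarrow> real) \<Rightarrow> real" where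
  "scalar_curv R = (\<Sum>i\<in>UNIV. ricci R i i)"

definition S_tensor :: "('n::finite \<Rightarrow> 'n \<Rightarrow> 'n \<Rightarrow> 'n \<Rightarrow> real) \<Rightarrow> 'n \<Rightarrow> 'n \<Rightarrow> 'n \<Rightarrow> 'n \<Rightarrow> real" where
  "S_tensor R i j k l = scalar_curv R / (real CARD('n) * (real CARD('n) - 1)) *
     (kdelta i l * kdelta j k - kdelta i k * kdelta j l)"

definition einstein :: "('n::finite \<Rightarrow> 'n \<Rightarrow> 'n \<Rightarrow> 'n \<Rightarrow> real) \<Rightarrow> 'n \<Rightarrow> 'n \<Rightarrow> real" where
  "einstein R i j = 1 / (real CARD('n) - 2) *
     (scalar_curv R / real CARD('n) * kdelta i j - ricci R i j)"

definition K_tensor :: "('n::finite \<Rightarrow> 'n \<Rightarrow> 'n \<Rightarrow> 'n \<Rightarrow> real) \<Rightarrow> 'n \<Rightarrow> 'n \<Rightarrow> 'n \<Rightarrow> 'n \<Rightarrow> real" where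
  "K_tensor R i j k l =
     einstein R i k * kdelta j l + einstein R j l * kdelta i k
     - einstein R i l * kdelta j k - einstein R j k * kdelta i l"

definition weyl :: "('n::finite \<Rightarrow> 'n \<Rightarrow> 'n \<Rightarrow> 'n \<Rightarrow> real) \<Rightarrow> 'n \<Rightarrow> 'n \<Rightarrow> 'n \<Rightarrow> 'n \<Rightarrow> real" where
  "weyl R i j k l = R i j k l - K_tensor R i j k l - S_tensor R i j k l"


section \<open>Unitary representations of the special orthogonal group\<close>

definition SO_group :: "(real^'n^'n) set" where
  "SO_group = {h. orthogonal_matrix h \<and> det h = 1}"

definition irreducible_unitary_rep :: "(real^'n^'n \<Rightarrow> complex^'d^'d) \<Rightarrow> bool" where
  "irreducible_unitary_rep \<pi> \<longleftrightarrow>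
     continuous_on SO_group \<pi> \<and>
     \<pi> (mat 1) = mat 1 \<and>
     (\<forall>h\<in>SO_group. \<forall>k\<in>SO_group. \<pi> (h ** k) = \<pi> h ** \<pi> k) \<and>
     (\<forall>h\<in>SO_group. (\<chi> a b. cnj (\<pi> h $ b $ a)) ** \<pi> h = mat 1) \<and>
     (\<forall>W. vec.subspace W \<and> (\<forall>h\<in>SO_group. \<forall>w\<in>W. \<pi> h *v w \<in> W) \<longrightarrow> W = {0} \<or> W = UNIV)"

text \<open>
  The Lie algebra of the special orthogonal group consists of the skew-symmetric matrices.  The
  operations \<open>*\<close> and \<open>^\<close> on the vector type are componentwise, so the library's \<^const>\<open>exp\<close> cannot
  serve as the matrix exponential.
\<close>

definition mat_exp :: "real^'n^'n \<Rightarrow> real^'n^'n" where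
  "mat_exp X = (\<Sum>k. (1 / fact k) *\<^sub>R (((**) X ^^ k) (mat 1)))"

definition drep :: "(real^'n^'n \<Rightarrow> complex^'d^'d) \<Rightarrow> real^'n^'n \<Rightarrow> complex^'d^'d" where
  "drep \<pi> X = vector_derivative (\<lambda>t. \<pi> (mat_exp (t *\<^sub>R X))) (at 0)"

definition drep_complex :: "(real^'n^'n \<Rightarrow> complex^'d^'d) \<Rightarrow> complex^'n^'n \<Rightarrow> complex^'d^'d" where
  "drep_complex \<pi> X =
     drep \<pi> (\<chi> a b. Re (X $ a $ b)) + mat \<i> ** drep \<pi> (\<chi> a b. Im (X $ a $ b))"


section \<open>The universal enveloping algebra of \<open>so(n, C)\<close>\<close>

typedef ('n::finite) so_C = "{X :: complex^'n^'n. transpose X = - X}"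
  by (rule exI[of _ 0]) (simp add: transpose_def vec_eq_iff)

text \<open>
  The associative unital complex algebra generated by the elements of the Lie algebra, subject to
  the relations that make the inclusion of the generators linear and turn Lie brackets into
  commutators.  The constructor \<open>Scal\<close> stands for the scalar multiples of the unit.
\<close>

datatype ('n::finite) uterm =
  Scal complex | Gen "'n so_C" | Add "'n uterm" "'n uterm" | Mul "'n uterm" "'n uterm"

inductive ueq :: "('n::finite) uterm \<Rightarrow> 'n uterm \<Rightarrow> bool" where
  ueq_refl: "ueq s s"
| ueq_sym: "ueq s t \<Longrightarrow> ueq t s"
| ueq_trans: "ueq s t \<Longrightarrow> ueq t u \<Longrightarrow> ueq s u"
| ueq_Add: "ueq s s' \<Longrightarrow> ueq t t' \<Longrightarrow> ueq (Add s t) (Add s' t')"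
| ueq_Mul: "ueq s s' \<Longrightarrow> ueq t t' \<Longrightarrow> ueq (Mul s t) (Mul s' t')"
| add_assoc: "ueq (Add (Add s t) u) (Add s (Add t u))"
| add_commute: "ueq (Add s t) (Add t s)"
| add_0: "ueq (Add (Scal 0) s) s"
| add_inverse: "ueq (Add (Mul (Scal (-1)) s) s) (Scal 0)"
| mul_assoc: "ueq (Mul (Mul s t) u) (Mul s (Mul t u))"
| mul_1_left: "ueq (Mul (Scal 1) s) s"
| mul_1_right: "ueq (Mul s (Scal 1)) s"
| distrib_left: "ueq (Mul s (Add t u)) (Add (Mul s t) (Mul s u))"
| distrib_right: "ueq (Mul (Add s t) u) (Add (Mul s u) (Mul t u))"
| Scal_add: "ueq (Scal (a + b)) (Add (Scal a) (Scal b))"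
| Scal_mult: "ueq (Scal (a * b)) (Mul (Scal a) (Scal b))"
| Scal_central: "ueq (Mul (Scal a) s) (Mul s (Scal a))"
| Gen_add: "Rep_so_C z = Rep_so_C x + Rep_so_C y \<Longrightarrow> ueq (Gen z) (Add (Gen x) (Gen y))"
| Gen_scale: "Rep_so_C z = mat a ** Rep_so_C x \<Longrightarrow> ueq (Gen z) (Mul (Scal a) (Gen x))"
| Gen_bracket: "Rep_so_C z = Rep_so_C x ** Rep_so_C y - Rep_so_C y ** Rep_so_C x \<Longrightarrow>
    ueq (Gen z) (Add (Mul (Gen x) (Gen y)) (Mul (Scal (-1)) (Mul (Gen y) (Gen x))))"

lemma ueq_imp_counit_eq:
  assumes "ueq s t"
  shows "rec_uterm (\<lambda>c. c) (\<lambda>x. 0) (\<lambda>s t a b. a + b) (\<lambda>s t a b. a * b) s =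
    (rec_uterm (\<lambda>c. c) (\<lambda>x. 0) (\<lambda>s t a b. a + b) (\<lambda>s t a b. a * b) t :: complex)"
  using assms by induction (simp_all add: algebra_simps)

quotient_type 'n uea = "('n::finite) uterm" / ueq
  by (intro equivpI reflpI sympI transpI) (blast intro: ueq_refl ueq_sym ueq_trans)+

instantiation uea :: (finite) ring_1
begin

lift_definition zero_uea :: "'a uea" is "Scal 0" .
lift_definition one_uea :: "'a uea" is "Scal 1" .
lift_definition plus_uea :: "'a uea \<Rightarrow> 'a uea \<Rightarrow> 'a uea" is Add by (rule ueq_Add)
lift_definition times_uea :: "'a uea \<Rightarrow> 'a uea \<Rightarrow> 'a uea" is Mul by (rule ueq_Mul)
lift_definition uminus_uea :: "'a uea \<Rightarrow> 'a uea" is "Mul (Scal (-1))"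
  by (intro ueq_Mul ueq_refl)
definition minus_uea :: "'a uea \<Rightarrow> 'a uea \<Rightarrow> 'a uea" where "minus_uea u v = u + - v"

instance
proof
  fix a b c :: "'a uea"
  show "a + b + c = a + (b + c)" by transfer (rule ueq.add_assoc)
  show "a + b = b + a" by transfer (rule ueq.add_commute)
  show "0 + a = a" by transfer (rule ueq.add_0)
  show "- a + a = 0" by transfer (rule ueq.add_inverse)
  show "a - b = a + - b" by (rule minus_uea_def)
  show "a * b * c = a * (b * c)" by transfer (rule ueq.mul_assoc)
  show "1 * a = a" by transfer (rule ueq.mul_1_left)
  show "a * 1 = a" by transfer (rule ueq.mul_1_right)
  show "a * (b + c) = a * b + a * c" by transfer (rule ueq.distrib_left)
  show "(a + b) * c = a * c + b * c" by transfer (rule ueq.distrib_right)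
  show "(0 :: 'a uea) \<noteq> 1" by transfer (use ueq_imp_counit_eq in force)
qed

end

lift_definition uea_scal :: "complex \<Rightarrow> ('n::finite) uea" is Scal .

lift_definition uea_gen :: "('n::finite) so_C \<Rightarrow> 'n uea" is Gen .

text \<open>
  Extension of a representation to the enveloping algebra.  The value does not depend on the
  representing term, because the differential of a representation is a Lie algebra homomorphism.
\<close>

primrec uterm_rep :: "(real^'n^'n \<Rightarrow> complex^'d^'d) \<Rightarrow> ('n::finite) uterm \<Rightarrow> complex^'d^'d" where
  "uterm_rep \<pi> (Scal c) = mat c"
| "uterm_rep \<pi> (Gen x) = drep_complex \<pi> (Rep_so_C x)"
| "uterm_rep \<pi> (Add s t) = uterm_rep \<pi> s + uterm_rep \<pi> t"
| "uterm_rep \<pi> (Mul s t) = uterm_rep \<pi> s ** uterm_rep \<pi> t"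

definition uea_rep :: "(real^'n^'n \<Rightarrow> complex^'d^'d) \<Rightarrow> ('n::finite) uea \<Rightarrow> complex^'d^'d" where
  "uea_rep \<pi> u = uterm_rep \<pi> (rep_uea u)"


section \<open>Pfaffian elements\<close>

text \<open>The matrix with \<open>e_ij(u) = <e_i,u> e_j - <e_j,u> e_i\<close>.\<close>

definition e_mat :: "'n \<Rightarrow> 'n \<Rightarrow> complex^'n^'n" where
  "e_mat i j = (\<chi> a b. (if a = j \<and> b = i then 1 else 0) - (if a = i \<and> b = j then 1 else 0))"

definition e_uea :: "'n::finite \<Rightarrow> 'n \<Rightarrow> 'n uea" where
  "e_uea i j = uea_gen (Abs_so_C (e_mat i j))"

text \<open>
  The index type is a finite linear order and plays the role of \<open>{1..n}\<close>; \<open>position i\<close> is the number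
  corresponding to \<open>i\<close>.
\<close>

definition position :: "'n::{finite,linorder} \<Rightarrow> nat" where
  "position i = card {..i}"

definition pf_sum :: "'n::{finite,linorder} set \<Rightarrow> 'n uea" where
  "pf_sum I = (let s = sorted_list_of_set I in
     \<Sum>\<sigma> | \<sigma> permutes I. of_int (sign \<sigma>) *
       prod_list (map (\<lambda>k. e_uea (\<sigma> (s ! (2 * k))) (\<sigma> (s ! (2 * k + 1)))) [0..<card I div 2]))"

definition pf :: "('n::{finite,linorder}) uea" where
  "pf = (let m = CARD('n) div 2 in
     uea_scal (1 / (\<i> ^ m * 2 ^ m * fact m)) * pf_sum UNIV)"

definition pf_upper :: "'n::{finite,linorder} \<Rightarrow> 'n \<Rightarrow> 'n uea" where
  "pf_upper i j = (let m = CARD('n) div 2 in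
     uea_scal ((-1) ^ (position i + position j) * (2 * of_nat m / (\<i> ^ m * 2 ^ m * fact m))) *
       pf_sum (UNIV - {i, j}))"

definition pf_elem :: "'n::{finite,linorder} \<Rightarrow> 'n \<Rightarrow> 'n uea" where
  "pf_elem i j = (if i = j then pf else if i < j then pf_upper i j else - pf_upper j i)"


section \<open>Associated bundles\<close>

definition frame_act :: "('n::finite \<Rightarrow> 'a tvec) \<Rightarrow> real^'n^'n \<Rightarrow> 'n \<Rightarrow> 'a tvec" where
  "frame_act b h j = (\<lambda>f. \<Sum>i\<in>UNIV. b i f * h $ i $ j)"

text \<open>
  A point of the bundle associated to \<open>\<pi>\<close> is an equivalence class of pairs of a frame and a vector,
  where \<open>(b h, v)\<close> is equivalent to \<open>(b, \<pi>(h) v)\<close> for \<open>h\<close> in the special orthogonal group.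
\<close>

type_synonym ('a, 'n, 'd) assoc_pt = "(('n \<Rightarrow> 'a tvec) \<times> (complex^'d)) set"

definition assoc_class ::
  "(real^'n^'n \<Rightarrow> complex^'d^'d) \<Rightarrow> ('n::finite \<Rightarrow> 'a tvec) \<Rightarrow> complex^'d \<Rightarrow> ('a, 'n, 'd::finite) assoc_pt"
where
  "assoc_class \<pi> b v = {(b', \<pi> h *v v) | b' h. h \<in> SO_group \<and> frame_act b' h = b}"

definition assoc_fibre ::
  "('a::topological_space, 'n::finite) chart set \<Rightarrow> ('a \<Rightarrow> 'a tvec \<Rightarrow> 'a tvec \<Rightarrow> real) \<Rightarrow>
   (real^'n^'n \<Rightarrow> complex^'d^'d) \<Rightarrow> 'a \<Rightarrow> ('a, 'n, 'd::finite) assoc_pt set" where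
  "assoc_fibre A g \<pi> p = {assoc_class \<pi> b v | b v. oriented_orthonormal_basis A g p b}"

text \<open>The identification of a fibre with the representation space given by a frame.\<close>

definition frame_coord ::
  "('n::finite \<Rightarrow> 'a tvec) \<Rightarrow> ('a, 'n, 'd::finite) assoc_pt \<Rightarrow> complex^'d" where
  "frame_coord b \<xi> = (THE v. (b, v) \<in> \<xi>)"

definition assoc_diff ::
  "('a, 'n::finite, 'd::finite) assoc_pt \<Rightarrow> ('a, 'n, 'd) assoc_pt \<Rightarrow> ('a, 'n, 'd) assoc_pt" where
  "assoc_diff \<xi> \<eta> = {(b, v - w) | b v w. (b, v) \<in> \<xi> \<and> (b, w) \<in> \<eta>}"

definition smooth_section ::
  "('a::topological_space, 'n::finite) chart set \<Rightarrow> ('a \<Rightarrow> 'a tvec \<Rightarrow> 'a tvec \<Rightarrow> real) \<Rightarrow>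
   (real^'n^'n \<Rightarrow> complex^'d^'d) \<Rightarrow> 'a set \<Rightarrow> ('a \<Rightarrow> ('a, 'n, 'd::finite) assoc_pt) \<Rightarrow> bool" where
  "smooth_section A g \<pi> U \<psi> \<longleftrightarrow> open U \<and> (\<forall>p\<in>U. \<psi> p \<in> assoc_fibre A g \<pi> p) \<and>
     (\<forall>V e. V \<subseteq> U \<and> local_frame A g V e \<longrightarrow>
        msmooth A V (\<lambda>p. frame_coord (\<lambda>i. e i p) (\<psi> p)))"

definition tvec_deriv :: "'a tvec \<Rightarrow> ('a \<Rightarrow> complex^'d) \<Rightarrow> complex^'d" where
  "tvec_deriv v \<phi> = (\<chi> a. Complex (v (\<lambda>q. Re (\<phi> q $ a))) (v (\<lambda>q. Im (\<phi> q $ a))))"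

text \<open>
  The connection matrix of a frame: column \<open>k\<close> contains the components of the covariant derivative
  of \<open>e_k\<close>.
\<close>

definition connection_matrix ::
  "('a \<Rightarrow> 'a tvec \<Rightarrow> 'a tvec \<Rightarrow> real) \<Rightarrow> ('a \<Rightarrow> 'a tvec \<Rightarrow> 'a vfield \<Rightarrow> 'a tvec) \<Rightarrow>
   ('n::finite \<Rightarrow> 'a vfield) \<Rightarrow> 'a \<Rightarrow> 'a tvec \<Rightarrow> real^'n^'n" where
  "connection_matrix g nabla e p v = (\<chi> l k. g p (nabla p v (e k)) (e l p))"

text \<open>
  \<open>D\<close> is the covariant derivative on the associated bundle induced by \<open>nabla\<close>: a section with
  component function \<open>\<phi>\<close> in a local frame \<open>e\<close> has the derivative \<open>v(\<phi>) + \<pi>(\<omega>(v)) \<phi>\<close> in this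
  frame, where \<open>\<omega>\<close> is the connection form of \<open>e\<close>.  This class is the same for all local frames,
  as the connection form transforms by \<open>h\<inverse> \<omega> h + h\<inverse> dh\<close> when \<open>e\<close> is replaced by \<open>e h\<close>.
\<close>

definition induced_connection ::
  "('a::topological_space, 'n::finite) chart set \<Rightarrow> ('a \<Rightarrow> 'a tvec \<Rightarrow> 'a tvec \<Rightarrow> real) \<Rightarrow>
   ('a \<Rightarrow> 'a tvec \<Rightarrow> 'a vfield \<Rightarrow> 'a tvec) \<Rightarrow> (real^'n^'n \<Rightarrow> complex^'d^'d) \<Rightarrow>
   ('a \<Rightarrow> 'a tvec \<Rightarrow> ('a \<Rightarrow> ('a, 'n, 'd::finite) assoc_pt) \<Rightarrow> ('a, 'n, 'd) assoc_pt) \<Rightarrow> bool" where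
  "induced_connection A g nabla \<pi> D \<longleftrightarrow>
     (\<forall>U e \<psi> p v.
        local_frame A g U e \<and> smooth_section A g \<pi> U \<psi> \<and> p \<in> U \<and> v \<in> tangent_space A p \<longrightarrow>
        D p v \<psi> = assoc_class \<pi> (\<lambda>i. e i p)
          (let \<phi> = (\<lambda>q. frame_coord (\<lambda>i. e i q) (\<psi> q)) in
           tvec_deriv v \<phi> + drep \<pi> (connection_matrix g nabla e p v) *v \<phi> p))"

definition second_cov ::
  "('a \<Rightarrow> 'a tvec \<Rightarrow> 'a vfield \<Rightarrow> 'a tvec) \<Rightarrow>
   ('a \<Rightarrow> 'a tvec \<Rightarrow> ('a \<Rightarrow> ('a, 'n, 'd) assoc_pt) \<Rightarrow> ('a, 'n::finite, 'd::finite) assoc_pt) \<Rightarrow>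
   'a vfield \<Rightarrow> 'a vfield \<Rightarrow> ('a \<Rightarrow> ('a, 'n, 'd) assoc_pt) \<Rightarrow> 'a \<Rightarrow> ('a, 'n, 'd) assoc_pt" where
  "second_cov nabla D X Y \<psi> p =
     assoc_diff (D p (X p) (\<lambda>q. D q (Y q) \<psi>)) (D p (nabla p (X p) Y) \<psi>)"

definition bundle_curvature ::
  "('a \<Rightarrow> 'a tvec \<Rightarrow> 'a vfield \<Rightarrow> 'a tvec) \<Rightarrow>
   ('a \<Rightarrow> 'a tvec \<Rightarrow> ('a \<Rightarrow> ('a, 'n, 'd) assoc_pt) \<Rightarrow> ('a, 'n::finite, 'd::finite) assoc_pt) \<Rightarrow>
   'a vfield \<Rightarrow> 'a vfield \<Rightarrow> ('a \<Rightarrow> ('a, 'n, 'd) assoc_pt) \<Rightarrow> 'a \<Rightarrow> ('a, 'n, 'd) assoc_pt" where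
  "bundle_curvature nabla D X Y \<psi> p =
     assoc_diff (second_cov nabla D X Y \<psi> p) (second_cov nabla D Y X \<psi> p)"

definition pf_curvature ::
  "('a \<Rightarrow> 'a tvec \<Rightarrow> 'a vfield \<Rightarrow> 'a tvec) \<Rightarrow> (real^('n::{finite,linorder})^('n::{finite,linorder}) \<Rightarrow> complex^'d^'d) \<Rightarrow>
   ('a \<Rightarrow> 'a tvec \<Rightarrow> ('a \<Rightarrow> ('a, 'n, 'd) assoc_pt) \<Rightarrow> ('a, 'n, 'd::finite) assoc_pt) \<Rightarrow>
   ('n \<Rightarrow> 'a vfield) \<Rightarrow> ('a \<Rightarrow> ('a, 'n, 'd) assoc_pt) \<Rightarrow> 'a \<Rightarrow> ('a, 'n, 'd) assoc_pt" where
  "pf_curvature nabla \<pi> D e \<psi> p = assoc_class \<pi> (\<lambda>i. e i p)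
     (\<Sum>i\<in>UNIV. \<Sum>j\<in>UNIV. uea_rep \<pi> (pf_elem i j) *v
        frame_coord (\<lambda>i. e i p) (bundle_curvature nabla D (e i) (e j) \<psi> p))"

end

theory Submission
  imports Defs
begin

text \<open>
  Everything happens in a fixed frame at one point.  There are three ingredients.

  \<^emph>\<open>The curvature acts through the Lie algebra.\<close>  In a frame with connection form \<open>\<omega>\<close> the induced
  covariant derivative is \<open>d + \<pi>(\<omega>)\<close>, so its curvature is \<open>\<pi>\<close> applied to \<open>d\<omega> + \<omega> \<and> \<omega>\<close>, whose entries are the
  \<open>R_ijkl\<close> (\<open>frame_coord_curvature\<close>).  This requires that the differential of a continuous unitary
  representation of the special orthogonal group is a homomorphism of Lie algebras.  It exists by
  integration of one-parameter groups, it is additive by the Trotter product formula, where unitarity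
  supplies the bounds, and it preserves brackets because these are derivatives of conjugations
  (\<open>drep_add\<close>, \<open>drep_bracket\<close>).  The same property makes the extension to the enveloping algebra well defined
  and multiplicative.

  \<^emph>\<open>A Pfaffian is expanded along a row.\<close>  Let \<open>C_ik\<close> be the sum over \<open>j \<noteq> i\<close> of \<open>pf_ij e_kj\<close>.  The factors of
  each term of \<open>pf\<close> have disjoint indices and commute, which gives \<open>C_ii = -pf\<close>.  For \<open>i \<noteq> k\<close> the index \<open>k\<close>
  occurs twice in each term of \<open>C_ik\<close>; antisymmetry leaves a commutator \<open>[e_kl, e_kj] = e_lj\<close>, which does
  not involve \<open>k\<close>, while exchanging \<open>i\<close> and \<open>k\<close> changes the sign of the permutation.  Hence \<open>C_ik = -C_ki\<close>
  (\<open>pf_row_diag\<close>, \<open>pf_row_antisym\<close>).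

  \<^emph>\<open>The curvature tensor is decomposed.\<close>  In the contraction of \<open>pf_ij e_kl\<close> with \<open>R = W + K + S\<close> the part \<open>K\<close>
  contributes a multiple of the sum of \<open>E_ik C_ik\<close>.  The Ricci tensor is symmetric by the first Bianchi
  identity, so \<open>E\<close> is symmetric, and it has trace zero; thus this sum is \<open>-tr(E) pf = 0\<close>.  The part \<open>S\<close>
  contributes a multiple of the sum of the \<open>C_ii\<close>, which is the scalar curvature term
  (\<open>weyl_contraction\<close>).
\<close>

section \<open>Smooth functions\<close>

text \<open>
  Smoothness is a greatest fixed point, but the derivative of a product is a sum of products, to which
  coinduction does not apply directly.  Induction on the order of differentiability has no such problem.
\<close>

primrec differentiable_order ::
  "nat \<Rightarrow> 'a::real_normed_vector set \<Rightarrow> ('a \<Rightarrow> 'b::real_normed_vector) \<Rightarrow> bool" where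
  "differentiable_order 0 S f \<longleftrightarrow> True"
| "differentiable_order (Suc k) S f \<longleftrightarrow> f differentiable_on S \<and>
     (\<forall>v. differentiable_order k S (\<lambda>x. frechet_derivative f (at x) v))"

lemma smooth_on_iff_differentiable_order:
  "smooth_on S f \<longleftrightarrow> (\<forall>k. differentiable_order k S f)"
proof (intro iffI allI)
  fix k
  show "smooth_on S f \<Longrightarrow> differentiable_order k S f"
  proof (induction k arbitrary: f)
    case (Suc k)
    from Suc.prems show ?case
      by (cases rule: smooth_on.cases) (auto intro: Suc.IH)
  qed simp
next
  show "\<forall>k. differentiable_order k S f \<Longrightarrow> smooth_on S f"
  proof (coinduction arbitrary: f rule: smooth_on.coinduct)
    case (smooth_on f)
    then have "\<And>k. differentiable_order (Suc k) S f" by blast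
    then show ?case by auto
  qed
qed

lemma differentiable_order_cong:
  assumes "open S" "\<And>x. x \<in> S \<Longrightarrow> f x = g x" "differentiable_order k S f"
  shows "differentiable_order k S g"
  using assms(2,3)
proof (induction k arbitrary: f g)
  case (Suc k)
  have df: "f differentiable at x" if "x \<in> S" for x
    using Suc.prems(2) that \<open>open S\<close> by (auto simp: differentiable_on_eq_differentiable_at)
  have "g differentiable_on S"
    using Suc.prems \<open>open S\<close> by (auto simp: differentiable_on_def intro: differentiable_transform_within[OF _ zero_less_one])
  moreover have "differentiable_order k S (\<lambda>x. frechet_derivative g (at x) v)" for v
  proof (rule Suc.IH)
    show "differentiable_order k S (\<lambda>x. frechet_derivative f (at x) v)" using Suc.prems by auto
    show "frechet_derivative f (at x) v = frechet_derivative g (at x) v" if "x \<in> S" for x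
      using frechet_derivative_transform_within_open[OF df[OF that] \<open>open S\<close> that Suc.prems(1)] by simp
  qed
  ultimately show ?case by simp
qed simp

lemma differentiable_order_subset:
  "differentiable_order k S f \<Longrightarrow> T \<subseteq> S \<Longrightarrow> differentiable_order k T f"
  by (induction k arbitrary: f) (auto intro: differentiable_on_subset)

lemma differentiable_order_pred:
  "differentiable_order (Suc k) S f \<Longrightarrow> differentiable_order k S f"
  by (induction k arbitrary: f) auto

lemma differentiable_order_const: "open S \<Longrightarrow> differentiable_order k S (\<lambda>x. c)"
  by (induction k arbitrary: c) auto

lemma differentiable_order_bounded_linear:
  assumes "open S" "bounded_linear L"
  shows "differentiable_order k S f \<Longrightarrow> differentiable_order k S (\<lambda>x. L (f x))"
proof (induction k arbitrary: f)
  case (Suc k)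
  have D: "((\<lambda>x. L (f x)) has_derivative (\<lambda>h. L (frechet_derivative f (at x) h))) (at x)" if "x \<in> S" for x
    using Suc.prems that \<open>open S\<close>
    by (intro bounded_linear.has_derivative[OF assms(2)])
       (auto simp: differentiable_on_eq_differentiable_at frechet_derivative_works[symmetric])
  have "differentiable_order k S (\<lambda>x. frechet_derivative (\<lambda>x. L (f x)) (at x) v)" for v
    by (rule differentiable_order_cong[OF \<open>open S\<close> _ Suc.IH])
       (use Suc.prems in \<open>auto simp: frechet_derivative_at[OF D, symmetric]\<close>)
  moreover have "(\<lambda>x. L (f x)) differentiable_on S"
    using D \<open>open S\<close> by (auto simp: differentiable_on_eq_differentiable_at differentiable_def)
  ultimately show ?case by simp
qed simp

lemma differentiable_order_add:
  assumes "open S"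
  shows "differentiable_order k S f \<Longrightarrow> differentiable_order k S g \<Longrightarrow>
    differentiable_order k S (\<lambda>x. f x + g x)"
proof (induction k arbitrary: f g)
  case (Suc k)
  have D: "((\<lambda>x. f x + g x) has_derivative
      (\<lambda>h. frechet_derivative f (at x) h + frechet_derivative g (at x) h)) (at x)" if "x \<in> S" for x
    using Suc.prems that \<open>open S\<close>
    by (intro has_derivative_add)
       (auto simp: differentiable_on_eq_differentiable_at frechet_derivative_works[symmetric])
  have "differentiable_order k S (\<lambda>x. frechet_derivative (\<lambda>x. f x + g x) (at x) v)" for v
    by (rule differentiable_order_cong[OF \<open>open S\<close> _ Suc.IH])
       (use Suc.prems in \<open>auto simp: frechet_derivative_at[OF D, symmetric]\<close>)
  moreover have "(\<lambda>x. f x + g x) differentiable_on S"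
    using D \<open>open S\<close> by (auto simp: differentiable_on_eq_differentiable_at differentiable_def)
  ultimately show ?case by simp
qed simp

text \<open>
  The derivative is a sum of two products whose factors are differentiable to the next lower order, so
  the induction hypothesis and closure under sums apply.
\<close>

lemma differentiable_order_bounded_bilinear:
  assumes "open S" "bounded_bilinear B"
  shows "differentiable_order k S f \<Longrightarrow> differentiable_order k S g \<Longrightarrow>
    differentiable_order k S (\<lambda>x. B (f x) (g x))"
proof (induction k arbitrary: f g)
  case (Suc k)
  have D: "((\<lambda>x. B (f x) (g x)) has_derivative
      (\<lambda>h. B (f x) (frechet_derivative g (at x) h) + B (frechet_derivative f (at x) h) (g x))) (at x)"
    if "x \<in> S" for x
    using Suc.prems that \<open>open S\<close>
    by (intro bounded_bilinear.FDERIV[OF assms(2)])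
       (auto simp: differentiable_on_eq_differentiable_at frechet_derivative_works[symmetric])
  have "differentiable_order k S (\<lambda>x. frechet_derivative (\<lambda>x. B (f x) (g x)) (at x) v)" for v
    by (rule differentiable_order_cong[OF \<open>open S\<close> _
          differentiable_order_add[OF \<open>open S\<close> Suc.IH Suc.IH]])
       (use Suc.prems in \<open>auto simp: frechet_derivative_at[OF D, symmetric] intro: differentiable_order_pred simp del: differentiable_order.simps(2)\<close>,
        use Suc.prems in \<open>auto intro: differentiable_order_pred\<close>)
  moreover have "(\<lambda>x. B (f x) (g x)) differentiable_on S"
    using D \<open>open S\<close> by (auto simp: differentiable_on_eq_differentiable_at differentiable_def)
  ultimately show ?case by simp
qed simp

section \<open>Smooth functions on a manifold\<close>

locale smooth_manifold =
  fixes A :: "('a::topological_space, 'n::finite) chart set"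
  assumes smooth_atlas: "smooth_atlas A"
begin

lemma open_chart_image:
  assumes "(V, \<phi>) \<in> A" "open U"
  shows "open (\<phi> ` (U \<inter> V))"
proof -
  from smooth_atlas assms(1)
  have "open V" "open (\<phi> ` V)" "homeomorphism V (\<phi> ` V) \<phi> (inv_into V \<phi>)"
    by (auto simp: smooth_atlas_def)
  moreover have "openin (top_of_set V) (U \<inter> V)"
    using \<open>open U\<close> by (auto simp: openin_open)
  ultimately show ?thesis
    using homeomorphism_imp_open_map openin_open_trans by blast
qed

lemma chart_inverse:
  assumes "(V, \<phi>) \<in> A" "y \<in> \<phi> ` (U \<inter> V)"
  shows "inv_into V \<phi> y \<in> U"
proof -
  from smooth_atlas assms(1) have "homeomorphism V (\<phi> ` V) \<phi> (inv_into V \<phi>)"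
    by (auto simp: smooth_atlas_def)
  with assms(2) show ?thesis by (auto simp: homeomorphism_def)
qed

lemma msmooth_iff:
  "msmooth A U f \<longleftrightarrow> open U \<and>
     (\<forall>k. \<forall>(V, \<phi>)\<in>A. differentiable_order k (\<phi> ` (U \<inter> V)) (\<lambda>y. f (inv_into V \<phi> y)))"
  by (auto simp: msmooth_def smooth_on_iff_differentiable_order o_def)

lemma msmooth_cong:
  assumes "msmooth A U f" "\<And>q. q \<in> U \<Longrightarrow> f q = g q"
  shows "msmooth A U g"
  unfolding msmooth_iff
proof (intro conjI allI ballI)
  show "open U" using assms(1) by (simp add: msmooth_def)
  fix k VP assume "VP \<in> A"
  then obtain V \<phi> where VP: "VP = (V, \<phi>)" "(V, \<phi>) \<in> A" by (cases VP) auto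
  have "differentiable_order k (\<phi> ` (U \<inter> V)) (\<lambda>y. g (inv_into V \<phi> y))"
    by (rule differentiable_order_cong[where f = "\<lambda>y. f (inv_into V \<phi> y)"])
       (use VP assms \<open>open U\<close> open_chart_image chart_inverse in \<open>auto simp: msmooth_iff\<close>)
  then show "case VP of (V, \<phi>) \<Rightarrow> differentiable_order k (\<phi> ` (U \<inter> V)) (\<lambda>y. g (inv_into V \<phi> y))"
    by (simp add: VP)
qed

lemma msmooth_subset: "msmooth A U f \<Longrightarrow> open V \<Longrightarrow> V \<subseteq> U \<Longrightarrow> msmooth A V f"
  unfolding msmooth_iff
  by (fastforce elim!: differentiable_order_subset)

lemma msmooth_const: "open U \<Longrightarrow> msmooth A U (\<lambda>q. c)"
  using open_chart_image by (auto simp: msmooth_iff intro!: differentiable_order_const)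

lemma msmooth_bounded_linear:
  "bounded_linear L \<Longrightarrow> msmooth A U f \<Longrightarrow> msmooth A U (\<lambda>q. L (f q))"
  using open_chart_image
  by (auto simp: msmooth_iff intro!: differentiable_order_bounded_linear[of _ L])

lemma msmooth_add: "msmooth A U f \<Longrightarrow> msmooth A U g \<Longrightarrow> msmooth A U (\<lambda>q. f q + g q)"
  using open_chart_image by (auto simp: msmooth_iff intro!: differentiable_order_add)

lemma msmooth_bounded_bilinear:
  "bounded_bilinear B \<Longrightarrow> msmooth A U f \<Longrightarrow> msmooth A U g \<Longrightarrow> msmooth A U (\<lambda>q. B (f q) (g q))"
  using open_chart_image
  by (auto simp: msmooth_iff intro!: differentiable_order_bounded_bilinear[of _ B])

lemma msmooth_sum:
  "open U \<Longrightarrow> (\<And>i. i \<in> I \<Longrightarrow> msmooth A U (f i)) \<Longrightarrow> msmooth A U (\<lambda>q. \<Sum>i\<in>I. f i q)"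
  by (induction I rule: infinite_finite_induct) (auto intro!: msmooth_add msmooth_const)

lemma msmooth_euclidean:
  fixes F :: "'a \<Rightarrow> 'b::euclidean_space"
  assumes "open U" "\<And>b. b \<in> Basis \<Longrightarrow> msmooth A U (\<lambda>q. F q \<bullet> b)"
  shows "msmooth A U F"
proof -
  have "msmooth A U (\<lambda>q. \<Sum>b\<in>Basis. (F q \<bullet> b) *\<^sub>R b)"
    by (intro msmooth_sum msmooth_bounded_linear[OF bounded_linear_scaleR_left] assms)
  then show ?thesis by (simp add: euclidean_representation)
qed

lemma msmooth_inner: "msmooth A U F \<Longrightarrow> msmooth A U (\<lambda>q. F q \<bullet> b)"
  by (rule msmooth_bounded_linear[OF bounded_linear_inner_left])

lemma msmooth_imp_at: "msmooth A U f \<Longrightarrow> p \<in> U \<Longrightarrow> msmooth_at A p f"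
  by (auto simp: msmooth_at_def)

section \<open>Derivations\<close>

lemma tangent_add:
  "v \<in> tangent_space A p \<Longrightarrow> msmooth_at A p f \<Longrightarrow> msmooth_at A p h \<Longrightarrow> v (\<lambda>q. f q + h q) = v f + v h"
  and tangent_mult:
  "v \<in> tangent_space A p \<Longrightarrow> msmooth_at A p f \<Longrightarrow> msmooth_at A p h \<Longrightarrow>
     v (\<lambda>q. f q * h q) = v f * h p + f p * v h"
  and tangent_scale: "v \<in> tangent_space A p \<Longrightarrow> msmooth_at A p f \<Longrightarrow> v (\<lambda>q. c * f q) = c * v f"
  and tangent_not_smooth: "v \<in> tangent_space A p \<Longrightarrow> \<not> msmooth_at A p f \<Longrightarrow> v f = 0"
  by (auto simp: tangent_space_def)

lemma tangent_space_combination: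
  assumes "v \<in> tangent_space A p" "w \<in> tangent_space A p"
  shows "(\<lambda>f. a * v f + b * w f) \<in> tangent_space A p"
  using assms unfolding tangent_space_def mem_Collect_eq
  by (auto simp: algebra_simps)

lemma tangent_space_zero: "(\<lambda>f. 0) \<in> tangent_space A p"
  by (auto simp: tangent_space_def)

lemma tangent_space_sum:
  assumes "\<And>i. i \<in> I \<Longrightarrow> v i \<in> tangent_space A p"
  shows "(\<lambda>f. \<Sum>i\<in>I. c i * v i f) \<in> tangent_space A p"
  using assms
proof (induction I rule: infinite_finite_induct)
  case (insert x F)
  have "(\<lambda>f. c x * v x f + 1 * (\<Sum>i\<in>F. c i * v i f)) \<in> tangent_space A p"
    using insert by (intro tangent_space_combination) auto
  then show ?case using insert by simp
qed (auto simp: tangent_space_zero)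

text \<open>
  A function that vanishes near the point is its own product with the indicator function of its
  support; both factors vanish at the point, so the Leibniz rule applies.
\<close>

lemma tangent_local_zero:
  assumes v: "v \<in> tangent_space A p" and U: "open U" "p \<in> U" and f: "\<And>q. q \<in> U \<Longrightarrow> f q = 0"
  shows "v f = 0"
proof -
  let ?h = "\<lambda>q. if q \<in> U then 0 else 1 :: real"
  have "msmooth A U f" "msmooth A U ?h"
    using f by (auto intro: msmooth_cong[OF msmooth_const[OF U(1), of 0]])
  then have "v (\<lambda>q. f q * ?h q) = v f * ?h p + f p * v ?h"
    using U by (intro tangent_mult[OF v]) (auto intro: msmooth_imp_at)
  moreover have "(\<lambda>q. f q * ?h q) = f"
    using f by auto
  ultimately show ?thesis using U f by simp
qed

text \<open>
  A derivation depends on the germ only; functions such as the components of a section are known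
  only on the domain of a frame and are arbitrary elsewhere.
\<close>

lemma tangent_cong:
  assumes v: "v \<in> tangent_space A p" and f: "msmooth A U f" "p \<in> U"
    and eq: "\<And>q. q \<in> U \<Longrightarrow> f q = h q"
  shows "v f = v h"
proof -
  have U: "open U" using f by (simp add: msmooth_def)
  have h: "msmooth A U h" using msmooth_cong[OF f(1) eq] .
  have d: "msmooth A U (\<lambda>q. h q - f q)"
    using msmooth_cong[OF msmooth_const[OF U, of 0], of "\<lambda>q. h q - f q"] eq by simp
  have "v (\<lambda>q. f q + (h q - f q)) = v f + v (\<lambda>q. h q - f q)"
    by (rule tangent_add[OF v]) (use f d in \<open>auto intro: msmooth_imp_at\<close>)
  moreover have "v (\<lambda>q. h q - f q) = 0"
    by (rule tangent_local_zero[OF v U f(2)]) (use eq in auto)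
  ultimately show ?thesis by simp
qed

lemma tangent_const: 
  assumes v: "v \<in> tangent_space A p" shows "v (\<lambda>q. c) = 0"
proof -
  have s: "msmooth_at A p (\<lambda>q. 1)" by (rule msmooth_imp_at[OF msmooth_const[OF open_UNIV]]) simp
  have "v (\<lambda>q. 1 * 1) = v (\<lambda>q. 1) * 1 + 1 * v (\<lambda>q. 1)" by (rule tangent_mult[OF v s s])
  then have "v (\<lambda>q. 1) = 0" by simp
  then show ?thesis using tangent_scale[OF v s, of c] by simp
qed

lemma tangent_sum:
  assumes v: "v \<in> tangent_space A p" and "open U" "p \<in> U" and "\<And>i. i \<in> I \<Longrightarrow> msmooth A U (f i)"
  shows "v (\<lambda>q. \<Sum>i\<in>I. f i q) = (\<Sum>i\<in>I. v (f i))"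
  using assms(4)
proof (induction I rule: infinite_finite_induct)
  case (insert x F)
  have "v (\<lambda>q. f x q + (\<Sum>i\<in>F. f i q)) = v (f x) + v (\<lambda>q. \<Sum>i\<in>F. f i q)"
    using insert.prems assms(2,3)
    by (intro tangent_add[OF v]) (auto intro!: msmooth_imp_at[where U = U] msmooth_sum)
  then show ?case using insert by simp
qed (auto simp: tangent_const[OF v])

lemma tangent_diff:
  assumes v: "v \<in> tangent_space A p" and f: "msmooth A U f" "msmooth A U h" "p \<in> U"
  shows "v (\<lambda>q. f q - h q) = v f - v h"
proof -
  have h: "msmooth A U (\<lambda>q. (-1) * h q)"
    by (rule msmooth_bounded_linear[OF bounded_linear_mult_right f(2)])
  have "v (\<lambda>q. f q + (-1) * h q) = v f + v (\<lambda>q. (-1) * h q)"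
    by (rule tangent_add[OF v msmooth_imp_at[OF f(1,3)] msmooth_imp_at[OF h f(3)]])
  also have "v (\<lambda>q. (-1) * h q) = (-1) * v h"
    by (rule tangent_scale[OF v msmooth_imp_at[OF f(2,3)]])
  finally show ?thesis by simp
qed

lemma msmooth_diff: "msmooth A U f \<Longrightarrow> msmooth A U g \<Longrightarrow> msmooth A U (\<lambda>q. f q - g q)"
  using msmooth_add[OF _ msmooth_bounded_linear[OF bounded_linear_minus[OF bounded_linear_ident]], of U f g]
  by simp

end

text \<open>
  For complex column vectors this is \<^const>\<open>tvec_deriv\<close>.  In this generality one Leibniz rule covers
  products of matrices, of matrices with vectors, and of scalars.
\<close>

definition vderiv :: "'a tvec \<Rightarrow> ('a \<Rightarrow> 'b::euclidean_space) \<Rightarrow> 'b" where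
  "vderiv v F = (\<Sum>b\<in>Basis. v (\<lambda>q. F q \<bullet> b) *\<^sub>R b)"

lemma vderiv_inner: "b \<in> Basis \<Longrightarrow> vderiv v F \<bullet> b = v (\<lambda>q. F q \<bullet> b)"
  unfolding vderiv_def by (simp add: inner_sum_left_Basis)

context smooth_manifold
begin

lemma vderiv_cong:
  assumes "v \<in> tangent_space A p" "msmooth A U F" "p \<in> U" "\<And>q. q \<in> U \<Longrightarrow> F q = G q"
  shows "vderiv v F = vderiv v G"
  unfolding vderiv_def
  by (intro sum.cong refl arg_cong2[where f = "(*\<^sub>R)"] tangent_cong[OF assms(1) msmooth_inner[OF assms(2)]])
     (use assms in auto)

lemma vderiv_bounded_linear:
  fixes L :: "'b::euclidean_space \<Rightarrow> 'c::euclidean_space"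
  assumes v: "v \<in> tangent_space A p" and L: "bounded_linear L" and F: "msmooth A U F" "p \<in> U"
  shows "vderiv v (\<lambda>q. L (F q)) = L (vderiv v F)"
proof (rule euclidean_eqI)
  fix c :: 'c assume c: "c \<in> Basis"
  have U: "open U" using F by (simp add: msmooth_def)
  interpret L: bounded_linear L by fact
  have eq: "L (F q) \<bullet> c = (\<Sum>b\<in>Basis. (L b \<bullet> c) * (F q \<bullet> b))" for q
  proof -
    have "L (F q) = L (\<Sum>b\<in>Basis. (F q \<bullet> b) *\<^sub>R b)" by (simp add: euclidean_representation)
    then show ?thesis by (simp add: L.sum L.scaleR inner_sum_left algebra_simps)
  qed
  have "vderiv v (\<lambda>q. L (F q)) \<bullet> c = v (\<lambda>q. \<Sum>b\<in>Basis. (L b \<bullet> c) * (F q \<bullet> b))"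
    by (simp add: vderiv_inner c eq)
  also have "\<dots> = (\<Sum>b\<in>Basis. v (\<lambda>q. (L b \<bullet> c) * (F q \<bullet> b)))"
    by (intro tangent_sum[OF v U F(2)] msmooth_bounded_linear[OF bounded_linear_mult_right] msmooth_inner F)
  also have "\<dots> = (\<Sum>b\<in>Basis. (L b \<bullet> c) * v (\<lambda>q. F q \<bullet> b))"
    by (intro sum.cong refl tangent_scale[OF v] msmooth_imp_at[OF _ F(2)] msmooth_inner F)
  also have "\<dots> = L (vderiv v F) \<bullet> c"
    unfolding vderiv_def by (simp add: L.sum L.scaleR inner_sum_left algebra_simps)
  finally show "vderiv v (\<lambda>q. L (F q)) \<bullet> c = L (vderiv v F) \<bullet> c" .
qed

lemma vderiv_sum:
  fixes F :: "'i \<Rightarrow> 'a \<Rightarrow> 'b::euclidean_space"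
  assumes v: "v \<in> tangent_space A p" and U: "open U" "p \<in> U" and F: "\<And>i. i \<in> I \<Longrightarrow> msmooth A U (F i)"
  shows "vderiv v (\<lambda>q. \<Sum>i\<in>I. F i q) = (\<Sum>i\<in>I. vderiv v (F i))"
proof (rule euclidean_eqI)
  fix b :: 'b assume b: "b \<in> Basis"
  have "v (\<lambda>q. \<Sum>i\<in>I. F i q \<bullet> b) = (\<Sum>i\<in>I. v (\<lambda>q. F i q \<bullet> b))"
    by (intro tangent_sum[OF v U] msmooth_inner F)
  then show "vderiv v (\<lambda>q. \<Sum>i\<in>I. F i q) \<bullet> b = (\<Sum>i\<in>I. vderiv v (F i)) \<bullet> b"
    by (simp add: vderiv_inner b inner_sum_left)
qed

lemma vderiv_add:
  fixes F :: "'a \<Rightarrow> 'b::euclidean_space"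
  assumes v: "v \<in> tangent_space A p" and F: "msmooth A U F" "msmooth A U G" "p \<in> U"
  shows "vderiv v (\<lambda>q. F q + G q) = vderiv v F + vderiv v G"
proof -
  have "v (\<lambda>q. F q \<bullet> b + G q \<bullet> b) = v (\<lambda>q. F q \<bullet> b) + v (\<lambda>q. G q \<bullet> b)" for b
    by (intro tangent_add[OF v] msmooth_imp_at[OF _ F(3)] msmooth_inner F)
  then show ?thesis by (simp add: vderiv_def inner_add_left scaleR_add_left sum.distrib)
qed

text \<open>
  Expanding the first factor in the basis reduces the statement to products of a real function and a
  vector-valued function.
\<close>

lemma vderiv_bounded_bilinear:
  fixes F :: "'a \<Rightarrow> 'b::euclidean_space" and G :: "'a \<Rightarrow> 'c::euclidean_space"
    and B :: "'b \<Rightarrow> 'c \<Rightarrow> 'd::euclidean_space"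
  assumes v: "v \<in> tangent_space A p" and B: "bounded_bilinear B"
    and F: "msmooth A U F" "msmooth A U G" "p \<in> U"
  shows "vderiv v (\<lambda>q. B (F q) (G q)) = B (vderiv v F) (G p) + B (F p) (vderiv v G)"
proof -
  interpret B: bounded_bilinear B by fact
  have U: "open U" using F by (simp add: msmooth_def)
  have eq: "B x y = (\<Sum>b\<in>Basis. (x \<bullet> b) *\<^sub>R B b y)" for x y
  proof -
    have "B x y = B (\<Sum>b\<in>Basis. (x \<bullet> b) *\<^sub>R b) y" by (simp add: euclidean_representation)
    then show ?thesis by (simp add: B.sum_left B.scaleR_left)
  qed
  have sc: "vderiv v (\<lambda>q. f q *\<^sub>R H q) = v f *\<^sub>R H p + f p *\<^sub>R vderiv v H"
    if "msmooth A U f" "msmooth A U H" for f and H :: "'a \<Rightarrow> 'd"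
  proof -
    have "v (\<lambda>q. f q * (H q \<bullet> b)) = v f * (H p \<bullet> b) + f p * v (\<lambda>q. H q \<bullet> b)" for b
      by (intro tangent_mult[OF v] msmooth_imp_at[OF _ F(3)] msmooth_inner that)
    then have "vderiv v (\<lambda>q. f q *\<^sub>R H q) =
        v f *\<^sub>R (\<Sum>b\<in>Basis. (H p \<bullet> b) *\<^sub>R b) + f p *\<^sub>R vderiv v H"
      by (simp add: vderiv_def scaleR_add_left sum.distrib scaleR_sum_right)
    then show ?thesis by (simp add: euclidean_representation)
  qed
  have sm: "msmooth A U (\<lambda>q. B b (G q))" for b
    by (intro msmooth_bounded_linear[OF B.bounded_linear_right] F)
  have "vderiv v (\<lambda>q. B (F q) (G q)) = vderiv v (\<lambda>q. \<Sum>b\<in>Basis. (F q \<bullet> b) *\<^sub>R B b (G q))"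
    using eq[of "F _" "G _"] by simp
  also have "\<dots> = (\<Sum>b\<in>Basis. vderiv v (\<lambda>q. (F q \<bullet> b) *\<^sub>R B b (G q)))"
    by (intro vderiv_sum[OF v U F(3)] msmooth_bounded_bilinear[OF bounded_bilinear_scaleR]
        msmooth_inner F sm)
  also have "\<dots> = (\<Sum>b\<in>Basis. (vderiv v F \<bullet> b) *\<^sub>R B b (G p) + (F p \<bullet> b) *\<^sub>R B b (vderiv v G))"
    using sc[OF msmooth_inner[OF F(1)] sm]
    by (intro sum.cong refl)
       (simp add: vderiv_inner vderiv_bounded_linear[OF v B.bounded_linear_right F(2,3)])
  also have "\<dots> = B (vderiv v F) (G p) + B (F p) (vderiv v G)"
    by (simp add: sum.distrib flip: eq)
  finally show ?thesis .
qed

lemma vector_field_on_subset: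
  "vector_field_on A U X \<Longrightarrow> open V \<Longrightarrow> V \<subseteq> U \<Longrightarrow> vector_field_on A V X"
  unfolding vector_field_on_def by blast

lemma vector_field_msmooth_vderiv:
  assumes X: "vector_field_on A U X" and F: "msmooth A U F"
  shows "msmooth A U (\<lambda>q. vderiv (X q) F)"
proof (rule msmooth_euclidean)
  show "open U" using F by (simp add: msmooth_def)
  fix b :: 'b assume "b \<in> Basis"
  then show "msmooth A U (\<lambda>q. vderiv (X q) F \<bullet> b)"
    using X msmooth_inner[OF F, of b] unfolding vector_field_on_def
    by (simp add: vderiv_inner)
qed

end

section \<open>Matrix products and powers\<close>

lemma bounded_bilinear_matrix_mult:
  "bounded_bilinear ((**) ::
     'f::{real_normed_field, euclidean_space}^'n^'m \<Rightarrow> 'f^'p^'n \<Rightarrow> 'f^'p^'m)"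
  unfolding bilinear_conv_bounded_bilinear[symmetric] bilinear_def
  by (auto intro!: linearI
      simp: vec_eq_iff matrix_matrix_mult_def sum.distrib scaleR_sum_right algebra_simps)

lemma bounded_bilinear_matrix_vector_mult:
  "bounded_bilinear ((*v) :: 'f::{real_normed_field, euclidean_space}^'n^'m \<Rightarrow> 'f^'n \<Rightarrow> 'f^'m)"
  unfolding bilinear_conv_bounded_bilinear[symmetric] bilinear_def
  by (auto intro!: linearI
      simp: vec_eq_iff matrix_vector_mult_def sum.distrib scaleR_sum_right algebra_simps)

lemmas matrix_mult_linear =
  bounded_bilinear.add_left[OF bounded_bilinear_matrix_mult]
  bounded_bilinear.add_right[OF bounded_bilinear_matrix_mult]
  bounded_bilinear.diff_left[OF bounded_bilinear_matrix_mult]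
  bounded_bilinear.diff_right[OF bounded_bilinear_matrix_mult]
  bounded_bilinear.minus_left[OF bounded_bilinear_matrix_mult]
  bounded_bilinear.minus_right[OF bounded_bilinear_matrix_mult]
  bounded_bilinear.scaleR_left[OF bounded_bilinear_matrix_mult]
  bounded_bilinear.scaleR_right[OF bounded_bilinear_matrix_mult]

lemma has_vector_derivative_bilinear:
  fixes B :: "'b::real_normed_vector \<Rightarrow> 'c::real_normed_vector \<Rightarrow> 'd::real_normed_vector"
  assumes "bounded_bilinear B"
    "(f has_vector_derivative f') (at t)" "(g has_vector_derivative g') (at t)"
  shows "((\<lambda>t. B (f t) (g t)) has_vector_derivative B (f t) g' + B f' (g t)) (at t)"
proof -
  interpret B: bounded_bilinear B by fact
  show ?thesis
    using B.FDERIV[OF assms(2,3)[unfolded has_vector_derivative_def]]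
    by (simp add: has_vector_derivative_def B.scaleR_left B.scaleR_right scaleR_add_right)
qed

text \<open>
  The library's power on the vector type is componentwise.  This is the iterated product that occurs
  in \<^const>\<open>mat_exp\<close>.
\<close>

definition mpow :: "'f::semiring_1^'n^'n \<Rightarrow> nat \<Rightarrow> 'f^'n^'n" where
  "mpow X k = ((**) X ^^ k) (mat 1)"

lemma mpow_0 [simp]: "mpow X 0 = mat 1"
  and mpow_Suc: "mpow X (Suc k) = X ** mpow X k"
  by (simp_all add: mpow_def)

lemma mpow_Suc_right: "mpow X (Suc k) = mpow X k ** X"
proof (induction k)
  case (Suc k)
  have "mpow X (Suc (Suc k)) = X ** (mpow X k ** X)" by (simp only: mpow_Suc[of X "Suc k"] Suc)
  then show ?case by (simp only: matrix_mul_assoc mpow_Suc)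
qed (simp add: mpow_Suc)

lemma mpow_one [simp]: "mpow (mat 1) k = mat 1"
  by (induction k) (simp_all add: mpow_Suc)

text \<open>
  Bounds for the difference of two large powers follow from this sum as soon as the powers
  themselves stay bounded; no factor grows exponentially.
\<close>

lemma mpow_diff_telescope:
  fixes X Y :: "'f::{real_normed_field, euclidean_space}^'n^'n"
  shows "mpow X n - mpow Y n = (\<Sum>k<n. mpow X k ** (X - Y) ** mpow Y (n - 1 - k))"
proof (induction n)
  case (Suc n)
  have "mpow X (Suc n) - mpow Y (Suc n) = X ** (mpow X n - mpow Y n) + (X - Y) ** mpow Y n"
    by (simp add: mpow_Suc matrix_mult_linear)
  also have "\<dots> = (\<Sum>k<n. mpow X (Suc k) ** (X - Y) ** mpow Y (n - 1 - k)) + (X - Y) ** mpow Y n"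
    by (simp add: Suc.IH bounded_bilinear.sum_right[OF bounded_bilinear_matrix_mult] mpow_Suc
        matrix_mul_assoc)
  also have "\<dots> = (\<Sum>k<Suc n. mpow X k ** (X - Y) ** mpow Y (Suc n - 1 - k))"
    by (subst sum.lessThan_Suc_shift) simp
  finally show ?case .
qed simp

lemma ex_matrix_norm_mult_bound:
  "\<exists>K>0. \<forall>(X :: 'f::{real_normed_field, euclidean_space}^'n^'n) (Y :: 'f^'n^'n).
     norm (X ** Y) \<le> norm X * norm Y * K"
  using bounded_bilinear.pos_bounded[OF bounded_bilinear_matrix_mult] by blast

lemma norm_mpow_diff_le:
  fixes X Y :: "'f::{real_normed_field, euclidean_space}^'n^'n"
  assumes K: "K > 0" "\<And>(X :: 'f^'n^'n) (Y :: 'f^'n^'n). norm (X ** Y) \<le> norm X * norm Y * K"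
    and X: "\<And>k. norm (mpow X k) \<le> C" and Y: "\<And>k. norm (mpow Y k) \<le> C"
  shows "norm (mpow X n - mpow Y n) \<le> real n * ((C * K)\<^sup>2 * norm (X - Y))"
proof -
  have C: "0 \<le> C" using X[of 0] norm_ge_zero order_trans by blast
  have "norm (mpow X k ** (X - Y) ** mpow Y j) \<le> (C * K)\<^sup>2 * norm (X - Y)" for k j
  proof -
    have "norm (mpow X k ** (X - Y) ** mpow Y j) \<le> norm (mpow X k ** (X - Y)) * norm (mpow Y j) * K"
      by (rule K)
    also have "\<dots> \<le> (C * norm (X - Y) * K) * C * K"
    proof (intro mult_right_mono mult_mono)
      show "norm (mpow X k ** (X - Y)) \<le> C * norm (X - Y) * K"
        by (rule order_trans[OF K(2)]) (use X K(1) in \<open>auto intro!: mult_right_mono\<close>)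
    qed (use Y C K in auto)
    finally show ?thesis by (simp add: power2_eq_square mult_ac)
  qed
  then show ?thesis
    unfolding mpow_diff_telescope
    by (intro order_trans[OF norm_sum]) (simp add: sum_bounded_above[where A = "{..<n}", simplified])
qed

text \<open>
  Boundedness of the powers makes each summand \<open>X^k (X - 1)\<close> of the telescoping sum for \<open>Y = 1\<close> equal
  to \<open>X - 1\<close> up to an error of second order in \<open>X - 1\<close>.
\<close>

lemma norm_mpow_linear_le:
  fixes X :: "'f::{real_normed_field, euclidean_space}^'n^'n"
  assumes K: "K > 0" "\<And>(X :: 'f^'n^'n) (Y :: 'f^'n^'n). norm (X ** Y) \<le> norm X * norm Y * K"
    and X: "\<And>k. norm (mpow X k) \<le> C" and I: "norm (mat 1 :: 'f^'n^'n) \<le> C"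
  shows "norm (mpow X n - mat 1 - real n *\<^sub>R (X - mat 1)) \<le>
    (real n)\<^sup>2 * ((C * K)\<^sup>2 * K * (norm (X - mat 1))\<^sup>2)"
proof -
  let ?D = "X - mat 1"
  have "norm (mpow X k ** ?D - ?D) \<le> real n * ((C * K)\<^sup>2 * K * (norm ?D)\<^sup>2)" if "k < n" for k
  proof -
    have "mpow X k ** ?D - ?D = (mpow X k - mpow (mat 1) k) ** ?D"
      by (simp add: matrix_mult_linear)
    also have "norm \<dots> \<le> norm (mpow X k - mpow (mat 1) k) * norm ?D * K" by (rule K)
    also have "\<dots> \<le> (real k * ((C * K)\<^sup>2 * norm ?D)) * norm ?D * K"
      using K X I by (intro mult_right_mono norm_mpow_diff_le) auto
    also have "\<dots> \<le> (real n * ((C * K)\<^sup>2 * norm ?D)) * norm ?D * K"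
      using K that by (intro mult_right_mono) auto
    finally show ?thesis by (simp add: power2_eq_square mult_ac)
  qed
  then have "norm (\<Sum>k<n. mpow X k ** ?D - ?D) \<le> (\<Sum>k<n. real n * ((C * K)\<^sup>2 * K * (norm ?D)\<^sup>2))"
    by (intro order_trans[OF norm_sum] sum_mono) auto
  moreover have "mpow X n - mat 1 - real n *\<^sub>R ?D = (\<Sum>k<n. mpow X k ** ?D - ?D)"
    using mpow_diff_telescope[of X n "mat 1"] by (simp add: sum_subtractf scaleR_conv_of_real vec_eq_iff)
  ultimately show ?thesis by (simp add: power2_eq_square mult_ac)
qed

section \<open>The matrix exponential\<close>

text \<open>
  The endomorphisms of Euclidean space with the operator norm form a Banach algebra, so that the
  theory of the exponential function applies to them.
\<close>

typedef ('n::finite) endo = "UNIV :: ((real^'n) \<Rightarrow>\<^sub>L (real^'n)) set" ..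

setup_lifting type_definition_endo

instantiation endo :: (finite) real_normed_algebra_1
begin

lift_definition zero_endo :: "'a endo" is 0 .
lift_definition one_endo :: "'a endo" is id_blinfun .
lift_definition plus_endo :: "'a endo \<Rightarrow> 'a endo \<Rightarrow> 'a endo" is "(+)" .
lift_definition minus_endo :: "'a endo \<Rightarrow> 'a endo \<Rightarrow> 'a endo" is "(-)" .
lift_definition uminus_endo :: "'a endo \<Rightarrow> 'a endo" is "uminus" .
lift_definition times_endo :: "'a endo \<Rightarrow> 'a endo \<Rightarrow> 'a endo" is "(o\<^sub>L)" .
lift_definition scaleR_endo :: "real \<Rightarrow> 'a endo \<Rightarrow> 'a endo" is "(*\<^sub>R)" .
lift_definition norm_endo :: "'a endo \<Rightarrow> real" is norm .
definition dist_endo :: "'a endo \<Rightarrow> 'a endo \<Rightarrow> real" where "dist_endo x y = norm (x - y)"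
definition sgn_endo :: "'a endo \<Rightarrow> 'a endo" where "sgn_endo x = scaleR (inverse (norm x)) x"
definition uniformity_endo :: "('a endo \<times> 'a endo) filter" where
  "uniformity_endo = (INF e\<in>{0<..}. principal {(x, y). dist x y < e})"
definition open_endo :: "'a endo set \<Rightarrow> bool" where
  "open_endo S = (\<forall>x\<in>S. \<forall>\<^sub>F (x', y) in uniformity. x' = x \<longrightarrow> y \<in> S)"

instance
proof
  fix x y z :: "'a endo" and a b :: real and S :: "'a endo set"
  show "x + y + z = x + (y + z)" "x + y = y + x" "0 + x = x" "- x + x = 0" "x - y = x + - y"
    by (transfer; simp)+
  show "a *\<^sub>R (x + y) = a *\<^sub>R x + a *\<^sub>R y" "(a + b) *\<^sub>R x = a *\<^sub>R x + b *\<^sub>R x"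
    "a *\<^sub>R b *\<^sub>R x = (a * b) *\<^sub>R x" "1 *\<^sub>R x = x"
    by (transfer; simp add: algebra_simps)+
  show "x * y * z = x * (y * z)" "1 * x = x" "x * 1 = x"
    by (transfer; simp add: blinfun_eqI)+
  show "(x + y) * z = x * z + y * z" "x * (y + z) = x * y + x * z"
    "a *\<^sub>R x * y = a *\<^sub>R (x * y)" "x * a *\<^sub>R y = a *\<^sub>R (x * y)"
    by (transfer; rule blinfun_eqI; simp add: blinfun.bilinear_simps)+
  show "dist x y = norm (x - y)" by (rule dist_endo_def)
  show "sgn x = scaleR (inverse (norm x)) x" by (rule sgn_endo_def)
  show "uniformity = (INF e\<in>{0<..}. principal {(x, y :: 'a endo). dist x y < e})"
    by (rule uniformity_endo_def)
  show "open S \<longleftrightarrow> (\<forall>x\<in>S. \<forall>\<^sub>F (x', y) in uniformity. x' = x \<longrightarrow> y \<in> S)" by (rule open_endo_def)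
  show "(norm x = 0) = (x = 0)" "norm (a *\<^sub>R x) = \<bar>a\<bar> * norm x" by (transfer; simp)+
  show "norm (x + y) \<le> norm x + norm y" by transfer (rule norm_triangle_ineq)
  show "norm (x * y) \<le> norm x * norm y" by transfer (rule norm_blinfun_compose)
  show "norm (1 :: 'a endo) = 1" by transfer (rule norm_blinfun_id)
  show "(0 :: 'a endo) \<noteq> 1"
    by transfer (metis norm_blinfun_id norm_zero zero_neq_one)
qed

end

instance endo :: (finite) banach
proof
  fix X :: "nat \<Rightarrow> 'a endo"
  assume "Cauchy X"
  have d: "dist x y = dist (Rep_endo x) (Rep_endo y)" for x y :: "'a endo"
    by (simp add: dist_norm norm_endo.rep_eq minus_endo.rep_eq)
  have "Cauchy (\<lambda>k. Rep_endo (X k))"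
    using \<open>Cauchy X\<close> by (simp add: Cauchy_def d)
  then obtain l where "(\<lambda>k. Rep_endo (X k)) \<longlonglongrightarrow> l"
    using Cauchy_convergent convergent_def by blast
  then have "X \<longlonglongrightarrow> Abs_endo l"
    by (simp add: lim_sequentially d Abs_endo_inverse)
  then show "convergent X" by (auto simp: convergent_def)
qed

definition endo_matrix :: "('n::finite) endo \<Rightarrow> real^'n^'n" where
  "endo_matrix x = matrix (blinfun_apply (Rep_endo x))"

definition matrix_endo :: "real^'n^'n \<Rightarrow> ('n::finite) endo" where
  "matrix_endo X = Abs_endo (Blinfun ((*v) X))"

lemma endo_matrix_inverse: "endo_matrix (matrix_endo X) = X"
  by (simp add: endo_matrix_def matrix_endo_def Abs_endo_inverse bounded_linear_Blinfun_apply
      matrix_vector_mul_bounded_linear)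

lemma endo_matrix_mult: "endo_matrix (x * y) = endo_matrix x ** endo_matrix y"
proof -
  have "blinfun_apply (Rep_endo (x * y)) = blinfun_apply (Rep_endo x) \<circ> blinfun_apply (Rep_endo y)"
    by (auto simp: times_endo.rep_eq)
  then show ?thesis
    by (simp add: endo_matrix_def matrix_compose bounded_linear.linear[OF blinfun.bounded_linear_right])
qed

lemma endo_matrix_one: "endo_matrix 1 = mat 1"
  by (simp add: endo_matrix_def one_endo.rep_eq id_blinfun.rep_eq matrix_id_mat_1[unfolded id_def])

lemma bounded_linear_endo_matrix: "bounded_linear (endo_matrix :: ('n::finite) endo \<Rightarrow> real^'n^'n)"
proof (rule bounded_linear_intro)
  fix x y :: "'n endo" and r :: real
  show "endo_matrix (x + y) = endo_matrix x + endo_matrix y"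
    by (simp add: endo_matrix_def plus_endo.rep_eq blinfun.bilinear_simps matrix_def vec_eq_iff)
  show "endo_matrix (r *\<^sub>R x) = r *\<^sub>R endo_matrix x"
    by (simp add: endo_matrix_def scaleR_endo.rep_eq blinfun.bilinear_simps matrix_def vec_eq_iff)
  have "\<bar>endo_matrix x $ i $ j\<bar> \<le> norm x" for i j
  proof -
    have "\<bar>endo_matrix x $ i $ j\<bar> \<le> norm (blinfun_apply (Rep_endo x) (axis j 1))"
      by (simp add: endo_matrix_def matrix_def component_le_norm_cart)
    also have "\<dots> \<le> norm x"
      using norm_blinfun[of "Rep_endo x" "axis j 1"] by (simp add: norm_endo.rep_eq)
    finally show ?thesis .
  qed
  then have "norm (endo_matrix x $ i) \<le> real CARD('n) * norm x" for i
    by (intro order_trans[OF norm_le_l1_cart] sum_bounded_above[THEN order_trans]) auto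
  then have "(\<Sum>i\<in>UNIV. norm (endo_matrix x $ i)) \<le> real CARD('n) * (real CARD('n) * norm x)"
    by (intro sum_bounded_above[THEN order_trans]) auto
  moreover have "norm (endo_matrix x) \<le> (\<Sum>i\<in>UNIV. norm (endo_matrix x $ i))"
    unfolding norm_vec_def by (rule L2_set_le_sum) auto
  ultimately show "norm (endo_matrix x) \<le> norm x * (real CARD('n) * real CARD('n))"
    by (simp add: mult_ac)
qed

lemma endo_matrix_power: "endo_matrix (matrix_endo X ^ k) = mpow X k"
  by (induction k) (simp_all add: endo_matrix_one endo_matrix_mult endo_matrix_inverse mpow_Suc)

lemma mat_exp_sums: "(\<lambda>k. (1 / fact k) *\<^sub>R mpow X k) sums mat_exp X"
  and mat_exp_eq_exp: "mat_exp X = endo_matrix (exp (matrix_endo X))"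
proof -
  have "(\<lambda>k. endo_matrix (matrix_endo X ^ k /\<^sub>R fact k)) sums endo_matrix (exp (matrix_endo X))"
    by (intro bounded_linear.sums[OF bounded_linear_endo_matrix] exp_converges)
  then have *: "(\<lambda>k. (1 / fact k) *\<^sub>R mpow X k) sums endo_matrix (exp (matrix_endo X))"
    by (simp add: endo_matrix_power divide_inverse
        linear_scale[OF bounded_linear.linear[OF bounded_linear_endo_matrix]])
  then show "mat_exp X = endo_matrix (exp (matrix_endo X))"
    by (simp add: mat_exp_def mpow_def sums_iff)
  with * show "(\<lambda>k. (1 / fact k) *\<^sub>R mpow X k) sums mat_exp X" by simp
qed

lemma matrix_endo_scaleR: "matrix_endo (t *\<^sub>R X) = t *\<^sub>R matrix_endo X"
proof -
  have "Blinfun ((*v) (t *\<^sub>R X)) = t *\<^sub>R Blinfun ((*v) X)"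
    by (rule blinfun_eqI)
       (simp add: bounded_linear_Blinfun_apply matrix_vector_mul_bounded_linear blinfun.scaleR_left
         scaleR_matrix_vector_assoc)
  then show ?thesis
    by (simp add: matrix_endo_def scaleR_endo.abs_eq)
qed

lemma mat_exp_scaleR_derivative:
  "((\<lambda>t. mat_exp (t *\<^sub>R X)) has_vector_derivative mat_exp (t *\<^sub>R X) ** X) (at t)"
  using bounded_linear.has_vector_derivative[OF bounded_linear_endo_matrix
      exp_scaleR_has_vector_derivative_right[where A = "matrix_endo X" and t = t and T = UNIV]]
  by (simp add: mat_exp_eq_exp matrix_endo_scaleR endo_matrix_mult endo_matrix_inverse)

lemma mat_exp_0 [simp]: "mat_exp (0 :: real^'n^'n) = mat 1"
  using matrix_endo_scaleR[of 0 "0 :: real^'n^'n"] by (simp add: mat_exp_eq_exp endo_matrix_one)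

lemma mat_exp_scaleR_add: "mat_exp ((s + t) *\<^sub>R X) = mat_exp (s *\<^sub>R X) ** mat_exp (t *\<^sub>R X)"
proof -
  have "exp ((s + t) *\<^sub>R matrix_endo X) = exp (s *\<^sub>R matrix_endo X) * exp (t *\<^sub>R matrix_endo X)"
    by (subst scaleR_add_left, rule exp_add_commuting) simp
  then show ?thesis
    by (simp only: mat_exp_eq_exp matrix_endo_scaleR endo_matrix_mult)
qed

text \<open>
  This applies to transposition and to conjugation, which commute with the powers of a matrix and
  therefore with the exponential series.
\<close>

lemma mat_exp_bounded_linear_image:
  assumes L: "bounded_linear L" and "\<And>k. L (mpow X k) = mpow Y k"
  shows "L (mat_exp X) = mat_exp Y"
proof -
  have "(\<lambda>k. L ((1 / fact k) *\<^sub>R mpow X k)) sums L (mat_exp X)"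
    by (rule bounded_linear.sums[OF L mat_exp_sums])
  then have "(\<lambda>k. (1 / fact k) *\<^sub>R mpow Y k) sums L (mat_exp X)"
    using linear_scale[OF bounded_linear.linear[OF L]] by (simp add: assms(2))
  with mat_exp_sums[of Y] show ?thesis by (simp add: sums_iff)
qed

lemma bounded_linear_transpose: "bounded_linear (transpose :: real^'n^'n \<Rightarrow> real^'n^'n)"
  by (auto simp: linear_conv_bounded_linear[symmetric] transpose_def vec_eq_iff intro!: linearI)

lemma mat_exp_transpose: "transpose (mat_exp X) = mat_exp (transpose X)"
proof (rule mat_exp_bounded_linear_image[OF bounded_linear_transpose])
  show "transpose (mpow X k) = mpow (transpose X) k" for k
  proof (induction k)
    case (Suc k)
    then show ?case
      by (metis mpow_Suc mpow_Suc_right matrix_transpose_mul)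
  qed (simp add: transpose_mat)
qed

lemma mat_exp_conj:
  assumes "h' ** h = mat 1" "h ** h' = mat 1"
  shows "h ** mat_exp X ** h' = mat_exp (h ** X ** h')"
proof (rule mat_exp_bounded_linear_image)
  show "bounded_linear (\<lambda>X. h ** X ** h')"
    by (auto simp: linear_conv_bounded_linear[symmetric] matrix_mult_linear intro!: linearI)
  show "h ** mpow X k ** h' = mpow (h ** X ** h') k" for k
  proof (induction k)
    case (Suc k)
    have "h ** mpow X (Suc k) ** h' = h ** X ** (h' ** h) ** mpow X k ** h'"
      using assms by (simp add: mpow_Suc matrix_mul_assoc)
    also have "\<dots> = (h ** X ** h') ** (h ** mpow X k ** h')" by (simp add: matrix_mul_assoc)
    finally show ?case by (simp add: Suc mpow_Suc)
  qed (simp add: assms)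
qed

section \<open>One-parameter groups of matrices\<close>

text \<open>
  A matrix \<open>N\<close> close to the identity is injective, since \<open>N u = 0\<close> means \<open>(N - 1) u = - u\<close>.
\<close>

lemma ex_right_inverse_near_one:
  "\<exists>\<epsilon>>0. \<forall>N :: complex^'d^'d. norm (N - mat 1) < \<epsilon> \<longrightarrow> (\<exists>N'. N ** N' = mat 1)"
proof -
  obtain K where K: "K > 0" "\<And>(X :: complex^'d^'d) v. norm (X *v v) \<le> norm X * norm v * K"
    using bounded_bilinear.pos_bounded[OF bounded_bilinear_matrix_vector_mult] by blast
  have "\<exists>N'. N ** N' = mat 1" if N: "norm (N - mat 1) < 1 / K" for N :: "complex^'d^'d"
  proof -
    have "inj ((*v) N)"
    proof (rule injI)
      fix v w assume "N *v v = N *v w"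
      then have "(N - mat 1) *v (v - w) = - (v - w)"
        by (simp add: matrix_vector_mult_diff_distrib matrix_vector_mult_diff_rdistrib)
      then have "norm (v - w) \<le> norm (N - mat 1) * norm (v - w) * K"
        using K(2)[of "N - mat 1" "v - w"] by (metis norm_minus_cancel)
      moreover have "norm (N - mat 1) * K < 1" using N K(1) by (simp add: field_simps)
      ultimately have "\<not> norm (v - w) > 0"
        by (metis mult.assoc mult.commute mult_less_cancel_left2 not_le)
      then show "v = w" by simp
    qed
    then show ?thesis
      using matrix_left_invertible_injective[of N] matrix_left_right_inverse by blast
  qed
  then show ?thesis using K(1) by (intro exI[of _ "1 / K"]) auto
qed

text \<open>
  An antiderivative \<open>F\<close> of a continuous one-parameter group \<open>M\<close> satisfies
  \<open>F(t + a) - F(t) = M(t) (F(a) - F(0))\<close>, where the last factor is invertible for small \<open>a\<close>.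
\<close>

lemma one_parameter_group_differentiable:
  fixes M :: "real \<Rightarrow> complex^'d^'d"
  assumes cont: "continuous_on UNIV M" and add: "\<And>s t. M (s + t) = M s ** M t" and M0: "M 0 = mat 1"
  shows "\<exists>x. (M has_vector_derivative x) (at 0)"
proof -
  \<comment> \<open>The interval leaves room for arguments \<open>t + s\<close> with \<open>t\<close> in \<open>(-1, 1)\<close> and \<open>s\<close> in \<open>[0, 1]\<close>.\<close>
  obtain F where F': "\<And>t. t \<in> {-3..3} \<Longrightarrow> (F has_vector_derivative M t) (at t within {-3..3})"
    using antiderivative_continuous[OF continuous_on_subset[OF cont, of "{-3..3}"]] by auto
  have F: "(F has_vector_derivative M t) (at t)" if "t \<in> {-3<..<3}" for t
    using F'[of t] that at_within_interior[of t "{-3..3}"] by (auto simp: interior_atLeastAtMost_real)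
  have shift: "F (t + a) - F t = M t ** (F a - F 0)" if "t \<in> {-1<..<1}" "a \<in> {0..1}" for t a
  proof -
    \<comment> \<open>Its derivative \<open>M (t + s) - M t M s\<close> vanishes.\<close>
    define G where "G s = F (t + s) - M t ** F s" for s
    have G': "(G has_vector_derivative 0) (at s within {0..1})" if s: "s \<in> {0..1}" for s
    proof (rule has_vector_derivative_at_within)
      have "(F \<circ> (\<lambda>s. t + s) has_vector_derivative 1 *\<^sub>R M (t + s)) (at s)"
        using s \<open>t \<in> _\<close> by (intro vector_diff_chain_at) (auto intro!: derivative_eq_intros F)
      moreover have "((\<lambda>s. M t ** F s) has_vector_derivative M t ** M s) (at s)"
        using s F[of s]
        by (intro bounded_linear.has_vector_derivative[OF
              bounded_bilinear.bounded_linear_right[OF bounded_bilinear_matrix_mult]]) auto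
      ultimately show "(G has_vector_derivative 0) (at s)"
        unfolding G_def using has_vector_derivative_diff add[of t s] by (fastforce simp: o_def)
    qed
    obtain c where "\<And>s. s \<in> {0..1} \<Longrightarrow> G s = c"
      using has_vector_derivative_zero_constant[OF convex_real_interval(5) G'] by auto
    then have "G a = G 0" using that by simp
    then show ?thesis by (simp add: G_def matrix_mult_linear algebra_simps)
  qed
  obtain \<epsilon> where \<epsilon>: "\<epsilon> > 0" "\<And>N :: complex^'d^'d. norm (N - mat 1) < \<epsilon> \<Longrightarrow> \<exists>N'. N ** N' = mat 1"
    using ex_right_inverse_near_one by blast
  have "(F has_vector_derivative mat 1) (at 0)" using F[of 0] M0 by simp
  then have "((\<lambda>h. norm (F (0 + h) - F 0 - h *\<^sub>R mat 1) / norm h) \<longlongrightarrow> 0) (at 0)"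
    unfolding has_vector_derivative_def has_derivative_at by simp
  then have "\<forall>\<^sub>F h in at 0. norm (F (0 + h) - F 0 - h *\<^sub>R mat 1) / norm h < \<epsilon>"
    using \<epsilon>(1) by (rule order_tendstoD)
  then obtain d where d: "d > 0"
    "\<And>h. h \<noteq> 0 \<Longrightarrow> \<bar>h\<bar> < d \<Longrightarrow> norm (F h - F 0 - h *\<^sub>R mat 1) / \<bar>h\<bar> < \<epsilon>"
    unfolding eventually_at by (auto simp: dist_real_def)
  define a where "a = min (d / 2) 1"
  have a: "0 < a" "a < d" "a \<in> {0..1}" using d(1) by (auto simp: a_def)
  define N where "N = (1 / a) *\<^sub>R (F a - F 0)"
  have "N - mat 1 = (1 / a) *\<^sub>R (F a - F 0 - a *\<^sub>R mat 1)"
    using a by (simp add: N_def algebra_simps)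
  then have "norm (N - mat 1) < \<epsilon>" using d(2)[of a] a by simp
  then obtain N' where N': "N ** N' = mat 1" using \<epsilon>(2) by blast
  have M: "M t = (1 / a) *\<^sub>R (F (t + a) - F t) ** N'" if "t \<in> {-1<..<1}" for t
  proof -
    have "(1 / a) *\<^sub>R (F (t + a) - F t) = M t ** N"
      using shift[OF that a(3)] by (simp add: N_def matrix_mult_linear)
    then show ?thesis using N' by (simp flip: matrix_mul_assoc)
  qed
  have "((\<lambda>t. (1 / a) *\<^sub>R (F (t + a) - F t) ** N') has_vector_derivative
      (1 / a) *\<^sub>R (M a - M 0) ** N') (at 0)"
  proof (intro bounded_linear.has_vector_derivative[OF
        bounded_bilinear.bounded_linear_left[OF bounded_bilinear_matrix_mult]]
      bounded_linear.has_vector_derivative[OF bounded_linear_scaleR_right] has_vector_derivative_diff)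
    have "(F \<circ> (\<lambda>s. s + a) has_vector_derivative 1 *\<^sub>R M (0 + a)) (at 0)"
      using a by (intro vector_diff_chain_at) (auto intro!: derivative_eq_intros F)
    then show "((\<lambda>t. F (t + a)) has_vector_derivative M a) (at 0)" by (simp add: o_def)
    show "(F has_vector_derivative M 0) (at 0)" by (rule F) simp
  qed
  then have "(M has_vector_derivative (1 / a) *\<^sub>R (M a - M 0) ** N') (at 0)"
    by (rule has_vector_derivative_transform_within_open[of _ _ _ "{-1<..<1}"]) (use M in auto)
  then show ?thesis by blast
qed

text \<open>
  The bound for the powers turns the first-order expansion of \<open>N (t / n)\<close> into one of its \<open>n\<close>-th power with
  a quadratic remainder that is uniform in \<open>n\<close>; the limit \<open>P t\<close> inherits it.
\<close>

lemma limit_of_powers_derivative: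
  fixes N P :: "real \<Rightarrow> 'f::{real_normed_field, euclidean_space}^'n^'n"
  assumes N0: "N 0 = mat 1" and N': "(N has_vector_derivative z) (at 0)"
    and bound: "\<And>t k. norm (mpow (N t) k) \<le> C"
    and lim: "\<And>t. (\<lambda>n. mpow (N (t / real (Suc n))) (Suc n)) \<longlonglongrightarrow> P t"
  shows "(P has_vector_derivative z) (at 0)"
proof -
  obtain K where K: "K > 0" "\<And>(X :: 'f^'n^'n) (Y :: 'f^'n^'n). norm (X ** Y) \<le> norm X * norm Y * K"
    using ex_matrix_norm_mult_bound by blast
  have C1: "norm (mat 1 :: 'f^'n^'n) \<le> C" using bound[of 0 0] by simp
  define B where "B = (C * K)\<^sup>2 * K * (norm z)\<^sup>2"
  have quot: "((\<lambda>h. (1 / h) *\<^sub>R (N h - mat 1)) \<longlongrightarrow> z) (at 0)"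
  proof -
    have "((\<lambda>h. norm (N (0 + h) - N 0 - h *\<^sub>R z) / norm h) \<longlongrightarrow> 0) (at 0)"
      using N' unfolding has_vector_derivative_def has_derivative_at by simp
    then have "((\<lambda>h. (1 / h) *\<^sub>R (N h - mat 1) - z) \<longlongrightarrow> 0) (at 0)"
    proof (rule Lim_null_comparison[rotated])
      have "norm ((1 / h) *\<^sub>R (N h - mat 1) - z) = norm (N (0 + h) - N 0 - h *\<^sub>R z) / norm h"
        if "h \<noteq> 0" for h
      proof -
        have "(1 / h) *\<^sub>R (N h - mat 1) - z = (1 / h) *\<^sub>R (N (0 + h) - N 0 - h *\<^sub>R z)"
          using that by (simp add: N0 scaleR_diff_right)
        then show ?thesis by simp
      qed
      then show "\<forall>\<^sub>F h in at 0. norm ((1 / h) *\<^sub>R (N h - mat 1) - z) \<le>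
          norm (N (0 + h) - N 0 - h *\<^sub>R z) / norm h"
        using eventually_neq_at_within[of 0 "0::real" UNIV] by (auto elim!: eventually_mono)
    qed
    then show ?thesis by (simp add: Lim_null[of _ z])
  qed
  have P: "norm (P t - mat 1 - t *\<^sub>R z) \<le> t\<^sup>2 * B" if "t \<noteq> 0" for t
  proof -
    define s where "s n = t / real (Suc n)" for n
    have s: "filterlim s (at 0) sequentially"
      unfolding filterlim_at s_def using that LIMSEQ_Suc[OF lim_const_over_n[of t]]
      by (auto intro!: always_eventually)
    have q: "(\<lambda>n. (1 / s n) *\<^sub>R (N (s n) - mat 1)) \<longlonglongrightarrow> z"
      by (rule filterlim_compose[OF quot s])
    have st: "real (Suc n) = t * (1 / s n)" for n using that by (simp add: s_def)
    have "(\<lambda>n. norm (mpow (N (s n)) (Suc n) - mat 1 - t *\<^sub>R ((1 / s n) *\<^sub>R (N (s n) - mat 1))))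
        \<longlonglongrightarrow> norm (P t - mat 1 - t *\<^sub>R z)"
      using lim[of t] q unfolding s_def[symmetric] by (intro tendsto_intros)
    moreover have "(\<lambda>n. t\<^sup>2 * ((C * K)\<^sup>2 * K * (norm ((1 / s n) *\<^sub>R (N (s n) - mat 1)))\<^sup>2)) \<longlonglongrightarrow> t\<^sup>2 * B"
      unfolding B_def by (intro tendsto_intros q)
    moreover have "norm (mpow (N (s n)) (Suc n) - mat 1 - t *\<^sub>R ((1 / s n) *\<^sub>R (N (s n) - mat 1))) \<le>
        t\<^sup>2 * ((C * K)\<^sup>2 * K * (norm ((1 / s n) *\<^sub>R (N (s n) - mat 1)))\<^sup>2)" for n
      using norm_mpow_linear_le[OF K bound[of "s n"] C1, of "Suc n"]
      unfolding st[of n] by (simp add: power_mult_distrib power_divide mult_ac)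
    ultimately show ?thesis by (blast intro: LIMSEQ_le)
  qed
  have P0: "P 0 = mat 1"
  proof (rule LIMSEQ_unique)
    show "(\<lambda>n. mat 1 :: 'f^'n^'n) \<longlonglongrightarrow> mat 1" by (rule tendsto_const)
    show "(\<lambda>n. mat 1) \<longlonglongrightarrow> P 0" using lim[of 0] by (simp add: N0)
  qed
  have "((\<lambda>h. norm (P (0 + h) - P 0 - h *\<^sub>R z) / norm h) \<longlongrightarrow> 0) (at 0)"
  proof (rule Lim_null_comparison)
    have "norm (norm (P (0 + h) - P 0 - h *\<^sub>R z) / norm h) \<le> \<bar>h\<bar> * B" if "h \<noteq> 0" for h
    proof -
      have e: "h\<^sup>2 * B = (\<bar>h\<bar> * B) * \<bar>h\<bar>" 
        using abs_mult_self_eq[of h] by (metis mult.commute mult.assoc power2_eq_square)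
      then show ?thesis using P[OF that, unfolded e] that by (simp add: P0 pos_divide_le_eq)
    qed
    then show "\<forall>\<^sub>F h in at 0. norm (norm (P (0 + h) - P 0 - h *\<^sub>R z) / norm h) \<le> \<bar>h\<bar> * B"
      using eventually_neq_at_within[of 0 "0::real" UNIV] by (auto elim!: eventually_mono)
    show "((\<lambda>h. \<bar>h\<bar> * B) \<longlongrightarrow> 0) (at 0)"
      by (auto intro!: tendsto_eq_intros)
  qed
  then show ?thesis
    by (simp add: has_vector_derivative_def has_derivative_at bounded_linear_scaleR_left)
qed

section \<open>The differential of a representation of \<open>SO(n)\<close>\<close>

lemma SO_mult: "h \<in> SO_group \<Longrightarrow> k \<in> SO_group \<Longrightarrow> h ** k \<in> SO_group"
  by (simp add: SO_group_def orthogonal_matrix_mul det_mul)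

lemma SO_one [simp]: "mat 1 \<in> SO_group"
  by (simp add: SO_group_def orthogonal_matrix_id)

lemma SO_transpose: "h \<in> SO_group \<Longrightarrow> transpose h \<in> SO_group"
  by (simp add: SO_group_def orthogonal_matrix_transpose)

lemma SO_transpose_mult:
  "h \<in> SO_group \<Longrightarrow> transpose h ** h = mat 1" "h \<in> SO_group \<Longrightarrow> h ** transpose h = mat 1"
  by (auto simp: SO_group_def orthogonal_matrix_def)

lemma SO_mpow: "h \<in> SO_group \<Longrightarrow> mpow h k \<in> SO_group"
  by (induction k) (auto simp: mpow_Suc SO_mult)

lemma transpose_mat_exp_skew:
  assumes "transpose X = - X"
  shows "transpose (mat_exp (t *\<^sub>R X)) = mat_exp (- t *\<^sub>R X)"
proof -
  have "transpose (t *\<^sub>R X) = t *\<^sub>R transpose X" by (simp add: transpose_def vec_eq_iff)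
  then show ?thesis by (simp add: mat_exp_transpose assms)
qed

text \<open>
  The determinant of an orthogonal matrix is 1 or -1, and here it is the square of the determinant at
  half the parameter.
\<close>

lemma mat_exp_skew_SO:
  assumes X: "transpose X = - X"
  shows "mat_exp (t *\<^sub>R X) \<in> SO_group"
proof -
  have inv: "mat_exp (s *\<^sub>R X) ** transpose (mat_exp (s *\<^sub>R X)) = mat 1" for s
    using mat_exp_scaleR_add[of s "- s" X] by (simp add: transpose_mat_exp_skew[OF X])
  then have orth: "orthogonal_matrix (mat_exp (s *\<^sub>R X))" for s
    by (simp add: orthogonal_matrix_def matrix_left_right_inverse1)
  have "det (mat_exp (t *\<^sub>R X)) = det (mat_exp ((t / 2) *\<^sub>R X)) * det (mat_exp ((t / 2) *\<^sub>R X))"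
    using mat_exp_scaleR_add[of "t / 2" "t / 2" X] by (simp add: det_mul)
  moreover have "det (mat_exp ((t / 2) *\<^sub>R X)) \<in> {1, -1}"
    using det_orthogonal_matrix[OF orth] by auto
  ultimately have "det (mat_exp (t *\<^sub>R X)) = 1" by auto
  with orth show ?thesis by (simp add: SO_group_def)
qed

lemma norm_SO_bounded: "h \<in> SO_group \<Longrightarrow> norm (h :: real^'n^'n) \<le> real CARD('n)"
proof -
  assume h: "h \<in> SO_group"
  have "norm (h $ i) = 1" for i
  proof -
    have "(h ** transpose h) $ i $ i = 1" using SO_transpose_mult(2)[OF h] by (simp add: mat_def)
    then have "(norm (h $ i))\<^sup>2 = 1"
      by (simp add: matrix_matrix_mult_def transpose_def power2_norm_eq_inner inner_vec_def)
    then show ?thesis using abs_square_eq_1[of "norm (h $ i)"] by simp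
  qed
  then show ?thesis using L2_set_le_sum[of UNIV "\<lambda>i. norm (h $ i)"] by (simp add: norm_vec_def)
qed

definition adjoint_matrix :: "complex^'d^'d \<Rightarrow> complex^'d^'d" where
  "adjoint_matrix N = (\<chi> a b. cnj (N $ b $ a))"

lemma norm_unitary_bounded:
  fixes N :: "complex^'d^'d"
  assumes "adjoint_matrix N ** N = mat 1"
  shows "norm N \<le> real CARD('d)"
proof -
  have "N ** adjoint_matrix N = mat 1" using assms matrix_left_right_inverse by blast
  have "norm (N $ i) = 1" for i
  proof -
    have "(N ** adjoint_matrix N) $ i $ i = 1" using \<open>N ** _ = _\<close> by (simp add: mat_def)
    then have "of_real (\<Sum>k\<in>UNIV. (cmod (N $ i $ k))\<^sup>2) = (1 :: complex)"
      by (simp add: matrix_matrix_mult_def adjoint_matrix_def complex_norm_square del: of_real_power)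
    then have "(\<Sum>k\<in>UNIV. (cmod (N $ i $ k))\<^sup>2) = 1" using of_real_eq_1_iff by blast
    then show ?thesis by (simp add: norm_vec_def L2_set_def)
  qed
  then show ?thesis using L2_set_le_sum[of UNIV "\<lambda>i. norm (N $ i)"] by (simp add: norm_vec_def)
qed

lemma mpow_mat_exp: "mpow (mat_exp (s *\<^sub>R X)) n = mat_exp ((real n * s) *\<^sub>R X)"
proof (induction n)
  case (Suc n)
  have "real (Suc n) * s = s + real n * s" by (simp add: algebra_simps)
  then show ?case by (simp only: mpow_Suc Suc mat_exp_scaleR_add)
qed simp

lemma transpose_skew_scaleR: "transpose X = - X \<Longrightarrow> transpose (c *\<^sub>R X) = - (c *\<^sub>R X)"
  for X :: "real^'n^'n"
proof -
  have "transpose (c *\<^sub>R X) = c *\<^sub>R transpose X" by (simp add: transpose_def vec_eq_iff)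
  then show "transpose X = - X \<Longrightarrow> transpose (c *\<^sub>R X) = - (c *\<^sub>R X)" by simp
qed

lemma transpose_skew_add: "transpose X = - X \<Longrightarrow> transpose Y = - Y \<Longrightarrow> transpose (X + Y) = - (X + Y)"
  for X Y :: "real^'n^'n"
proof -
  have "transpose (X + Y) = transpose X + transpose Y" by (simp add: transpose_def vec_eq_iff)
  then show "transpose X = - X \<Longrightarrow> transpose Y = - Y \<Longrightarrow> transpose (X + Y) = - (X + Y)" by simp
qed

text \<open>
  The product of the two exponentials and the exponential of the sum have the same derivative at 0, so
  they differ by \<open>o(1/n)\<close> at the parameter \<open>t / n\<close>.  As all powers are orthogonal and hence bounded,
  the \<open>n\<close>-th powers differ by \<open>n o(1/n)\<close>.
\<close>

lemma trotter_SO: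
  fixes X Y :: "real^'n^'n"
  assumes X: "transpose X = - X" and Y: "transpose Y = - Y"
  shows "(\<lambda>n. mpow (mat_exp ((t / real (Suc n)) *\<^sub>R X) ** mat_exp ((t / real (Suc n)) *\<^sub>R Y)) (Suc n))
    \<longlonglongrightarrow> mat_exp (t *\<^sub>R (X + Y))"
proof (cases "t = 0")
  case False
  define G where "G s = mat_exp (s *\<^sub>R X) ** mat_exp (s *\<^sub>R Y)" for s
  define E where "E s = mat_exp (s *\<^sub>R (X + Y))" for s
  define s where "s n = t / real (Suc n)" for n
  obtain K where K: "K > 0" "\<And>(X :: real^'n^'n) (Y :: real^'n^'n). norm (X ** Y) \<le> norm X * norm Y * K"
    using ex_matrix_norm_mult_bound by blast
  have XY: "transpose (X + Y) = - (X + Y)"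
    by (rule transpose_skew_add[OF X Y])
  have SO: "G r \<in> SO_group" "E r \<in> SO_group" for r
    by (simp_all add: G_def E_def SO_mult mat_exp_skew_SO X Y XY)
  have "(G has_vector_derivative mat_exp (0 *\<^sub>R X) ** (mat_exp (0 *\<^sub>R Y) ** Y) +
      (mat_exp (0 *\<^sub>R X) ** X) ** mat_exp (0 *\<^sub>R Y)) (at 0)"
    unfolding G_def
    by (rule has_vector_derivative_bilinear[OF bounded_bilinear_matrix_mult
          mat_exp_scaleR_derivative mat_exp_scaleR_derivative])
  moreover have "(E has_vector_derivative mat_exp (0 *\<^sub>R (X + Y)) ** (X + Y)) (at 0)"
    unfolding E_def by (rule mat_exp_scaleR_derivative)
  ultimately have "((\<lambda>r. G r - E r) has_vector_derivative 0) (at 0)"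
    using has_vector_derivative_diff by fastforce
  then have "((\<lambda>h. norm (G h - E h) / norm h) \<longlongrightarrow> 0) (at 0)"
    unfolding has_vector_derivative_def has_derivative_at by (simp add: G_def E_def)
  moreover have "filterlim s (at 0) sequentially"
    unfolding filterlim_at s_def using False LIMSEQ_Suc[OF lim_const_over_n[of t]]
    by (auto intro!: always_eventually)
  ultimately have "(\<lambda>n. norm (G (s n) - E (s n)) / norm (s n)) \<longlonglongrightarrow> 0"
    by (rule filterlim_compose)
  then have lim0: "(\<lambda>n. (real CARD('n) * K)\<^sup>2 * (\<bar>t\<bar> * (norm (G (s n) - E (s n)) / norm (s n)))) \<longlonglongrightarrow> 0"
    by (intro tendsto_mult_right_zero)
  have "norm (mpow (G (s n)) (Suc n) - mpow (E (s n)) (Suc n)) \<le>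
      (real CARD('n) * K)\<^sup>2 * (\<bar>t\<bar> * (norm (G (s n) - E (s n)) / norm (s n)))" for n
  proof -
    have "norm (mpow (G (s n)) (Suc n) - mpow (E (s n)) (Suc n)) \<le>
        real (Suc n) * ((real CARD('n) * K)\<^sup>2 * norm (G (s n) - E (s n)))"
      by (intro norm_mpow_diff_le K norm_SO_bounded SO_mpow SO)
    moreover have "real (Suc n) = \<bar>t\<bar> / norm (s n)" using False by (simp add: s_def)
    ultimately show ?thesis by (simp add: mult_ac)
  qed
  then have "(\<lambda>n. mpow (G (s n)) (Suc n) - mpow (E (s n)) (Suc n)) \<longlonglongrightarrow> 0"
    by (intro Lim_null_comparison[OF _ lim0] always_eventually allI)
  moreover have "mpow (E (s n)) (Suc n) = E t" for n
    unfolding E_def mpow_mat_exp by (simp add: s_def)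
  ultimately show ?thesis
    unfolding Lim_null[of _ "mat_exp (t *\<^sub>R (X + Y))"] by (simp add: G_def E_def s_def)
qed (use LIMSEQ_const_iff in simp)

locale so_representation =
  fixes \<pi> :: "real^'n^'n \<Rightarrow> complex^'d^'d"
  assumes rep: "irreducible_unitary_rep \<pi>"
begin

lemma rep_one: "\<pi> (mat 1) = mat 1"
  and rep_mult: "h \<in> SO_group \<Longrightarrow> k \<in> SO_group \<Longrightarrow> \<pi> (h ** k) = \<pi> h ** \<pi> k"
  and rep_continuous: "continuous_on SO_group \<pi>"
  and rep_unitary: "h \<in> SO_group \<Longrightarrow> adjoint_matrix (\<pi> h) ** \<pi> h = mat 1"
  using rep by (auto simp: irreducible_unitary_rep_def adjoint_matrix_def)

lemma rep_mpow: "h \<in> SO_group \<Longrightarrow> \<pi> (mpow h k) = mpow (\<pi> h) k"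
  by (induction k) (auto simp: mpow_Suc rep_mult SO_mpow rep_one)

text \<open>
  A continuous representation is differentiable along one-parameter groups, so the derivative in the
  definition of \<^const>\<open>drep\<close> exists.
\<close>

lemma drep_derivative:
  assumes X: "transpose X = - X"
  shows "((\<lambda>t. \<pi> (mat_exp (t *\<^sub>R X))) has_vector_derivative drep \<pi> X) (at 0)"
proof -
  have "continuous_on UNIV (\<lambda>t. mat_exp (t *\<^sub>R X))"
    using mat_exp_scaleR_derivative[THEN has_vector_derivative_continuous]
    by (auto simp: continuous_on_eq_continuous_within)
  then have "continuous_on UNIV (\<lambda>t. \<pi> (mat_exp (t *\<^sub>R X)))"
    by (rule continuous_on_compose2[OF rep_continuous]) (auto simp: mat_exp_skew_SO X)
  then have "\<exists>x. ((\<lambda>t. \<pi> (mat_exp (t *\<^sub>R X))) has_vector_derivative x) (at 0)"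
    by (rule one_parameter_group_differentiable)
       (simp_all add: mat_exp_scaleR_add rep_mult mat_exp_skew_SO X rep_one)
  then show ?thesis
    unfolding drep_def using vector_derivative_at by metis
qed

lemma drep_eqI:
  "transpose X = - X \<Longrightarrow> ((\<lambda>t. \<pi> (mat_exp (t *\<^sub>R X))) has_vector_derivative x) (at 0) \<Longrightarrow> drep \<pi> X = x"
  using drep_derivative vector_derivative_unique_at by blast

lemma drep_scaleR: 
  assumes "transpose X = - X" shows "drep \<pi> (c *\<^sub>R X) = c *\<^sub>R drep \<pi> X"
proof (rule drep_eqI[OF transpose_skew_scaleR[OF assms]])
  have "((\<lambda>t. \<pi> (mat_exp (t *\<^sub>R X))) \<circ> (\<lambda>t. t * c) has_vector_derivative c *\<^sub>R drep \<pi> X) (at 0)"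
    by (rule vector_diff_chain_at)
       (auto intro!: derivative_eq_intros drep_derivative assms)
  then show "((\<lambda>t. \<pi> (mat_exp (t *\<^sub>R c *\<^sub>R X))) has_vector_derivative c *\<^sub>R drep \<pi> X) (at 0)"
    by (simp add: o_def)
qed

text \<open>
  By continuity the Trotter formula is preserved by \<open>\<pi>\<close>.  Thus \<open>\<pi> (mat_exp (t (X + Y)))\<close> is a limit of powers
  of a curve of unitary matrices with derivative \<open>drep \<pi> X + drep \<pi> Y\<close>.
\<close>

lemma drep_add:
  assumes X: "transpose X = - X" and Y: "transpose Y = - Y"
  shows "drep \<pi> (X + Y) = drep \<pi> X + drep \<pi> Y"
proof (rule drep_eqI[OF transpose_skew_add[OF X Y]])
  let ?E = "\<lambda>X t. mat_exp (t *\<^sub>R X)"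
  have SO: "?E X t \<in> SO_group" "?E Y t \<in> SO_group" "?E (X + Y) t \<in> SO_group" for t
    by (rule mat_exp_skew_SO[OF X] mat_exp_skew_SO[OF Y] mat_exp_skew_SO[OF transpose_skew_add[OF X Y]])+
  show "((\<lambda>t. \<pi> (?E (X + Y) t)) has_vector_derivative drep \<pi> X + drep \<pi> Y) (at 0)"
  proof (rule limit_of_powers_derivative[where N = "\<lambda>t. \<pi> (?E X t ** ?E Y t)"])
    have "((\<lambda>t. \<pi> (?E X t) ** \<pi> (?E Y t)) has_vector_derivative
        \<pi> (?E X 0) ** drep \<pi> Y + drep \<pi> X ** \<pi> (?E Y 0)) (at 0)"
      by (intro has_vector_derivative_bilinear[OF bounded_bilinear_matrix_mult] drep_derivative X Y)
    then show "((\<lambda>t. \<pi> (?E X t ** ?E Y t)) has_vector_derivative drep \<pi> X + drep \<pi> Y) (at 0)"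
      by (simp add: rep_mult SO rep_one add.commute)
    show "norm (mpow (\<pi> (?E X t ** ?E Y t)) k) \<le> real CARD('d)" for t k
      unfolding rep_mpow[OF SO_mult[OF SO(1,2)], symmetric]
      by (intro norm_unitary_bounded rep_unitary SO_mpow SO_mult SO)
    show "(\<lambda>n. mpow (\<pi> (?E X (t / real (Suc n)) ** ?E Y (t / real (Suc n)))) (Suc n))
        \<longlonglongrightarrow> \<pi> (?E (X + Y) t)" for t
      unfolding rep_mpow[OF SO_mult[OF SO(1,2)], symmetric]
      by (rule continuous_on_tendsto_compose[OF rep_continuous trotter_SO[OF X Y] SO(3)])
         (auto intro!: always_eventually SO_mpow SO_mult SO)
  qed (simp add: rep_one)
qed

text \<open>
  The differential is meaningful on skew matrices only.  Precomposed with the projection to the skew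
  part it becomes a linear map on all matrices, which can be applied to matrix-valued functions and
  differentiated through.
\<close>

definition skew_rep :: "real^'n^'n \<Rightarrow> complex^'d^'d" where
  "skew_rep X = drep \<pi> ((1 / 2) *\<^sub>R (X - transpose X))"

lemma skew_rep_eq: "transpose X = - X \<Longrightarrow> skew_rep X = drep \<pi> X"
proof -
  assume X: "transpose X = - X"
  have "(1 / 2) *\<^sub>R (X - transpose X) = X" unfolding X by (simp add: vec_eq_iff)
  then show ?thesis by (simp add: skew_rep_def)
qed

lemma bounded_linear_skew_rep: "bounded_linear skew_rep"
  unfolding linear_conv_bounded_linear[symmetric]
proof (rule linearI)
  have skew: "transpose ((1 / 2) *\<^sub>R (X - transpose X)) = - ((1 / 2) *\<^sub>R (X - transpose X))"
    for X :: "real^'n^'n"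
    by (simp add: transpose_def vec_eq_iff field_simps)
  fix X Y :: "real^'n^'n" and c :: real
  have "(1 / 2) *\<^sub>R (X + Y - transpose (X + Y)) =
      (1 / 2) *\<^sub>R (X - transpose X) + (1 / 2) *\<^sub>R (Y - transpose Y)"
    by (simp add: transpose_def vec_eq_iff field_simps)
  then show "skew_rep (X + Y) = skew_rep X + skew_rep Y"
    by (simp only: skew_rep_def drep_add[OF skew skew])
  have "(1 / 2) *\<^sub>R (c *\<^sub>R X - transpose (c *\<^sub>R X)) = c *\<^sub>R ((1 / 2) *\<^sub>R (X - transpose X))"
    by (simp add: transpose_def vec_eq_iff algebra_simps)
  then show "skew_rep (c *\<^sub>R X) = c *\<^sub>R skew_rep X"
    by (simp only: skew_rep_def drep_scaleR[OF skew])
qed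

lemma drep_conj:
  assumes X: "transpose X = - X" and h: "h \<in> SO_group"
  shows "\<pi> h ** drep \<pi> X ** \<pi> (transpose h) = drep \<pi> (h ** X ** transpose h)"
proof (rule drep_eqI[symmetric])
  show "transpose (h ** X ** transpose h) = - (h ** X ** transpose h)"
    by (simp add: matrix_transpose_mul X matrix_mult_linear matrix_mul_assoc)
  have eq: "mat_exp (t *\<^sub>R (h ** X ** transpose h)) = h ** mat_exp (t *\<^sub>R X) ** transpose h" for t
    by (simp add: mat_exp_conj[OF SO_transpose_mult[OF h]] matrix_mult_linear)
  have "((\<lambda>t. \<pi> h ** \<pi> (mat_exp (t *\<^sub>R X)) ** \<pi> (transpose h)) has_vector_derivative
      \<pi> h ** drep \<pi> X ** \<pi> (transpose h)) (at 0)"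
    by (intro bounded_linear.has_vector_derivative[OF
          bounded_bilinear.bounded_linear_left[OF bounded_bilinear_matrix_mult]]
        bounded_linear.has_vector_derivative[OF
          bounded_bilinear.bounded_linear_right[OF bounded_bilinear_matrix_mult]] drep_derivative X)
  then show "((\<lambda>t. \<pi> (mat_exp (t *\<^sub>R (h ** X ** transpose h)))) has_vector_derivative
      \<pi> h ** drep \<pi> X ** \<pi> (transpose h)) (at 0)"
    by (simp add: eq rep_mult SO_mult h SO_transpose mat_exp_skew_SO X)
qed

text \<open>
  The bracket is the derivative at 0 of \<open>Y\<close> conjugated by the one-parameter group of \<open>X\<close>; by
  \<open>drep_conj\<close> the representation turns this curve into the conjugate of \<open>drep \<pi> Y\<close> by \<open>\<pi> (mat_exp (t X))\<close>.
\<close>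

lemma drep_bracket:
  assumes X: "transpose X = - X" and Y: "transpose Y = - Y"
  shows "drep \<pi> (X ** Y - Y ** X) = drep \<pi> X ** drep \<pi> Y - drep \<pi> Y ** drep \<pi> X"
proof -
  let ?E = "\<lambda>t. mat_exp (t *\<^sub>R X)"
  note mult_deriv = has_vector_derivative_bilinear[OF bounded_bilinear_matrix_mult]
  have SO: "?E t \<in> SO_group" "transpose (?E t) \<in> SO_group" for t
    by (simp_all add: mat_exp_skew_SO X SO_transpose)
  have tr: "transpose (?E t) = mat_exp (t *\<^sub>R (- X))" for t
    using transpose_mat_exp_skew[OF X, of t] by simp
  have mX: "transpose (- X) = - (- X)" using transpose_skew_scaleR[OF X, of "-1"] by simp
  have dm: "drep \<pi> (- X) = - drep \<pi> X" using drep_scaleR[OF X, of "-1"] by simp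
  have D1: "((\<lambda>t. \<pi> (?E t) ** drep \<pi> Y ** \<pi> (mat_exp (t *\<^sub>R (- X)))) has_vector_derivative
      (\<pi> (?E 0) ** drep \<pi> Y) ** drep \<pi> (- X) +
      (\<pi> (?E 0) ** 0 + drep \<pi> X ** drep \<pi> Y) ** \<pi> (mat_exp (0 *\<^sub>R (- X)))) (at 0)"
    by (intro mult_deriv drep_derivative X mX has_vector_derivative_const)
  have "((\<lambda>t. ?E t ** Y ** mat_exp (t *\<^sub>R (- X))) has_vector_derivative
      (?E 0 ** Y) ** (mat_exp (0 *\<^sub>R (- X)) ** (- X)) +
      (?E 0 ** 0 + (?E 0 ** X) ** Y) ** mat_exp (0 *\<^sub>R (- X))) (at 0)"
    by (intro mult_deriv mat_exp_scaleR_derivative has_vector_derivative_const)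
  note D2 = bounded_linear.has_vector_derivative[OF bounded_linear_skew_rep this]
  have eq: "skew_rep (?E t ** Y ** mat_exp (t *\<^sub>R (- X))) =
      \<pi> (?E t) ** drep \<pi> Y ** \<pi> (mat_exp (t *\<^sub>R (- X)))" for t
  proof -
    have "transpose (?E t ** Y ** transpose (?E t)) = - (?E t ** Y ** transpose (?E t))"
      by (simp add: matrix_transpose_mul Y matrix_mult_linear matrix_mul_assoc)
    then show ?thesis
      using drep_conj[OF Y SO(1)] by (simp only: skew_rep_eq tr)
  qed
  have "skew_rep ((?E 0 ** Y) ** (mat_exp (0 *\<^sub>R (- X)) ** (- X)) +
      (?E 0 ** 0 + (?E 0 ** X) ** Y) ** mat_exp (0 *\<^sub>R (- X))) =
      (\<pi> (?E 0) ** drep \<pi> Y) ** drep \<pi> (- X) +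
      (\<pi> (?E 0) ** 0 + drep \<pi> X ** drep \<pi> Y) ** \<pi> (mat_exp (0 *\<^sub>R (- X)))"
    by (rule vector_derivative_unique_at[OF D2[unfolded eq] D1])
  then have "skew_rep (X ** Y - Y ** X) = drep \<pi> X ** drep \<pi> Y - drep \<pi> Y ** drep \<pi> X"
    by (simp add: rep_one dm matrix_mult_linear
        bounded_bilinear.zero_right[OF bounded_bilinear_matrix_mult])
  moreover have "transpose (X ** Y - Y ** X) = - (X ** Y - Y ** X)"
  proof -
    have "transpose (X ** Y - Y ** X) = transpose (X ** Y) - transpose (Y ** X)"
      by (simp add: transpose_def vec_eq_iff)
    then show ?thesis by (simp add: matrix_transpose_mul X Y matrix_mult_linear)
  qed
  ultimately show ?thesis by (simp add: skew_rep_eq)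
qed

end

section \<open>The extension to the enveloping algebra\<close>

lemma mat_mult_component: "(mat c ** M) $ a $ b = c * M $ a $ b"
proof -
  have "(\<Sum>k\<in>UNIV. (if a = k then c else 0) * M $ k $ b) = (\<Sum>k\<in>UNIV. if a = k then c * M $ k $ b else 0)"
    by (intro sum.cong) auto
  then show ?thesis by (simp add: matrix_matrix_mult_def mat_def)
qed

lemma mult_mat_component: "(M ** mat c) $ a $ b = M $ a $ b * (c :: complex)"
proof -
  have "(\<Sum>k\<in>UNIV. M $ a $ k * (if k = b then c else 0)) = (\<Sum>k\<in>UNIV. if k = b then M $ a $ k * c else 0)"
    by (intro sum.cong) auto
  then show ?thesis by (simp add: matrix_matrix_mult_def mat_def)
qed

lemma mat_central: "mat c ** M = M ** mat (c :: complex)"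
  by (simp add: vec_eq_iff mat_mult_component mult_mat_component mult.commute)

lemma mat_minus_one_mult: "mat (- 1) ** M = - (M :: complex^'d^'d)"
  by (simp add: vec_eq_iff mat_mult_component)

lemma mat_0: "mat 0 = (0 :: complex^'d^'d)"
  by (simp add: vec_eq_iff mat_def)

lemma transpose_e_mat: "transpose (e_mat i j) = - e_mat i j"
  by (simp add: vec_eq_iff transpose_def e_mat_def conj_commute)

lemma Rep_Abs_e_mat: "Rep_so_C (Abs_so_C (e_mat i j)) = e_mat i j"
  by (simp add: Abs_so_C_inverse transpose_e_mat)

definition re_part :: "complex^'n^'n \<Rightarrow> real^'n^'n" where
  "re_part X = (\<chi> a b. Re (X $ a $ b))"

definition im_part :: "complex^'n^'n \<Rightarrow> real^'n^'n" where
  "im_part X = (\<chi> a b. Im (X $ a $ b))"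

lemma re_im_part_skew:
  assumes "transpose X = - X"
  shows "transpose (re_part X) = - re_part X" "transpose (im_part X) = - im_part X"
proof -
  have "X $ j $ i = - X $ i $ j" for i j
    using arg_cong[OF assms, of "\<lambda>Z. Z $ i $ j"] by (simp add: transpose_def)
  then have re: "Re (X $ j $ i) = - Re (X $ i $ j)" and im: "Im (X $ j $ i) = - Im (X $ i $ j)" for i j
    by (metis uminus_complex.simps(1), metis uminus_complex.simps(2))
  have "transpose (re_part X) $ i $ j = (- re_part X) $ i $ j"
    "transpose (im_part X) $ i $ j = (- im_part X) $ i $ j" for i j
    by (simp_all add: transpose_def re_part_def im_part_def) (rule re im)+
  then show "transpose (re_part X) = - re_part X" "transpose (im_part X) = - im_part X"
    unfolding vec_eq_iff by blast+
qed

lemma re_im_part_linear: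
  "re_part (X + Y) = re_part X + re_part Y" "im_part (X + Y) = im_part X + im_part Y"
  "re_part (mat c ** X) = Re c *\<^sub>R re_part X - Im c *\<^sub>R im_part X"
  "im_part (mat c ** X) = Re c *\<^sub>R im_part X + Im c *\<^sub>R re_part X"
  by (simp_all add: vec_eq_iff re_part_def im_part_def mat_mult_component)

lemma re_im_part_mult:
  "re_part (X ** Y) = re_part X ** re_part Y - im_part X ** im_part Y"
  "im_part (X ** Y) = re_part X ** im_part Y + im_part X ** re_part Y"
  by (simp_all add: vec_eq_iff re_part_def im_part_def matrix_matrix_mult_def
      sum_subtractf sum.distrib)

lemma re_im_part_diff:
  "re_part (X - Y) = re_part X - re_part Y" "im_part (X - Y) = im_part X - im_part Y"
  by (simp_all add: vec_eq_iff re_part_def im_part_def)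

context so_representation
begin

lemma drep_complex_eq:
  "transpose X = - X \<Longrightarrow> drep_complex \<pi> X = skew_rep (re_part X) + mat \<i> ** skew_rep (im_part X)"
  by (simp add: drep_complex_def re_part_def[symmetric] im_part_def[symmetric] skew_rep_eq re_im_part_skew)

lemmas skew_rep_linear =
  linear_add[OF bounded_linear.linear[OF bounded_linear_skew_rep]]
  linear_diff[OF bounded_linear.linear[OF bounded_linear_skew_rep]]
  linear_scale[OF bounded_linear.linear[OF bounded_linear_skew_rep]]
  linear_0[OF bounded_linear.linear[OF bounded_linear_skew_rep]]

lemma skew_rep_bracket:
  assumes "transpose X = - X" "transpose Y = - Y"
  shows "skew_rep (X ** Y - Y ** X) = skew_rep X ** skew_rep Y - skew_rep Y ** skew_rep X"
proof -
  have "transpose (X ** Y - Y ** X) = transpose (X ** Y) - transpose (Y ** X)"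
    by (simp add: transpose_def vec_eq_iff)
  then have "transpose (X ** Y - Y ** X) = - (X ** Y - Y ** X)"
    by (simp add: matrix_transpose_mul assms matrix_mult_linear)
  then show ?thesis by (simp add: skew_rep_eq assms drep_bracket)
qed

lemma drep_complex_bracket:
  assumes X: "transpose X = - X" and Y: "transpose Y = - Y" and Z: "transpose (X ** Y - Y ** X) = - (X ** Y - Y ** X)"
  shows "drep_complex \<pi> (X ** Y - Y ** X) =
    drep_complex \<pi> X ** drep_complex \<pi> Y - drep_complex \<pi> Y ** drep_complex \<pi> X"
proof -
  note sk = re_im_part_skew[OF X] re_im_part_skew[OF Y]
  let ?L = skew_rep
  have re: "re_part (X ** Y - Y ** X) = (re_part X ** re_part Y - re_part Y ** re_part X) -
      (im_part X ** im_part Y - im_part Y ** im_part X)"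
    and im: "im_part (X ** Y - Y ** X) = (re_part X ** im_part Y - im_part Y ** re_part X) +
      (im_part X ** re_part Y - re_part Y ** im_part X)"
    by (simp_all add: re_im_part_diff re_im_part_mult)
  have mult: "(M + mat \<i> ** M') ** (N + mat \<i> ** N') = M ** N - M' ** N' + mat \<i> ** (M ** N' + M' ** N)"
    for M M' N N' :: "complex^'d^'d"
  proof -
    have "mat \<i> ** M' ** (mat \<i> ** N') = mat \<i> ** (mat \<i> ** (M' ** N'))"
      by (metis mat_central matrix_mul_assoc)
    also have "\<dots> = - (M' ** N')" by (simp add: vec_eq_iff mat_mult_component flip: mult.assoc)
    finally have "mat \<i> ** M' ** (mat \<i> ** N') = - (M' ** N')" .
    moreover have "M ** (mat \<i> ** N') = mat \<i> ** (M ** N')"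
      by (metis mat_central matrix_mul_assoc)
    moreover have "mat \<i> ** M' ** N = mat \<i> ** (M' ** N)" by (simp add: matrix_mul_assoc)
    ultimately show ?thesis by (simp add: matrix_mult_linear)
  qed
  show ?thesis
    unfolding drep_complex_eq[OF Z] drep_complex_eq[OF X] drep_complex_eq[OF Y] re im mult
      skew_rep_linear(1)[of "_ ** _ - _ ** _"] skew_rep_linear(2)[of "_ ** _ - _ ** _"]
      skew_rep_bracket[OF sk(1,3)] skew_rep_bracket[OF sk(2,4)]
      skew_rep_bracket[OF sk(1,4)] skew_rep_bracket[OF sk(2,3)]
    by (simp add: matrix_mult_linear)
qed

lemma Rep_so_C_skew: "transpose (Rep_so_C x) = - Rep_so_C x"
  using Rep_so_C[of x] by simp

text \<open>
  The defining relations of the enveloping algebra hold for the images of the generators, because the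
  complexified differential is linear and preserves brackets.
\<close>

lemma uterm_rep_cong: "ueq s t \<Longrightarrow> uterm_rep \<pi> s = uterm_rep \<pi> t"
proof (induction rule: ueq.induct)
  case (add_0 s)
  show ?case by (simp add: mat_0)
next
  case (add_inverse s)
  show ?case by (simp add: mat_minus_one_mult mat_0)
next
  case (mul_assoc s t u)
  show ?case by (simp add: matrix_mul_assoc)
next
  case (Scal_add a b)
  show ?case by (simp add: vec_eq_iff mat_def)
next
  case (Scal_mult a b)
  have "mat (a * b) $ i $ j = (mat a ** mat b :: complex^'d^'d) $ i $ j" for i j
    unfolding mat_mult_component by (simp add: mat_def)
  then show ?case by (simp add: vec_eq_iff del: mat_def)
next
  case (Scal_central a s)
  show ?case by (simp add: mat_central)
next
  case (Gen_add z x y)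
  then have "drep_complex \<pi> (Rep_so_C z) = skew_rep (re_part (Rep_so_C x + Rep_so_C y)) +
      mat \<i> ** skew_rep (im_part (Rep_so_C x + Rep_so_C y))"
    using drep_complex_eq[OF Rep_so_C_skew[of z]] by simp
  then show ?case
    by (simp add: drep_complex_eq Rep_so_C_skew re_im_part_linear skew_rep_linear matrix_mult_linear)
next
  case (Gen_scale z a x)
  then have "drep_complex \<pi> (Rep_so_C z) = skew_rep (re_part (mat a ** Rep_so_C x)) +
      mat \<i> ** skew_rep (im_part (mat a ** Rep_so_C x))"
    using drep_complex_eq[OF Rep_so_C_skew[of z]] by simp
  then show ?case
    by (simp add: drep_complex_eq Rep_so_C_skew re_im_part_linear skew_rep_linear vec_eq_iff
        mat_mult_component complex_eq_iff algebra_simps)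
next
  case (Gen_bracket z x y)
  have "transpose (Rep_so_C x ** Rep_so_C y - Rep_so_C y ** Rep_so_C x) =
      - (Rep_so_C x ** Rep_so_C y - Rep_so_C y ** Rep_so_C x)"
    using Rep_so_C_skew[of z] Gen_bracket by simp
  then have "drep_complex \<pi> (Rep_so_C z) =
      drep_complex \<pi> (Rep_so_C x) ** drep_complex \<pi> (Rep_so_C y) -
      drep_complex \<pi> (Rep_so_C y) ** drep_complex \<pi> (Rep_so_C x)"
    using Gen_bracket drep_complex_bracket[OF Rep_so_C_skew Rep_so_C_skew] by simp
  then show ?case by (simp add: mat_minus_one_mult)
qed (simp_all add: matrix_mult_linear add_ac)

lemma uea_rep_abs: "uea_rep \<pi> (abs_uea s) = uterm_rep \<pi> s"
  unfolding uea_rep_def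
  by (intro uterm_rep_cong Quotient3_rep_abs[OF Quotient3_uea] ueq_refl)

lemma uea_rep_mult: "uea_rep \<pi> (u * v) = uea_rep \<pi> u ** uea_rep \<pi> v"
proof (induction u rule: uea.abs_induct)
  case (1 s)
  show ?case
  proof (induction v rule: uea.abs_induct)
    case (1 t)
    show ?case by (simp add: times_uea.abs_eq uea_rep_abs)
  qed
qed

lemma uea_rep_add: "uea_rep \<pi> (u + v) = uea_rep \<pi> u + uea_rep \<pi> v"
proof (induction u rule: uea.abs_induct)
  case (1 s)
  show ?case
  proof (induction v rule: uea.abs_induct)
    case (1 t)
    show ?case by (simp add: plus_uea.abs_eq uea_rep_abs)
  qed
qed

lemma uea_rep_0: "uea_rep \<pi> 0 = 0"
  using uea_rep_add[of 0 0] by simp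

lemma uea_rep_minus: "uea_rep \<pi> (- u) = - uea_rep \<pi> u"
  using uea_rep_add[of u "- u"] by (simp add: uea_rep_0 minus_unique)

lemma uea_rep_sum: "uea_rep \<pi> (sum f I) = (\<Sum>i\<in>I. uea_rep \<pi> (f i))"
  by (induction I rule: infinite_finite_induct) (simp_all add: uea_rep_0 uea_rep_add)

lemma uea_rep_e: "uea_rep \<pi> (e_uea k l) = skew_rep (re_part (e_mat k l))"
proof -
  have "im_part (e_mat k l) $ i $ j = 0" for i j
    unfolding im_part_def e_mat_def vec_lambda_beta minus_complex.sel if_distrib[of Im]
      zero_complex.sel one_complex.sel if_cancel
    by (rule diff_self)
  then have im: "im_part (e_mat k l) = 0" by (simp add: vec_eq_iff)
  have "uea_rep \<pi> (e_uea k l) = drep_complex \<pi> (e_mat k l)"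
    by (simp add: e_uea_def uea_gen.abs_eq uea_rep_abs Rep_Abs_e_mat)
  also have "\<dots> = skew_rep (re_part (e_mat k l)) + mat \<i> ** 0"
    unfolding drep_complex_eq[OF transpose_e_mat] im skew_rep_linear(4) ..
  finally show ?thesis
    by (simp add: bounded_bilinear.zero_right[OF bounded_bilinear_matrix_mult])
qed

end

section \<open>Expansion of Pfaffians in a noncommutative ring\<close>

text \<open>
  Factors of a Pfaffian term have disjoint indices and commute, so a chosen factor can be moved to the
  end of the noncommutative product.
\<close>

lemma prod_list_move_last:
  fixes f :: "'b \<Rightarrow> 'r::monoid_mult"
  assumes "distinct xs" "x \<in> set xs"
    and "\<And>y. y \<in> set xs \<Longrightarrow> y \<noteq> x \<Longrightarrow> f y * f x = f x * f y"
  shows "prod_list (map f xs) = prod_list (map f (filter (\<lambda>y. y \<noteq> x) xs)) * f x"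
  using assms
proof (induction xs)
  case (Cons a xs)
  have comm: "prod_list (map f ys) * f x = f x * prod_list (map f ys)"
    if "\<And>y. y \<in> set ys \<Longrightarrow> f y * f x = f x * f y" for ys
    using that by (induction ys) (auto simp: mult.assoc, metis mult.assoc)
  show ?case
  proof (cases "a = x")
    case True
    then have "x \<notin> set xs" using Cons.prems by auto
    then have "filter (\<lambda>y. y \<noteq> x) xs = xs" by (auto simp: filter_id_conv)
    moreover have "f y * f x = f x * f y" if "y \<in> set xs" for y
      using that Cons.prems(3)[of y] \<open>x \<notin> set xs\<close> by auto
    ultimately show ?thesis using True comm[of xs] by simp
  next
    case False
    then show ?thesis using Cons by (auto simp: mult.assoc)
  qed
qed simp

abbreviation transposition :: "'a \<Rightarrow> 'a \<Rightarrow> 'a \<Rightarrow> 'a" where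
  "transposition \<equiv> Transposition.transpose"

lemma sign_compose_transpose:
  fixes \<tau> :: "'n::finite \<Rightarrow> 'n"
  assumes "\<tau> permutes UNIV" "a \<noteq> b"
  shows "sign (\<tau> \<circ> transposition a b) = - sign \<tau>"
proof -
  have "permutation \<tau>" using assms(1) by (auto simp: permutation_permutes)
  then show ?thesis using assms(2) by (simp add: sign_compose permutation_swap_id sign_swap_id)
qed

lemma permutes_UNIV_compose_transpose:
  "\<tau> permutes UNIV \<Longrightarrow> (\<tau> \<circ> transposition a b) permutes UNIV"
  by (intro permutes_compose permutes_swap_id) auto

text \<open>
  These are the relations of the orthogonal Lie algebra that the expansion uses: the commutator of
  \<open>e k l\<close> and \<open>e k j\<close> does not involve \<open>k\<close>.  The function \<open>pos\<close> numbers the index set; a permutation \<open>\<tau>\<close> puts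
  the index \<open>\<tau> (pos r)\<close> at position \<open>r\<close> of the Pfaffian term, whose factors take the positions \<open>2 r\<close>
  and \<open>2 r + 1\<close>.
\<close>

locale pfaffian_ring =
  fixes e :: "'n::finite \<Rightarrow> 'n \<Rightarrow> 'r::ring_1" and pos :: "nat \<Rightarrow> 'n" and m :: nat
  assumes e_swap: "e j i = - e i j" and e_diag: "e i i = 0"
    and e_commute: "{i, j} \<inter> {k, l} = {} \<Longrightarrow> e i j * e k l = e k l * e i j"
    and e_bracket: "{i, k} \<inter> {j, l} = {} \<Longrightarrow>
      e k l * e k j - e k j * e k l = e i l * e i j - e i j * e i l"
    and pos: "bij_betw pos {..<2 * m} UNIV"
begin

definition pair :: "('n \<Rightarrow> 'n) \<Rightarrow> nat \<Rightarrow> 'r" where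
  "pair \<tau> r = e (\<tau> (pos (2 * r))) (\<tau> (pos (2 * r + 1)))"

definition tail :: "('n \<Rightarrow> 'n) \<Rightarrow> 'r" where
  "tail \<tau> = prod_list (map (pair \<tau>) [1..<m])"

text \<open>
  Up to sign this is the Pfaffian sum over the complement of \<open>{i, j}\<close>.  Writing it as a sum over
  permutations of all indices makes the signs uniform in \<open>i\<close> and \<open>j\<close>.
\<close>

definition minor :: "'n \<Rightarrow> 'n \<Rightarrow> 'r" where
  "minor i j = (\<Sum>\<tau> | \<tau> permutes UNIV \<and> \<tau> (pos 0) = i \<and> \<tau> (pos 1) = j. of_int (sign \<tau>) * tail \<tau>)"

text \<open>
  The \<open>(i, k)\<close> entry of the product of the matrices of minors and of generators, up to sign.
\<close>

definition row :: "'n \<Rightarrow> 'n \<Rightarrow> 'r" where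
  "row i k = (\<Sum>\<tau> | \<tau> permutes UNIV \<and> \<tau> (pos 0) = i. of_int (sign \<tau>) * tail \<tau> * e k (\<tau> (pos 1)))"

definition pfaffian :: 'r where
  "pfaffian = (\<Sum>\<tau> | \<tau> permutes UNIV. of_int (sign \<tau>) * prod_list (map (pair \<tau>) [0..<m]))"

lemma pos_inj: "k < 2 * m \<Longrightarrow> l < 2 * m \<Longrightarrow> pos k = pos l \<longleftrightarrow> k = l"
  using pos by (auto simp: bij_betw_def inj_on_def)

lemma permutes_inj_iff: "\<tau> permutes UNIV \<Longrightarrow> \<tau> x = \<tau> y \<longleftrightarrow> x = y"
  using permutes_inj[of \<tau> UNIV] by (auto simp: inj_def)

lemma pair_commute:
  assumes "\<tau> permutes UNIV" "r < m" "s < m" "r \<noteq> s"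
  shows "pair \<tau> r * pair \<tau> s = pair \<tau> s * pair \<tau> r"
proof -
  have "2 * r \<noteq> 2 * s + 1" "2 * r + 1 \<noteq> 2 * s" by presburger+
  then show ?thesis
    unfolding pair_def using assms
    by (intro e_commute) (auto simp: permutes_inj_iff pos_inj)
qed

text \<open>
  The position that shares a factor with position \<open>q\<close>; \<open>orient q\<close> below is the sign that brings the index
  at \<open>q\<close> to the first place of this factor, and \<open>rest q\<close> is the product of the remaining factors
  after the first.
\<close>

definition partner :: "nat \<Rightarrow> nat" where
  "partner q = (if even q then q + 1 else q - 1)"

definition orient :: "nat \<Rightarrow> 'r" where
  "orient q = (if even q then 1 else - 1)"

definition rest :: "nat \<Rightarrow> ('n \<Rightarrow> 'n) \<Rightarrow> 'r" where
  "rest q \<tau> = prod_list (map (pair \<tau>) (filter (\<lambda>r. r \<noteq> q div 2) [1..<m]))"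

lemma tail_eq_rest:
  assumes \<tau>: "\<tau> permutes UNIV" and q: "2 \<le> q" "q < 2 * m"
  shows "tail \<tau> = rest q \<tau> * orient q * e (\<tau> (pos q)) (\<tau> (pos (partner q)))"
proof -
  have "tail \<tau> = rest q \<tau> * pair \<tau> (q div 2)"
    unfolding tail_def rest_def
    by (rule prod_list_move_last) (use q \<tau> pair_commute[OF \<tau>] in auto)
  also have "pair \<tau> (q div 2) = orient q * e (\<tau> (pos q)) (\<tau> (pos (partner q)))"
  proof (cases "even q")
    case True
    then show ?thesis by (auto simp: pair_def orient_def partner_def elim!: evenE)
  next
    case False
    then show ?thesis
      using e_swap[of "\<tau> (pos (q - 1))" "\<tau> (pos q)"]
      by (auto simp: pair_def orient_def partner_def elim!: oddE)
  qed
  finally show ?thesis by (simp add: mult.assoc)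
qed

lemma partner_bounds: "2 \<le> q \<Longrightarrow> q < 2 * m \<Longrightarrow> 2 \<le> partner q \<and> partner q < 2 * m \<and> partner q \<noteq> q"
  unfolding partner_def by (auto elim!: oddE evenE)

lemma rest_cong:
  assumes "\<And>p. p < 2 * m \<Longrightarrow> p \<noteq> 0 \<Longrightarrow> p \<noteq> 1 \<Longrightarrow> p \<noteq> q \<Longrightarrow> p \<noteq> partner q \<Longrightarrow> \<tau> (pos p) = \<tau>' (pos p)"
  shows "rest q \<tau> = rest q \<tau>'"
proof -
  have "pair \<tau> r = pair \<tau>' r" if "r \<in> set (filter (\<lambda>r. r \<noteq> q div 2) [1..<m])" for r
  proof -
    have "2 * r \<noteq> partner q" "2 * r + 1 \<noteq> partner q" "2 * r \<noteq> q" "2 * r + 1 \<noteq> q"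
      using that unfolding partner_def by (auto elim!: oddE evenE)
    then show ?thesis unfolding pair_def using that by (auto intro!: arg_cong2[where f = e] assms)
  qed
  then show ?thesis unfolding rest_def by (intro arg_cong[where f = prod_list] map_cong refl)
qed

lemma rest_transpose:
  assumes "a \<in> {0, 1, q, partner q}" "b \<in> {0, 1, q, partner q}" "2 \<le> q" "q < 2 * m"
  shows "rest q (\<tau> \<circ> transposition (pos a) (pos b)) = rest q \<tau>"
proof (rule rest_cong)
  fix p assume p: "p < 2 * m" "p \<noteq> 0" "p \<noteq> 1" "p \<noteq> q" "p \<noteq> partner q"
  then have "pos p \<noteq> pos a" "pos p \<noteq> pos b"
    using assms partner_bounds[of q] by (auto simp: pos_inj)
  then show "(\<tau> \<circ> transposition (pos a) (pos b)) (pos p) = \<tau> (pos p)" by (simp add: Transposition.transpose_def)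
qed

text \<open>
  The part of the row expansion in which \<open>k\<close> stands at position \<open>q\<close>.  Exchanging the positions 1 and
  \<open>partner q\<close> changes the sign, hence only a commutator \<open>[e k l, e k j]\<close> survives; it is the same for
  \<open>i\<close> in place of \<open>k\<close>, while exchanging the positions 0 and \<open>q\<close> changes the sign again.
\<close>

lemma row_part_antisym:
  assumes q: "2 \<le> q" "q < 2 * m" and ik: "i \<noteq> k"
  defines "piece \<equiv> \<lambda>i k. \<Sum>\<tau> | \<tau> permutes UNIV \<and> \<tau> (pos 0) = i \<and> \<tau> (pos q) = k.
      of_int (sign \<tau>) * tail \<tau> * e k (\<tau> (pos 1))"
  shows "2 * piece i k + 2 * piece k i = 0"
proof -
  let ?q' = "partner q"
  note q' = partner_bounds[OF q]
  let ?P = "\<lambda>i k. {\<tau>. \<tau> permutes UNIV \<and> \<tau> (pos 0) = i \<and> \<tau> (pos q) = k}"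
  let ?s = "transposition (pos 1) (pos ?q')" and ?t = "transposition (pos 0) (pos q)"
  have ne: "pos 1 \<noteq> pos ?q'" "pos 0 \<noteq> pos q" "pos 0 \<noteq> pos 1" "pos 0 \<noteq> pos ?q'"
    "pos q \<noteq> pos 1" "pos q \<noteq> pos ?q'"
    using q q' by (auto simp: pos_inj)
  define comm where "comm \<tau> k = of_int (sign \<tau>) * (rest q \<tau> * orient q) *
      (e k (\<tau> (pos ?q')) * e k (\<tau> (pos 1)) - e k (\<tau> (pos 1)) * e k (\<tau> (pos ?q')))" for \<tau> k
  have two: "2 * piece i k = (\<Sum>\<tau>\<in>?P i k. comm \<tau> k)" for i k
  proof -
    let ?f = "\<lambda>\<tau>. of_int (sign \<tau>) * tail \<tau> * e k (\<tau> (pos 1))"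
    have "sum ?f (?P i k) = (\<Sum>\<tau>\<in>?P i k. ?f (\<tau> \<circ> ?s))"
      by (rule sum.reindex_bij_witness[where i = "\<lambda>\<tau>. \<tau> \<circ> ?s" and j = "\<lambda>\<tau>. \<tau> \<circ> ?s"])
         (use ne in \<open>auto simp: o_assoc[symmetric] permutes_UNIV_compose_transpose transpose_apply_other\<close>)
    then have "2 * piece i k = (\<Sum>\<tau>\<in>?P i k. ?f \<tau> + ?f (\<tau> \<circ> ?s))"
      unfolding piece_def mult_2 sum.distrib by simp
    also have "\<dots> = (\<Sum>\<tau>\<in>?P i k. comm \<tau> k)"
    proof (intro sum.cong refl)
      fix \<tau> assume "\<tau> \<in> ?P i k"
      then have \<tau>: "\<tau> permutes UNIV" "\<tau> (pos q) = k" by auto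
      have "rest q (\<tau> \<circ> ?s) = rest q \<tau>" using q by (intro rest_transpose) auto
      then show "?f \<tau> + ?f (\<tau> \<circ> ?s) = comm \<tau> k"
        using ne unfolding comm_def
        by (simp add: tail_eq_rest[OF \<tau>(1) q] tail_eq_rest[OF permutes_UNIV_compose_transpose[OF \<tau>(1)] q]
            sign_compose_transpose[OF \<tau>(1)] \<tau>(2) transpose_apply_other right_diff_distrib mult.assoc)
    qed
    finally show ?thesis .
  qed
  have "(\<Sum>\<tau>\<in>?P k i. comm \<tau> i) = (\<Sum>\<tau>\<in>?P i k. comm (\<tau> \<circ> ?t) i)"
    by (rule sum.reindex_bij_witness[where i = "\<lambda>\<tau>. \<tau> \<circ> ?t" and j = "\<lambda>\<tau>. \<tau> \<circ> ?t"])
       (use ne in \<open>auto simp: o_assoc[symmetric] permutes_UNIV_compose_transpose\<close>)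
  also have "\<dots> = (\<Sum>\<tau>\<in>?P i k. - comm \<tau> k)"
  proof (intro sum.cong refl)
    fix \<tau> assume "\<tau> \<in> ?P i k"
    then have \<tau>: "\<tau> permutes UNIV" "\<tau> (pos q) = k" "\<tau> (pos 0) = i" by auto
    have "rest q (\<tau> \<circ> ?t) = rest q \<tau>" using q by (intro rest_transpose) auto
    moreover have "{i, k} \<inter> {\<tau> (pos 1), \<tau> (pos ?q')} = {}"
      using ne by (auto simp: \<tau>(2,3)[symmetric] permutes_inj_iff[OF \<tau>(1)])
    note e_bracket[OF this]
    ultimately show "comm (\<tau> \<circ> ?t) i = - comm \<tau> k"
      using ne unfolding comm_def
      by (simp add: sign_compose_transpose[OF \<tau>(1)] transpose_apply_other)
  qed
  finally show ?thesis unfolding two sum_negf by simp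
qed

text \<open>
  The sum is split by the position of \<open>k\<close> in the first summand and of \<open>i\<close> in the second.  Position 1 gives a
  factor \<open>e k k\<close>.  The factor 2 remains because the ring may have 2-torsion.
\<close>

lemma row_antisym:
  assumes ik: "i \<noteq> k"
  shows "2 * (row i k + row k i) = 0"
proof -
  define piece where "piece i k x = (\<Sum>\<tau> | \<tau> permutes UNIV \<and> \<tau> (pos 0) = i \<and> \<tau> x = k.
      of_int (sign \<tau>) * tail \<tau> * e k (\<tau> (pos 1)))" for i k x
  have row: "row i k = (\<Sum>x\<in>UNIV. piece i k x)" for i k
  proof -
    have "row i k = (\<Sum>x\<in>UNIV. \<Sum>\<tau> | \<tau> \<in> {\<tau>. \<tau> permutes UNIV \<and> \<tau> (pos 0) = i} \<and> inv \<tau> k = x.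
        of_int (sign \<tau>) * tail \<tau> * e k (\<tau> (pos 1)))"
      unfolding row_def by (rule sum.group[symmetric]) auto
    also have "\<dots> = (\<Sum>x\<in>UNIV. piece i k x)"
      unfolding piece_def
      by (intro sum.cong refl Collect_cong) (auto simp: permutes_inv_eq permutes_inverses)
    finally show ?thesis .
  qed
  have "2 * piece i k x + 2 * piece k i x = 0" for x
  proof -
    obtain q where q: "q < 2 * m" "x = pos q"
      using pos by (force simp: bij_betw_def)
    consider "q = 0" | "q = 1" | "2 \<le> q" by linarith
    then show ?thesis
    proof cases
      case 1
      then have "{\<tau>. \<tau> permutes UNIV \<and> \<tau> (pos 0) = i \<and> \<tau> x = k} = {}"
        "{\<tau>. \<tau> permutes UNIV \<and> \<tau> (pos 0) = k \<and> \<tau> x = i} = {}" using q ik by auto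
      then show ?thesis by (simp only: piece_def sum.empty) simp
    next
      case 2
      then have "piece i k x = 0" "piece k i x = 0"
        unfolding piece_def using q by (auto intro!: sum.neutral simp: e_diag)
      then show ?thesis by simp
    next
      case 3
      then show ?thesis using row_part_antisym[OF 3 q(1) ik] by (simp add: piece_def q(2))
    qed
  qed
  then have "(\<Sum>x\<in>UNIV. 2 * piece i k x + 2 * piece k i x) = 0" by simp
  then show ?thesis
    by (simp add: row sum.distrib sum_distrib_left distrib_left)
qed

text \<open>
  The terms of the full Pfaffian are split by the position of \<open>i\<close>, and each position contributes the same
  amount: exchanging two factors is an even permutation and the factors commute, while exchanging
  the two places of a factor changes both the sign and the factor.
\<close>

lemma row_diag:
  assumes m: "m \<ge> 1"
  shows "of_nat (2 * m) * row i i = pfaffian"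
proof -
  let ?f = "\<lambda>\<tau>. of_int (sign \<tau>) * tail \<tau> * e (\<tau> (pos 0)) (\<tau> (pos 1))"
  have f: "?f \<tau> = of_int (sign \<tau>) * prod_list (map (pair \<tau>) [0..<m])" if \<tau>: "\<tau> permutes UNIV" for \<tau>
  proof -
    have "filter (\<lambda>r. r \<noteq> 0) [0..<m] = [1..<m]"
      using m by (simp add: upt_conv_Cons filter_id_conv)
    then have "prod_list (map (pair \<tau>) [0..<m]) = tail \<tau> * pair \<tau> 0"
      unfolding tail_def using m pair_commute[OF \<tau>]
      by (subst prod_list_move_last[where x = 0]) auto
    then show ?thesis by (simp add: pair_def mult.assoc)
  qed
  have part: "(\<Sum>\<tau> | \<tau> permutes UNIV \<and> \<tau> x = i. ?f \<tau>) = row i i" for x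
  proof -
    obtain q where q: "q < 2 * m" "x = pos q"
      using pos by (force simp: bij_betw_def)
    let ?P = "\<lambda>x. {\<tau>. \<tau> permutes UNIV \<and> \<tau> x = i}"
    have row: "row i i = sum ?f (?P (pos 0))"
      unfolding row_def by (intro sum.cong) auto
    consider "q = 0" | "q = 1" | "2 \<le> q" by linarith
    then show ?thesis
    proof cases
      case 1
      then show ?thesis by (simp add: row q(2))
    next
      case 2
      let ?s = "transposition (pos 0) (pos 1)"
      have ne: "pos 0 \<noteq> pos 1" using 2 q by (simp add: pos_inj)
      have "sum ?f (?P (pos 1)) = (\<Sum>\<tau>\<in>?P (pos 0). ?f (\<tau> \<circ> ?s))"
        by (rule sum.reindex_bij_witness[where i = "\<lambda>\<tau>. \<tau> \<circ> ?s" and j = "\<lambda>\<tau>. \<tau> \<circ> ?s"])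
           (use ne in \<open>auto simp: o_assoc[symmetric] permutes_UNIV_compose_transpose\<close>)
      also have "\<dots> = sum ?f (?P (pos 0))"
      proof (intro sum.cong refl)
        fix \<tau> assume "\<tau> \<in> ?P (pos 0)"
        then have \<tau>: "\<tau> permutes UNIV" by auto
        have "pair (\<tau> \<circ> ?s) r = pair \<tau> r" if "r \<in> set [1..<m]" for r
          using that q by (simp add: pair_def Transposition.transpose_def pos_inj)
        then have "tail (\<tau> \<circ> ?s) = tail \<tau>"
          unfolding tail_def by (intro arg_cong[where f = prod_list] map_cong refl)
        then show "?f (\<tau> \<circ> ?s) = ?f \<tau>"
          using ne e_swap[of "\<tau> (pos 1)" "\<tau> (pos 0)"] by (simp add: sign_compose_transpose[OF \<tau>])
      qed
      finally show ?thesis by (simp add: row q(2) 2)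
    next
      case 3
      let ?q' = "partner q"
      note q' = partner_bounds[OF 3 q(1)]
      have ne: "pos 1 \<noteq> pos ?q'" "pos 0 \<noteq> pos q" "pos 0 \<noteq> pos 1" "pos 0 \<noteq> pos ?q'"
        "pos q \<noteq> pos 1" "pos q \<noteq> pos ?q'"
        using q 3 q' by (auto simp: pos_inj)
      let ?s = "transposition (pos 0) (pos q)" and ?t = "transposition (pos 1) (pos ?q')"
      have st: "?s \<circ> ?t = ?t \<circ> ?s" 
        using ne by (auto simp: fun_eq_iff Transposition.transpose_def)
      have inv: "?s \<circ> ?t \<circ> (?s \<circ> ?t) = id"
      proof -
        have "?s \<circ> ?t \<circ> (?s \<circ> ?t) = ?s \<circ> (?t \<circ> ?s) \<circ> ?t" by (simp only: comp_assoc)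
        also have "\<dots> = (?s \<circ> ?s) \<circ> (?t \<circ> ?t)" by (simp only: st[symmetric] comp_assoc)
        also have "\<dots> = id" by simp
        finally show ?thesis .
      qed
      have "sum ?f (?P (pos q)) = (\<Sum>\<tau>\<in>?P (pos 0). ?f (\<tau> \<circ> (?s \<circ> ?t)))"
        by (rule sum.reindex_bij_witness[where i = "\<lambda>\<tau>. \<tau> \<circ> (?s \<circ> ?t)" and j = "\<lambda>\<tau>. \<tau> \<circ> (?s \<circ> ?t)"])
           (use ne in \<open>auto simp: comp_assoc inv[unfolded comp_assoc One_nat_def] transpose_apply_other
              intro!: permutes_compose permutes_swap_id\<close>)
      also have "\<dots> = sum ?f (?P (pos 0))"
      proof (intro sum.cong refl)
        fix \<tau> assume "\<tau> \<in> ?P (pos 0)"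
        then have \<tau>: "\<tau> permutes UNIV" by auto
        note \<tau>s = permutes_UNIV_compose_transpose[OF \<tau>, of "pos 0" "pos q"]
        note \<tau>st = permutes_UNIV_compose_transpose[OF \<tau>s, of "pos 1" "pos ?q'"]
        have "rest q (\<tau> \<circ> ?s \<circ> ?t) = rest q (\<tau> \<circ> ?s)" "rest q (\<tau> \<circ> ?s) = rest q \<tau>"
          using 3 q by (auto intro!: rest_transpose)
        moreover have "{\<tau> (pos 0), \<tau> (pos 1)} \<inter> {\<tau> (pos q), \<tau> (pos ?q')} = {}"
          using ne by (auto simp: permutes_inj_iff[OF \<tau>])
        note e_commute[OF this]
        ultimately show "?f (\<tau> \<circ> (?s \<circ> ?t)) = ?f \<tau>"
          unfolding o_assoc tail_eq_rest[OF \<tau>st 3 q(1)] tail_eq_rest[OF \<tau> 3 q(1)]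
          using ne
          by (simp add: sign_compose_transpose[OF \<tau>] sign_compose_transpose[OF \<tau>s]
              transpose_apply_other mult.assoc)
      qed
      finally show ?thesis by (simp add: row q(2))
    qed
  qed
  have "pfaffian = (\<Sum>\<tau> | \<tau> permutes UNIV. ?f \<tau>)"
    unfolding pfaffian_def using f by (intro sum.cong refl) (auto simp del: One_nat_def)
  also have "\<dots> = (\<Sum>x\<in>UNIV. \<Sum>\<tau> | \<tau> \<in> {\<tau>. \<tau> permutes UNIV} \<and> inv \<tau> i = x. ?f \<tau>)"
    by (rule sum.group[symmetric]) auto
  also have "\<dots> = (\<Sum>x\<in>(UNIV :: 'n set). row i i)"
  proof (intro sum.cong refl)
    fix x
    have "{\<tau>. \<tau> \<in> {\<tau>. \<tau> permutes UNIV} \<and> inv \<tau> i = x} = {\<tau>. \<tau> permutes UNIV \<and> \<tau> x = i}"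
      by (auto simp: permutes_inv_eq permutes_inverses)
    then show "(\<Sum>\<tau> | \<tau> \<in> {\<tau>. \<tau> permutes UNIV} \<and> inv \<tau> i = x. ?f \<tau>) = row i i"
      by (simp only: part)
  qed
  also have "\<dots> = of_nat (2 * m) * row i i"
    using bij_betw_same_card[OF pos] by simp
  finally show ?thesis by simp
qed

lemma row_eq_minors: "row i k = (\<Sum>j\<in>UNIV. minor i j * e k j)"
proof -
  have "row i k = (\<Sum>j\<in>UNIV. \<Sum>\<tau> | \<tau> \<in> {\<tau>. \<tau> permutes UNIV \<and> \<tau> (pos 0) = i} \<and> \<tau> (pos 1) = j.
      of_int (sign \<tau>) * tail \<tau> * e k (\<tau> (pos 1)))"
    unfolding row_def by (rule sum.group[symmetric]) auto
  also have "\<dots> = (\<Sum>j\<in>UNIV. minor i j * e k j)"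
    unfolding minor_def sum_distrib_right
    by (intro sum.cong refl) auto
  finally show ?thesis .
qed

lemma minor_swap:
  assumes "m \<ge> 1"
  shows "minor j i = - minor i j"
proof -
  let ?s = "transposition (pos 0) (pos 1)"
  have ne: "pos 0 \<noteq> pos 1" using assms by (simp add: pos_inj)
  let ?P = "\<lambda>i j. {\<tau>. \<tau> permutes UNIV \<and> \<tau> (pos 0) = i \<and> \<tau> (pos 1) = j}"
  have "minor j i = (\<Sum>\<tau>\<in>?P i j. of_int (sign (\<tau> \<circ> ?s)) * tail (\<tau> \<circ> ?s))"
    unfolding minor_def
    by (rule sum.reindex_bij_witness[where i = "\<lambda>\<tau>. \<tau> \<circ> ?s" and j = "\<lambda>\<tau>. \<tau> \<circ> ?s"])
       (use ne in \<open>auto simp: o_assoc[symmetric] permutes_UNIV_compose_transpose\<close>)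
  also have "\<dots> = (\<Sum>\<tau>\<in>?P i j. - (of_int (sign \<tau>) * tail \<tau>))"
  proof (intro sum.cong refl)
    fix \<tau> assume "\<tau> \<in> ?P i j"
    then have \<tau>: "\<tau> permutes UNIV" by auto
    have "pair (\<tau> \<circ> ?s) r = pair \<tau> r" if "r \<in> set [1..<m]" for r
      using that by (simp add: pair_def Transposition.transpose_def pos_inj)
    then have "tail (\<tau> \<circ> ?s) = tail \<tau>"
      unfolding tail_def by (intro arg_cong[where f = prod_list] map_cong refl)
    then show "of_int (sign (\<tau> \<circ> ?s)) * tail (\<tau> \<circ> ?s) = - (of_int (sign \<tau>) * tail \<tau>)"
      using ne by (simp add: sign_compose_transpose[OF \<tau>])
  qed
  finally show ?thesis by (simp add: minor_def sum_negf)
qed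

end

section \<open>Relations between the generators\<close>

definition matrix_unit :: "'n \<Rightarrow> 'n \<Rightarrow> complex^'n^'n" where
  "matrix_unit a b = (\<chi> x y. if x = a \<and> y = b then 1 else 0)"

lemma matrix_unit_mult:
  "matrix_unit a b ** matrix_unit c d = (if b = c then matrix_unit a d else 0)"
proof -
  have "(\<Sum>z\<in>UNIV. (if x = a \<and> z = b then 1 else 0) * (if z = c \<and> y = d then 1 else 0)) =
      (\<Sum>z\<in>UNIV. if z = b then (if x = a \<and> b = c \<and> y = d then 1 else (0 :: complex)) else 0)" for x y
    by (intro sum.cong) auto
  then show ?thesis by (auto simp: vec_eq_iff matrix_unit_def matrix_matrix_mult_def)
qed

lemma e_mat_eq_units: "e_mat i j = matrix_unit j i - matrix_unit i j"
  by (simp add: vec_eq_iff e_mat_def matrix_unit_def)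

lemma e_mat_commute:
  "{i, j} \<inter> {k, l} = {} \<Longrightarrow> e_mat i j ** e_mat k l - e_mat k l ** e_mat i j = 0"
  by (auto simp: e_mat_eq_units matrix_mult_linear matrix_unit_mult)

lemma e_mat_bracket:
  "k \<noteq> j \<Longrightarrow> k \<noteq> l \<Longrightarrow> e_mat k l ** e_mat k j - e_mat k j ** e_mat k l = e_mat l j"
  by (auto simp: e_mat_eq_units matrix_mult_linear matrix_unit_mult)

lemma uea_gen_scale: "Rep_so_C z = mat a ** Rep_so_C x \<Longrightarrow> uea_gen z = uea_scal a * uea_gen x"
  by transfer (rule Gen_scale)

lemma uea_gen_bracket:
  "Rep_so_C z = Rep_so_C x ** Rep_so_C y - Rep_so_C y ** Rep_so_C x \<Longrightarrow>
    uea_gen z = uea_gen x * uea_gen y - uea_gen y * uea_gen x"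
  unfolding minus_uea_def by transfer (rule Gen_bracket)

lemma uea_scal_add: "uea_scal (a + b) = uea_scal a + uea_scal b"
  by transfer (rule Scal_add)

lemma uea_scal_mult: "uea_scal (a * b) = uea_scal a * uea_scal b"
  by transfer (rule Scal_mult)

lemma uea_scal_0: "uea_scal 0 = 0" and uea_scal_1: "uea_scal 1 = 1"
  by (transfer, rule ueq_refl)+

lemma uea_scal_minus: "uea_scal (- a) = - uea_scal a"
  using uea_scal_add[of a "- a"] by (simp add: uea_scal_0 eq_neg_iff_add_eq_0 add.commute)

lemma uea_scal_of_nat: "uea_scal (of_nat k) = of_nat k"
  by (induction k) (simp_all add: uea_scal_0 uea_scal_1 uea_scal_add)

lemma e_uea_swap: "e_uea j i = - e_uea i j"
proof -
  have "e_mat j i = mat (- 1) ** e_mat i j"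
    unfolding mat_minus_one_mult by (simp add: vec_eq_iff e_mat_def)
  then have "Rep_so_C (Abs_so_C (e_mat j i)) = mat (- 1) ** Rep_so_C (Abs_so_C (e_mat i j))"
    unfolding Rep_Abs_e_mat .
  then have "e_uea j i = uea_scal (- 1) * e_uea i j"
    unfolding e_uea_def by (rule uea_gen_scale)
  then show ?thesis by (simp add: uea_scal_minus uea_scal_1)
qed

lemma e_uea_diag: "e_uea i i = 0"
proof -
  have "e_mat i i = e_mat i i ** e_mat i i - e_mat i i ** e_mat i i"
    by (simp add: e_mat_eq_units)
  note uea_gen_bracket[of "Abs_so_C (e_mat i i)" "Abs_so_C (e_mat i i)" "Abs_so_C (e_mat i i)",
      unfolded Rep_Abs_e_mat, OF this]
  then show ?thesis by (simp add: e_uea_def)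
qed

lemma e_uea_commute:
  assumes "{i, j} \<inter> {k, l} = {}"
  shows "e_uea i j * e_uea k l = e_uea k l * e_uea i j"
proof -
  have "e_mat i i = e_mat i j ** e_mat k l - e_mat k l ** e_mat i j"
    unfolding e_mat_commute[OF assms] by (simp add: e_mat_eq_units)
  note uea_gen_bracket[of "Abs_so_C (e_mat i i)" "Abs_so_C (e_mat i j)" "Abs_so_C (e_mat k l)",
      unfolded Rep_Abs_e_mat, OF this]
  then have "e_uea i i = e_uea i j * e_uea k l - e_uea k l * e_uea i j" by (simp only: e_uea_def)
  then show ?thesis by (simp add: e_uea_diag)
qed

lemma e_uea_bracket:
  assumes "k \<noteq> j" "k \<noteq> l"
  shows "e_uea k l * e_uea k j - e_uea k j * e_uea k l = e_uea l j"
proof -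
  note uea_gen_bracket[of "Abs_so_C (e_mat l j)" "Abs_so_C (e_mat k l)" "Abs_so_C (e_mat k j)",
      unfolded Rep_Abs_e_mat, OF e_mat_bracket[OF assms, symmetric]]
  then show ?thesis by (simp only: e_uea_def)
qed

section \<open>The elements \<open>pf_ij\<close> as Pfaffian minors\<close>

text \<open>
  Each of the elements \<open>us\<close> that \<open>a\<close> passes on its way contributes one transposition.
\<close>

lemma ex_permutation_move_front:
  fixes ps us vs :: "'n::finite list"
  assumes "distinct (ps @ us @ a # vs)"
  shows "\<exists>f. f permutes UNIV \<and> map f (ps @ us @ a # vs) = ps @ a # us @ vs \<and> sign f = (-1) ^ length us"
  using assms
proof (induction us arbitrary: vs rule: rev_induct)
  case Nil
  show ?case by (intro exI[of _ id] conjI permutes_id) simp_all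
next
  case (snoc b us)
  let ?t = "transposition a b"
  have ab: "a \<noteq> b" and out: "{a, b} \<inter> set (ps @ us @ vs) = {}" using snoc.prems by auto
  have "map ?t xs = xs" if "{a, b} \<inter> set xs = {}" for xs
    using that by (intro map_idI) (auto simp: Transposition.transpose_def)
  then have t: "map ?t (ps @ (us @ [b]) @ a # vs) = ps @ us @ a # b # vs"
    using out by simp
  obtain f where f: "f permutes UNIV" "map f (ps @ us @ a # b # vs) = ps @ a # us @ b # vs"
    "sign f = (-1) ^ length us"
    using snoc.IH[of "b # vs"] snoc.prems by auto
  show ?case
  proof (intro exI[of _ "f \<circ> ?t"] conjI)
    show "map (f \<circ> ?t) (ps @ (us @ [b]) @ a # vs) = ps @ a # (us @ [b]) @ vs"
      using f(2) t by (simp only: map_map[symmetric]) simp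
    show "sign (f \<circ> ?t) = (-1) ^ length (us @ [b])"
      using sign_compose_transpose[OF f(1) ab] f(3) by simp
  qed (rule permutes_UNIV_compose_transpose[OF f(1)])
qed

text \<open>
  In the increasing list, \<open>i\<close> passes \<open>position i - 1\<close> elements to reach the front, and then \<open>j\<close> passes
  \<open>position j - 2\<close> elements to reach the second place, since \<open>i\<close> has already left.
\<close>

lemma pf_sum_fixed_permutation:
  fixes i j :: "'n::{finite,linorder}"
  assumes n: "CARD('n) = 2 * m" and "i < j"
  defines "s \<equiv> sorted_list_of_set (UNIV :: 'n set)"
    and "s' \<equiv> sorted_list_of_set (UNIV - {i, j})"
  shows "\<exists>f. f permutes UNIV \<and> map f s = i # j # s' \<and>
    sign f = - ((-1) ^ (position i + position j))"
proof -
  have s: "sorted s" "distinct s" "set s = UNIV" unfolding s_def by simp_all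
  then obtain us vs where us: "s = us @ i # vs" using split_list by (metis UNIV_I)
  have st: "sorted_wrt (<) (us @ i # vs)"
    using s us by (simp add: strict_sorted_iff)
  have all: "x \<in> set us \<or> x = i \<or> x \<in> set vs" for x
  proof -
    have "x \<in> set s" using s(3) by simp
    then show ?thesis by (auto simp: us)
  qed
  have "j \<in> set vs" using all[of j] st \<open>i < j\<close> by (auto simp: sorted_wrt_append)
  then obtain vs1 vs2 where vs: "vs = vs1 @ j # vs2" using split_list by metis
  have lt: "x \<in> set us \<Longrightarrow> x < i" "x \<in> set us \<Longrightarrow> x < j" "x \<in> set vs1 \<Longrightarrow> i < x" "x \<in> set vs1 \<Longrightarrow> x < j"
    "x \<in> set vs2 \<Longrightarrow> j < x" "x \<in> set vs2 \<Longrightarrow> i < x" for x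
    using st by (auto simp: sorted_wrt_append vs)
  have all': "x \<in> set us \<or> x = i \<or> x \<in> set vs1 \<or> x = j \<or> x \<in> set vs2" for x
    using all[of x] by (auto simp: vs)
  have "sorted_wrt (<) (us @ vs1 @ vs2)"
    using st by (auto simp: sorted_wrt_append vs)
  then have "sorted (us @ vs1 @ vs2)" "distinct (us @ vs1 @ vs2)"
    by (simp_all add: strict_sorted_iff)
  moreover have "set (us @ vs1 @ vs2) = UNIV - {i, j}"
    using all' lt by (auto; fastforce)
  ultimately have s': "s' = us @ vs1 @ vs2"
    unfolding s'_def by (metis sorted_list_of_set.idem_if_sorted_distinct)
  have "{..i} = set (us @ [i])"
  proof (intro set_eqI)
    show "x \<in> {..i} \<longleftrightarrow> x \<in> set (us @ [i])" for x
      using all'[of x] lt[of x] \<open>i < j\<close> by auto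
  qed
  moreover have "{..j} = set (us @ i # vs1 @ [j])"
  proof (intro set_eqI)
    show "x \<in> {..j} \<longleftrightarrow> x \<in> set (us @ i # vs1 @ [j])" for x
      using all'[of x] lt[of x] \<open>i < j\<close> by auto
  qed
  moreover have "distinct (us @ [i])" "distinct (us @ i # vs1 @ [j])" using s us vs by auto
  ultimately have pos: "position i = length us + 1" "position j = length us + length vs1 + 2"
    unfolding position_def by (simp_all only: distinct_card) simp_all
  obtain f1 where f1: "f1 permutes UNIV" "map f1 s = i # us @ vs" "sign f1 = (-1) ^ length us"
    using ex_permutation_move_front[of "[]" us i vs] s us by auto
  obtain f2 where f2: "f2 permutes UNIV" "map f2 (i # us @ vs) = i # j # s'"
    "sign f2 = (-1) ^ (length us + length vs1)"
    using ex_permutation_move_front[of "[i]" "us @ vs1" j vs2] s us vs s' by auto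
  have "permutation f1" "permutation f2" using f1 f2 by (auto simp: permutation_permutes)
  then have "sign (f2 \<circ> f1) = - ((-1) ^ (position i + position j))"
    by (simp add: sign_compose f1 f2 pos power_add)
  moreover have "map (f2 \<circ> f1) s = i # j # s'"
    using f1(2) f2(2) by (simp only: map_map[symmetric])
  ultimately show ?thesis using permutes_compose[OF f1(1) f2(1)]
    by (intro exI[of _ "f2 \<circ> f1"] conjI)
qed

lemma pfaffian_ring_uea:
  assumes "CARD('n::{finite,linorder}) = 2 * m"
  shows "pfaffian_ring (e_uea :: 'n \<Rightarrow> 'n \<Rightarrow> 'n uea) (\<lambda>k. sorted_list_of_set UNIV ! k) m"
proof
  fix i j k l :: 'n
  show "e_uea j i = - e_uea i j" by (rule e_uea_swap)
  show "e_uea i i = 0" by (rule e_uea_diag)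
  show "{i, j} \<inter> {k, l} = {} \<Longrightarrow> e_uea i j * e_uea k l = e_uea k l * e_uea i j"
    by (rule e_uea_commute)
  show "{i, k} \<inter> {j, l} = {} \<Longrightarrow>
      e_uea k l * e_uea k j - e_uea k j * e_uea k l = e_uea i l * e_uea i j - e_uea i j * e_uea i l"
    using e_uea_bracket[of k j l] e_uea_bracket[of i j l] by auto
  show "bij_betw (\<lambda>k. sorted_list_of_set (UNIV :: 'n set) ! k) {..<2 * m} UNIV"
    by (rule bij_betw_nth) (simp_all add: assms)
qed

lemma pf_sum_eq_minor:
  fixes i j :: "'n::{finite,linorder}"
  assumes n: "CARD('n) = 2 * m" and "i < j"
  shows "pf_sum (UNIV - {i, j}) = - ((-1) ^ (position i + position j) *
    pfaffian_ring.minor e_uea (\<lambda>k. sorted_list_of_set UNIV ! k) m i j)"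
proof -
  interpret pfaffian_ring "e_uea :: 'n \<Rightarrow> 'n \<Rightarrow> 'n uea" "\<lambda>k. sorted_list_of_set UNIV ! k" m
    by (rule pfaffian_ring_uea[OF n])
  let ?s = "sorted_list_of_set (UNIV :: 'n set)" and ?s' = "sorted_list_of_set (UNIV - {i, j})"
  let ?I = "UNIV - {i, j}"
  obtain f where f: "f permutes UNIV" "map f ?s = i # j # ?s'"
    "sign f = - ((-1) ^ (position i + position j))"
    using pf_sum_fixed_permutation[OF assms] by (elim exE conjE)
  have len: "length ?s = 2 * m" using n by simp
  have card: "card ?I = 2 * m - 2" using n \<open>i < j\<close> by (simp add: card_Diff_subset)
  have m: "m \<ge> 1" using n zero_less_card_finite[where 'a = 'n] by linarith
  have fs: "f (?s ! k) = (i # j # ?s') ! k" if "k < 2 * m" for k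
    using that len f(2) nth_map[of k ?s f] by simp
  have f0: "f (?s ! 0) = i" "f (?s ! 1) = j" using fs[of 0] fs[of 1] m by auto
  have tail: "tail (\<sigma> \<circ> f) =
      prod_list (map (\<lambda>k. e_uea (\<sigma> (?s' ! (2 * k))) (\<sigma> (?s' ! (2 * k + 1)))) [0..<card ?I div 2])" for \<sigma>
  proof -
    have "[1..<m] = map Suc [0..<m - 1]" using m by (simp add: map_Suc_upt)
    moreover have "card ?I div 2 = m - 1" using card by simp
    moreover have "map (pair (\<sigma> \<circ> f) \<circ> Suc) [0..<m - 1] =
        map (\<lambda>k. e_uea (\<sigma> (?s' ! (2 * k))) (\<sigma> (?s' ! (2 * k + 1)))) [0..<m - 1]"
      by (rule map_cong) (auto simp: pair_def fs)
    ultimately show ?thesis by (simp only: tail_def map_map)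
  qed
  have inv: "inv f \<circ> f = id" "f \<circ> inv f = id" "inv f permutes UNIV"
    using f(1) by (auto intro: permutes_inv permutes_inv_o)
  have invf: "inv f i = ?s ! 0" "inv f j = ?s ! 1"
    using f0 f(1) permutes_inv_eq[OF f(1)] by auto
  have perm: "permutation f" using f(1) by (auto simp: permutation_permutes)
  have "minor i j = (\<Sum>\<sigma> | \<sigma> permutes ?I. of_int (sign (\<sigma> \<circ> f)) * tail (\<sigma> \<circ> f))"
    unfolding minor_def
  proof (rule sum.reindex_bij_witness[where i = "\<lambda>\<sigma>. \<sigma> \<circ> f" and j = "\<lambda>\<tau>. \<tau> \<circ> inv f"])
    fix \<tau> assume "\<tau> \<in> {\<tau>. \<tau> permutes UNIV \<and> \<tau> (?s ! 0) = i \<and> \<tau> (?s ! 1) = j}"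
    then have \<tau>: "\<tau> permutes UNIV" "\<tau> (?s ! 0) = i" "\<tau> (?s ! 1) = j" by auto
    show "\<tau> \<circ> inv f \<circ> f = \<tau>" by (simp add: comp_assoc inv)
    have "\<tau> \<circ> inv f permutes UNIV" using \<tau>(1) inv(3) by (intro permutes_compose) 
    moreover have "(\<tau> \<circ> inv f) x = x" if "x \<notin> ?I" for x
      using that \<tau>(2,3) invf by auto
    ultimately show "\<tau> \<circ> inv f \<in> {\<sigma>. \<sigma> permutes ?I}"
      unfolding mem_Collect_eq permutes_def by blast
  next
    fix \<sigma> assume "\<sigma> \<in> {\<sigma>. \<sigma> permutes ?I}"
    then have \<sigma>: "\<sigma> permutes ?I" by simp
    show "\<sigma> \<circ> f \<circ> inv f = \<sigma>" by (simp add: comp_assoc inv)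
    have "\<sigma> \<circ> f permutes UNIV"
      using permutes_compose[OF f(1) permutes_subset[OF \<sigma>]] by simp
    then show "\<sigma> \<circ> f \<in> {\<tau>. \<tau> permutes UNIV \<and> \<tau> (?s ! 0) = i \<and> \<tau> (?s ! 1) = j}"
      using f0 permutes_not_in[OF \<sigma>] by auto
  qed (simp_all add: comp_assoc inv)
  also have "\<dots> = of_int (sign f) * pf_sum ?I"
    unfolding pf_sum_def Let_def sum_distrib_left
  proof (intro sum.cong refl)
    fix \<sigma> assume "\<sigma> \<in> {\<sigma>. \<sigma> permutes ?I}"
    then have "\<sigma> permutes ?I" by simp
    then have "permutation \<sigma>" unfolding permutation_permutes by (intro exI[of _ ?I]) simp
    then show "of_int (sign (\<sigma> \<circ> f)) * tail (\<sigma> \<circ> f) = of_int (sign f) * (of_int (sign \<sigma>) *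
        prod_list (map (\<lambda>k. e_uea (\<sigma> (?s' ! (2 * k))) (\<sigma> (?s' ! (2 * k + 1)))) [0..<card ?I div 2]))"
      unfolding tail using perm by (simp add: sign_compose mult.assoc[symmetric] mult.commute[of "sign \<sigma>"])
  qed
  finally show ?thesis
    by (cases "even (position i + position j)") (simp_all add: f(3) del: even_add)
qed

text \<open>
  For \<open>i < j\<close> the sign in the definition of \<open>pf_ij\<close> and the sign of the permutation that moves \<open>i\<close> and \<open>j\<close> to the
  front have product -1; for \<open>i > j\<close> both sides change sign.
\<close>

lemma pf_elem_eq_minor:
  fixes i j :: "'n::{finite,linorder}"
  assumes n: "CARD('n) = 2 * m" and "i \<noteq> j"
  shows "pf_elem i j = - (uea_scal (2 * of_nat m / (\<i> ^ m * 2 ^ m * fact m)) *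
    pfaffian_ring.minor e_uea (\<lambda>k. sorted_list_of_set UNIV ! k) m i j)"
proof -
  interpret pfaffian_ring "e_uea :: 'n \<Rightarrow> 'n \<Rightarrow> 'n uea" "\<lambda>k. sorted_list_of_set UNIV ! k" m
    by (rule pfaffian_ring_uea[OF n])
  let ?c = "2 * of_nat m / (\<i> ^ m * 2 ^ m * fact m) :: complex"
  have m: "m \<ge> 1" using n zero_less_card_finite[where 'a = 'n] by linarith
  have upper: "pf_upper i j = - (uea_scal ?c * minor i j)" if "i < j" for i j
  proof -
    have sq: "((-1) ^ k) * ((-1) ^ k * x) = x" for k and x :: "'n uea"
      by (cases "even k") auto
    have sc: "uea_scal ((-1) ^ k * ?c) = uea_scal ?c * (-1) ^ k" for k
      by (cases "even k") (auto simp: uea_scal_minus)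
    show ?thesis
      unfolding pf_upper_def Let_def pf_sum_eq_minor[OF n that] n nonzero_mult_div_cancel_left[OF zero_neq_numeral[symmetric]]
      by (simp only: sc, simp only: mult.assoc sq mult_minus_right)
  qed
  show ?thesis
    using \<open>i \<noteq> j\<close> upper[of i j] upper[of j i] minor_swap[OF m, of i j]
    by (cases i j rule: linorder_cases) (auto simp: pf_elem_def)
qed

text \<open>
  Off the diagonal the product of the matrices \<open>(pf_ij)\<close> and \<open>(e_jk)\<close> is skew-symmetric.  For commuting
  entries it would vanish, being the expansion of a Pfaffian with two equal rows; here commutators
  remain.
\<close>

lemma
  fixes i :: "'n::{finite,linorder}"
  assumes n: "CARD('n) = 2 * m"
  shows pf_row_diag: "(\<Sum>j\<in>UNIV - {i}. pf_elem i j * e_uea i j) = - pf"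
    and pf_row_antisym: "i \<noteq> k \<Longrightarrow> (\<Sum>j\<in>UNIV - {i}. pf_elem i j * e_uea k j) =
    - (\<Sum>j\<in>UNIV - {k}. pf_elem k j * e_uea i j)"
proof -
  interpret pfaffian_ring "e_uea :: 'n \<Rightarrow> 'n \<Rightarrow> 'n uea" "\<lambda>k. sorted_list_of_set UNIV ! k" m
    by (rule pfaffian_ring_uea[OF n])
  let ?c = "2 * of_nat m / (\<i> ^ m * 2 ^ m * fact m) :: complex"
  let ?d = "1 / (\<i> ^ m * 2 ^ m * fact m) :: complex"
  have m: "m \<ge> 1" using n zero_less_card_finite[where 'a = 'n] by linarith
  have diag: "minor i i = 0" for i
  proof -
    let ?p = "\<lambda>k. sorted_list_of_set (UNIV :: 'n set) ! k"
    have ne: "?p 0 \<noteq> ?p 1" using pos_inj[of 0 1] m by simp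
    have False if "\<tau> permutes UNIV" "\<tau> (?p 0) = i" "\<tau> (?p 1) = i" for \<tau>
      using permutes_inj_iff[OF that(1), of "?p 0" "?p 1"] that(2,3) ne by simp
    then have "{\<tau>. \<tau> permutes UNIV \<and> \<tau> (?p 0) = i \<and> \<tau> (?p 1) = i} = {}" by blast
    then show ?thesis unfolding minor_def by (simp only: sum.empty)
  qed
  have row: "(\<Sum>j\<in>UNIV - {i}. pf_elem i j * e_uea k j) = - (uea_scal ?c * row i k)" for i k :: 'n
  proof -
    have "row i k = (\<Sum>j\<in>UNIV - {i}. minor i j * e_uea k j)"
      unfolding row_eq_minors by (rule sum.mono_neutral_right) (auto simp: diag)
    then have "- (uea_scal ?c * row i k) = (\<Sum>j\<in>UNIV - {i}. - (uea_scal ?c * (minor i j * e_uea k j)))"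
      by (simp add: sum_distrib_left sum_negf)
    also have "\<dots> = (\<Sum>j\<in>UNIV - {i}. pf_elem i j * e_uea k j)"
      by (intro sum.cong) (auto simp: pf_elem_eq_minor[OF n] mult.assoc)
    finally show ?thesis by simp
  qed
  have "?c = ?d * of_nat (2 * m)" by simp
  then have "uea_scal ?c * row i i = uea_scal ?d * (of_nat (2 * m) * row i i)"
    by (simp only: uea_scal_mult uea_scal_of_nat mult.assoc)
  also have "\<dots> = pf"
    unfolding row_diag[OF m] pfaffian_def pf_def pf_sum_def Let_def pair_def using n by simp
  finally show "(\<Sum>j\<in>UNIV - {i}. pf_elem i j * e_uea i j) = - pf"
    using row by simp
  assume ik: "i \<noteq> k"
  \<comment> \<open>The scalar absorbs the factor 2 of the relation for rows.\<close>
  have "?c = (?c / 2) * of_nat 2" by simp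
  then have "uea_scal ?c * (row i k + row k i) = uea_scal (?c / 2) * (2 * (row i k + row k i))"
    by (metis (no_types, lifting) mult.assoc of_nat_numeral uea_scal_mult uea_scal_of_nat)
  then have "uea_scal ?c * (row i k + row k i) = 0" using row_antisym[OF ik] by simp
  then show "(\<Sum>j\<in>UNIV - {i}. pf_elem i j * e_uea k j) =
      - (\<Sum>j\<in>UNIV - {k}. pf_elem k j * e_uea i j)"
    unfolding row by (simp add: semiring_class.distrib_left neg_eq_iff_add_eq_0)
qed

section \<open>Vector fields and the Levi-Civita connection\<close>

context smooth_manifold
begin

lemma vector_field_tangent: "vector_field_on A U X \<Longrightarrow> p \<in> U \<Longrightarrow> X p \<in> tangent_space A p"
  and vector_field_open: "vector_field_on A U X \<Longrightarrow> open U"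
  and vector_field_msmooth: "vector_field_on A U X \<Longrightarrow> V \<subseteq> U \<Longrightarrow> msmooth A V f \<Longrightarrow> msmooth A V (\<lambda>p. X p f)"
  by (auto simp: vector_field_on_def)

lemma vector_field_combination:
  assumes X: "vector_field_on A U X" and Y: "vector_field_on A U Y"
  shows "vector_field_on A U (\<lambda>q f. a * X q f + b * Y q f)"
  unfolding vector_field_on_def
proof (intro conjI ballI allI impI)
  show "open U" using X by (rule vector_field_open)
  show "(\<lambda>f. a * X p f + b * Y p f) \<in> tangent_space A p" if "p \<in> U" for p
    using that X Y by (intro tangent_space_combination vector_field_tangent)
  fix V and f :: "'a \<Rightarrow> real"
  assume "V \<subseteq> U \<and> msmooth A V f"
  then show "msmooth A V (\<lambda>p. a * X p f + b * Y p f)"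
    using X Y by (intro msmooth_add msmooth_bounded_linear[OF bounded_linear_mult_right])
      (auto intro: vector_field_msmooth)
qed

end

locale riemannian = smooth_manifold A
  for A :: "('a::topological_space, 'n::finite) chart set" +
  fixes g :: "'a \<Rightarrow> 'a tvec \<Rightarrow> 'a tvec \<Rightarrow> real"
    and nabla :: "'a \<Rightarrow> 'a tvec \<Rightarrow> 'a vfield \<Rightarrow> 'a tvec"
  assumes metric: "riemannian_metric A g" and levi_civita: "levi_civita A g nabla"
begin

lemma g_sym: "u \<in> tangent_space A p \<Longrightarrow> v \<in> tangent_space A p \<Longrightarrow> g p u v = g p v u"
  using metric unfolding riemannian_metric_def by blast

lemma g_combination:
  "u \<in> tangent_space A p \<Longrightarrow> v \<in> tangent_space A p \<Longrightarrow> w \<in> tangent_space A p \<Longrightarrow>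
    g p (\<lambda>f. a * u f + b * w f) v = a * g p u v + b * g p w v"
  using metric unfolding riemannian_metric_def by blast

lemma g_sum:
  assumes v: "v \<in> tangent_space A p" and u: "\<And>i. i \<in> I \<Longrightarrow> u i \<in> tangent_space A p"
  shows "g p (\<lambda>f. \<Sum>i\<in>I. c i * u i f) v = (\<Sum>i\<in>I. c i * g p (u i) v)"
  using u
proof (induction I rule: infinite_finite_induct)
  case (insert x F)
  have "g p (\<lambda>f. c x * u x f + 1 * (\<Sum>i\<in>F. c i * u i f)) v =
      c x * g p (u x) v + 1 * g p (\<lambda>f. \<Sum>i\<in>F. c i * u i f) v"
    using insert.prems by (intro g_combination v tangent_space_sum) auto
  then show ?case using insert by simp
qed (use g_combination[OF tangent_space_zero v tangent_space_zero, of 0 0] in simp_all)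

lemma g_smooth: "vector_field_on A U X \<Longrightarrow> vector_field_on A U Y \<Longrightarrow> msmooth A U (\<lambda>p. g p (X p) (Y p))"
  using metric unfolding riemannian_metric_def by blast

lemma basis_tangent: "oriented_orthonormal_basis A g p b \<Longrightarrow> b i \<in> tangent_space A p"
  and basis_orthonormal: "oriented_orthonormal_basis A g p b \<Longrightarrow> g p (b i) (b j) = (if i = j then 1 else 0)"
  by (auto simp: oriented_orthonormal_basis_def)

lemma basis_expansion:
  assumes b: "oriented_orthonormal_basis A g p b" and v: "v \<in> tangent_space A p"
  shows "v = (\<lambda>f. \<Sum>i\<in>UNIV. g p v (b i) * b i f)"
proof -
  obtain c where c: "v = (\<lambda>f. \<Sum>i\<in>UNIV. c i * b i f)"
    using b v unfolding oriented_orthonormal_basis_def by blast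
  have "g p v (b j) = c j" for j
  proof -
    have "g p v (b j) = (\<Sum>i\<in>UNIV. c i * g p (b i) (b j))"
      unfolding c by (intro g_sum basis_tangent[OF b])
    also have "\<dots> = (\<Sum>i\<in>UNIV. if i = j then c i else 0)"
      by (intro sum.cong) (auto simp: basis_orthonormal[OF b])
    finally show ?thesis by simp
  qed
  then show ?thesis using c by simp
qed

lemma g_basis_expansion:
  assumes b: "oriented_orthonormal_basis A g p b"
    and u: "u \<in> tangent_space A p" and v: "v \<in> tangent_space A p"
  shows "g p u v = (\<Sum>s\<in>UNIV. g p u (b s) * g p v (b s))"
proof -
  have "g p u v = g p (\<lambda>f. \<Sum>s\<in>UNIV. g p u (b s) * b s f) v"
    using basis_expansion[OF b u] by simp
  also have "\<dots> = (\<Sum>s\<in>UNIV. g p u (b s) * g p (b s) v)"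
    by (intro g_sum v basis_tangent[OF b])
  finally show ?thesis
    by (simp add: g_sym[OF basis_tangent[OF b] v])
qed

lemma affine: "affine_connection A nabla"
  using levi_civita by (simp add: levi_civita_def)

lemma nabla_field:
  "vector_field_on A U X \<Longrightarrow> vector_field_on A U Y \<Longrightarrow> vector_field_on A U (\<lambda>p. nabla p (X p) Y)"
  using affine unfolding affine_connection_def by blast

lemma nabla_tangent:
  "vector_field_on A U Y \<Longrightarrow> p \<in> U \<Longrightarrow> v \<in> tangent_space A p \<Longrightarrow> nabla p v Y \<in> tangent_space A p"
  using affine unfolding affine_connection_def by blast

lemma nabla_combination:
  "vector_field_on A U Y \<Longrightarrow> p \<in> U \<Longrightarrow> v \<in> tangent_space A p \<Longrightarrow> w \<in> tangent_space A p \<Longrightarrow>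
    nabla p (\<lambda>f. a * v f + b * w f) Y = (\<lambda>f. a * nabla p v Y f + b * nabla p w Y f)"
  using affine unfolding affine_connection_def by blast

lemma nabla_add:
  "vector_field_on A U Y \<Longrightarrow> vector_field_on A U Z \<Longrightarrow> p \<in> U \<Longrightarrow> v \<in> tangent_space A p \<Longrightarrow>
    nabla p v (\<lambda>q f. Y q f + Z q f) = (\<lambda>f. nabla p v Y f + nabla p v Z f)"
  using affine unfolding affine_connection_def by blast

lemma nabla_mult:
  "vector_field_on A U Y \<Longrightarrow> p \<in> U \<Longrightarrow> v \<in> tangent_space A p \<Longrightarrow> msmooth A U h \<Longrightarrow>
    nabla p v (\<lambda>q f. h q * Y q f) = (\<lambda>f. v h * Y p f + h p * nabla p v Y f)"
  using affine unfolding affine_connection_def by blast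

lemma nabla_diff:
  assumes Y: "vector_field_on A U Y" and Z: "vector_field_on A U Z" and p: "p \<in> U"
    and v: "v \<in> tangent_space A p"
  shows "nabla p v (\<lambda>q f. Y q f - Z q f) = (\<lambda>f. nabla p v Y f - nabla p v Z f)"
proof -
  have U: "open U" using Y by (rule vector_field_open)
  have Z': "vector_field_on A U (\<lambda>q f. (-1) * Z q f)"
    using vector_field_combination[OF Z Z, of "-1" 0] by simp
  have "nabla p v (\<lambda>q f. (-1) * Z q f) = (\<lambda>f. v (\<lambda>q. -1) * Z p f + (-1) * nabla p v Z f)"
    by (rule nabla_mult[OF Z p v msmooth_const[OF U]])
  then have "nabla p v (\<lambda>q f. (-1) * Z q f) = (\<lambda>f. - nabla p v Z f)"
    by (simp add: tangent_const[OF v])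
  then show ?thesis using nabla_add[OF Y Z' p v] by simp
qed

lemma metric_compatible:
  "vector_field_on A U Y \<Longrightarrow> vector_field_on A U Z \<Longrightarrow> p \<in> U \<Longrightarrow> v \<in> tangent_space A p \<Longrightarrow>
    v (\<lambda>q. g q (Y q) (Z q)) = g p (nabla p v Y) (Z p) + g p (Y p) (nabla p v Z)"
  using levi_civita unfolding levi_civita_def by blast

lemma torsion_free:
  "vector_field_on A U Y \<Longrightarrow> vector_field_on A U Z \<Longrightarrow> p \<in> U \<Longrightarrow>
    (\<lambda>f. nabla p (Y p) Z f - nabla p (Z p) Y f) = lie_bracket A Y Z p"
  using levi_civita unfolding levi_civita_def by blast

lemma torsion_free_smooth:
  "vector_field_on A U Y \<Longrightarrow> vector_field_on A U Z \<Longrightarrow> p \<in> U \<Longrightarrow> msmooth_at A p f \<Longrightarrow>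
    nabla p (Y p) Z f - nabla p (Z p) Y f = Y p (\<lambda>q. Z q f) - Z p (\<lambda>q. Y q f)"
  using fun_cong[OF torsion_free, of U Y Z p f] by (simp add: lie_bracket_def)

text \<open>
  On the common domain of \<open>X\<close> and \<open>Y\<close> this is their Lie bracket.  In this form it is a smooth vector field by
  the axioms of an affine connection, and the axioms apply to it without any change off the domain.
\<close>

definition torsion_bracket :: "'a vfield \<Rightarrow> 'a vfield \<Rightarrow> 'a vfield" where
  "torsion_bracket X Y = (\<lambda>q f. nabla q (X q) Y f - nabla q (Y q) X f)"

lemma torsion_bracket_field:
  "vector_field_on A U X \<Longrightarrow> vector_field_on A U Y \<Longrightarrow> vector_field_on A U (torsion_bracket X Y)"
  using vector_field_combination[OF nabla_field nabla_field, of U X Y Y X 1 "-1"]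
  by (simp add: torsion_bracket_def)

lemma riemann_curvature_eq:
  assumes X: "vector_field_on A U X" and Y: "vector_field_on A U Y" and p: "p \<in> U"
  shows "riemann_curvature A nabla X Y Z p = (\<lambda>f. nabla p (X p) (\<lambda>q. nabla q (Y q) Z) f
    - nabla p (Y p) (\<lambda>q. nabla q (X q) Z) f - nabla p (torsion_bracket X Y p) Z f)"
  using torsion_free[OF X Y p] by (simp add: riemann_curvature_def torsion_bracket_def fun_eq_iff)

lemma riemann_curvature_tangent:
  assumes X: "vector_field_on A U X" and Y: "vector_field_on A U Y" and Z: "vector_field_on A U Z"
    and p: "p \<in> U"
  shows "riemann_curvature A nabla X Y Z p \<in> tangent_space A p"
proof -
  have "(\<lambda>f. 1 * (1 * nabla p (X p) (\<lambda>q. nabla q (Y q) Z) f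
      + (-1) * nabla p (Y p) (\<lambda>q. nabla q (X q) Z) f) + (-1) * nabla p (torsion_bracket X Y p) Z f)
      \<in> tangent_space A p"
    using X Y Z p
    by (intro tangent_space_combination) 
       (auto intro!: nabla_tangent[of U] nabla_field vector_field_tangent[of U] torsion_bracket_field)
  then show ?thesis by (simp add: riemann_curvature_eq[OF X Y p])
qed

text \<open>
  Expanded into third-order terms, so that in the sum over the cyclic permutations of \<open>X\<close>, \<open>Y\<close> and \<open>Z\<close> the
  twelve terms cancel in pairs.
\<close>

lemma jacobi:
  assumes X: "vector_field_on A U X" and Y: "vector_field_on A U Y" and Z: "vector_field_on A U Z"
    and p: "p \<in> U" and f: "msmooth_at A p f"
  shows "torsion_bracket X (torsion_bracket Y Z) p f =
    X p (\<lambda>q. Y q (\<lambda>r. Z r f)) - X p (\<lambda>q. Z q (\<lambda>r. Y r f))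
    - Y p (\<lambda>q. Z q (\<lambda>r. X r f)) + Z p (\<lambda>q. Y q (\<lambda>r. X r f))"
proof -
  obtain W' where W': "p \<in> W'" "msmooth A W' f" using f by (auto simp: msmooth_at_def)
  define W where "W = W' \<inter> U"
  have U: "open U" using X by (rule vector_field_open)
  have W: "p \<in> W" "W \<subseteq> U" "msmooth A W f"
    using W' p U msmooth_subset[OF W'(2), of W] by (auto simp: W_def msmooth_def)
  note sm = vector_field_msmooth[OF X W(2)] vector_field_msmooth[OF Y W(2)]
    vector_field_msmooth[OF Z W(2)]
  have at: "msmooth A W h \<Longrightarrow> msmooth_at A q h" if "q \<in> W" for h :: "'a \<Rightarrow> real" and q
    using that by (rule msmooth_imp_at[rotated])
  have YZ: "torsion_bracket Y Z q h = Y q (\<lambda>r. Z r h) - Z q (\<lambda>r. Y r h)"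
    if "msmooth A W h" "q \<in> W" for q h
    unfolding torsion_bracket_def using torsion_free_smooth[OF Y Z _ at[OF that(2,1)]] that(2) W(2) by auto
  have Xp: "X p \<in> tangent_space A p" using X p by (rule vector_field_tangent)
  have "torsion_bracket X (torsion_bracket Y Z) p f =
      X p (\<lambda>q. torsion_bracket Y Z q f) - torsion_bracket Y Z p (\<lambda>q. X q f)"
    unfolding torsion_bracket_def[of X]
    by (rule torsion_free_smooth[OF X torsion_bracket_field[OF Y Z] p f])
  also have "X p (\<lambda>q. torsion_bracket Y Z q f) = X p (\<lambda>q. Y q (\<lambda>r. Z r f) - Z q (\<lambda>r. Y r f))"
    by (rule tangent_cong[OF Xp, symmetric, of W])
       (use W YZ in \<open>auto intro!: msmooth_diff sm\<close>)
  also have "\<dots> = X p (\<lambda>q. Y q (\<lambda>r. Z r f)) - X p (\<lambda>q. Z q (\<lambda>r. Y r f))"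
    by (rule tangent_diff[OF Xp _ _ W(1)]) (intro sm W(3))+
  also have "torsion_bracket Y Z p (\<lambda>q. X q f) = Y p (\<lambda>q. Z q (\<lambda>r. X r f)) - Z p (\<lambda>q. Y q (\<lambda>r. X r f))"
    by (rule YZ[OF sm(1)[OF W(3)] W(1)])
  finally show ?thesis by simp
qed

text \<open>
  The terms of the cyclic sum are grouped by the field \<open>X\<close> that is the direction or the argument of the
  outer covariant derivative.  Each group is an iterated bracket \<open>[X, [Y, Z]]\<close>, and the Jacobi identity
  applies.
\<close>

lemma first_bianchi:
  assumes X: "vector_field_on A U X" and Y: "vector_field_on A U Y" and Z: "vector_field_on A U Z"
    and p: "p \<in> U"
  shows "riemann_curvature A nabla X Y Z p f + riemann_curvature A nabla Y Z X p f +
    riemann_curvature A nabla Z X Y p f = 0"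
proof (cases "msmooth_at A p f")
  case True
  have cyc: "nabla p (X p) (\<lambda>q. nabla q (Y q) Z) f - nabla p (X p) (\<lambda>q. nabla q (Z q) Y) f
      - nabla p (torsion_bracket Y Z p) X f = torsion_bracket X (torsion_bracket Y Z) p f"
    if "vector_field_on A U X" "vector_field_on A U Y" "vector_field_on A U Z" for X Y Z
  proof -
    have "nabla p (X p) (\<lambda>q f. nabla q (Y q) Z f - nabla q (Z q) Y f) =
        (\<lambda>f. nabla p (X p) (\<lambda>q. nabla q (Y q) Z) f - nabla p (X p) (\<lambda>q. nabla q (Z q) Y) f)"
      using that p by (intro nabla_diff[of U]) (auto intro: nabla_field vector_field_tangent)
    then show ?thesis by (simp add: torsion_bracket_def)
  qed
  show ?thesis
    using cyc[OF X Y Z] cyc[OF Y Z X] cyc[OF Z X Y]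
      jacobi[OF X Y Z p True] jacobi[OF Y Z X p True] jacobi[OF Z X Y p True]
    by (simp add: riemann_curvature_eq[OF X Y p] riemann_curvature_eq[OF Y Z p] riemann_curvature_eq[OF Z X p])
next
  case False
  then show ?thesis
    using riemann_curvature_tangent[OF X Y Z p] riemann_curvature_tangent[OF Y Z X p]
      riemann_curvature_tangent[OF Z X Y p] by (simp add: tangent_not_smooth)
qed

end

section \<open>The curvature of the associated bundle\<close>

lemma msmooth_vec:
  fixes F :: "'a::topological_space \<Rightarrow> 'b::euclidean_space^'k"
  assumes "smooth_atlas (A :: ('a, 'n::finite) chart set)" "open U" "\<And>i. msmooth A U (\<lambda>q. F q $ i)"
  shows "msmooth A U F"
proof -
  interpret smooth_manifold A by standard (rule assms)
  show ?thesis
  proof (rule msmooth_euclidean[OF \<open>open U\<close>])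
    fix b :: "'b^'k" assume "b \<in> Basis"
    then obtain i u where "b = axis i u" "u \<in> Basis" by (auto simp: Basis_vec_def)
    then show "msmooth A U (\<lambda>q. F q \<bullet> b)"
      using msmooth_inner[OF assms(3)[of i], of u] by (simp add: inner_axis)
  qed
qed

lemma tvec_deriv_eq_vderiv: "tvec_deriv v \<phi> = vderiv v (\<phi> :: 'a \<Rightarrow> complex^'d)"
proof (rule euclidean_eqI)
  fix b :: "complex^'d" assume b: "b \<in> Basis"
  then obtain i u where iu: "b = axis i u" "u \<in> Basis" by (auto simp: Basis_vec_def)
  then have "u = 1 \<or> u = \<i>" by (auto simp: Basis_complex_def)
  then show "tvec_deriv v \<phi> \<bullet> b = vderiv v \<phi> \<bullet> b"
    unfolding vderiv_inner[OF b]
    by (auto simp: iu(1) inner_axis tvec_deriv_def inner_complex_def)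
qed

context riemannian
begin

lemma frame_act_compose: "frame_act (frame_act b h) k = frame_act b (h ** k)"
proof (intro ext)
  fix j f
  have "frame_act (frame_act b h) k j f = (\<Sum>i\<in>UNIV. \<Sum>l\<in>UNIV. b l f * h $ l $ i * k $ i $ j)"
    by (simp add: frame_act_def sum_distrib_right)
  also have "\<dots> = (\<Sum>l\<in>UNIV. \<Sum>i\<in>UNIV. b l f * h $ l $ i * k $ i $ j)"
    by (rule sum.swap)
  also have "\<dots> = frame_act b (h ** k) j f"
    by (simp add: frame_act_def matrix_matrix_mult_def sum_distrib_left mult.assoc)
  finally show "frame_act (frame_act b h) k j f = frame_act b (h ** k) j f" .
qed

lemma frame_act_one: "frame_act b (mat 1) = b"
proof (intro ext)
  fix j f
  have "(\<Sum>i\<in>UNIV. b i f * (if i = j then 1 else 0)) = (\<Sum>i\<in>UNIV. if i = j then b i f else 0)"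
    by (intro sum.cong) auto
  then show "frame_act b (mat 1) j f = b j f" by (simp add: frame_act_def mat_def)
qed

lemma frame_act_inject:
  assumes b: "oriented_orthonormal_basis A g p b" and eq: "frame_act b h = frame_act b k"
  shows "h = k"
proof -
  have "h $ l $ j = g p (frame_act b h j) (b l)" for h l j
  proof -
    have "frame_act b h j = (\<lambda>f. \<Sum>i\<in>UNIV. h $ i $ j * b i f)"
      by (simp add: frame_act_def mult.commute)
    then have "g p (frame_act b h j) (b l) = (\<Sum>i\<in>UNIV. h $ i $ j * g p (b i) (b l))"
      by (simp add: g_sum basis_tangent[OF b])
    also have "\<dots> = (\<Sum>i\<in>UNIV. if i = l then h $ i $ j else 0)"
      by (intro sum.cong) (auto simp: basis_orthonormal[OF b])
    finally show ?thesis by simp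
  qed
  with eq show ?thesis by (simp add: vec_eq_iff)
qed

lemma connection_matrix_component:
  "connection_matrix g nabla e p v $ l $ k = g p (nabla p v (e k)) (e l p)"
  by (simp add: connection_matrix_def)

lemma frame_field: "local_frame A g U e \<Longrightarrow> vector_field_on A U (e i)"
  and frame_open: "local_frame A g U e \<Longrightarrow> open U"
  and frame_basis: "local_frame A g U e \<Longrightarrow> p \<in> U \<Longrightarrow> oriented_orthonormal_basis A g p (\<lambda>i. e i p)"
  by (auto simp: local_frame_def)

text \<open>
  The functions \<open>g(e_k, e_l)\<close> are constant on the domain of the frame; their derivatives are the entries of
  the symmetric part.
\<close>

lemma connection_matrix_skew:
  assumes e: "local_frame A g U e" and p: "p \<in> U" and v: "v \<in> tangent_space A p"
  shows "transpose (connection_matrix g nabla e p v) = - connection_matrix g nabla e p v"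
proof -
  have "g p (nabla p v (e k)) (e l p) + g p (nabla p v (e l)) (e k p) = 0" for k l
  proof -
    let ?c = "if k = l then 1 else 0 :: real"
    have "v (\<lambda>q. ?c) = v (\<lambda>q. g q (e k q) (e l q))"
      by (rule tangent_cong[OF v msmooth_const[OF frame_open[OF e]] p])
         (simp add: basis_orthonormal[OF frame_basis[OF e]])
    then have "0 = g p (nabla p v (e k)) (e l p) + g p (e k p) (nabla p v (e l))"
      using metric_compatible[OF frame_field[OF e] frame_field[OF e] p v, of k l]
      by (simp only: tangent_const[OF v])
    then show ?thesis
      using g_sym[OF basis_tangent[OF frame_basis[OF e p]] nabla_tangent[OF frame_field[OF e] p v], of k l]
      by simp
  qed
  then have "transpose (connection_matrix g nabla e p v) $ k $ l = (- connection_matrix g nabla e p v) $ k $ l" for k l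
    by (simp add: transpose_def connection_matrix_component eq_neg_iff_add_eq_0)
  then show ?thesis unfolding vec_eq_iff by blast
qed

lemma connection_matrix_smooth:
  assumes e: "local_frame A g U e" and X: "vector_field_on A U X"
  shows "msmooth A U (\<lambda>q. connection_matrix g nabla e q (X q))"
  by (intro msmooth_vec[OF smooth_atlas frame_open[OF e]])
     (simp add: connection_matrix_component g_smooth nabla_field X frame_field[OF e])

lemma connection_matrix_combination:
  assumes e: "local_frame A g U e" and p: "p \<in> U"
    and v: "v \<in> tangent_space A p" and w: "w \<in> tangent_space A p"
  shows "connection_matrix g nabla e p (\<lambda>f. a * v f + b * w f) =
    a *\<^sub>R connection_matrix g nabla e p v + b *\<^sub>R connection_matrix g nabla e p w"
proof -
  have "g p (nabla p (\<lambda>f. a * v f + b * w f) (e k)) (e l p) =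
      a * g p (nabla p v (e k)) (e l p) + b * g p (nabla p w (e k)) (e l p)" for k l
    unfolding nabla_combination[OF frame_field[OF e] p v w]
    by (intro g_combination nabla_tangent[OF frame_field[OF e] p] v w basis_tangent[OF frame_basis[OF e p]])
  then show ?thesis by (simp add: vec_eq_iff connection_matrix_component)
qed

text \<open>
  The curvature form \<open>d\<omega> + \<omega> \<and> \<omega>\<close> of the frame, evaluated on two vector fields.  The value of \<open>\<omega>\<close> on the
  Lie bracket is written as a difference of values on covariant derivatives.
\<close>

definition curvature_matrix :: "('n \<Rightarrow> 'a vfield) \<Rightarrow> 'a vfield \<Rightarrow> 'a vfield \<Rightarrow> 'a \<Rightarrow> real^'n^'n" where
  "curvature_matrix e X Y p =
     vderiv (X p) (\<lambda>q. connection_matrix g nabla e q (Y q))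
     - vderiv (Y p) (\<lambda>q. connection_matrix g nabla e q (X q))
     - (connection_matrix g nabla e p (nabla p (X p) Y) - connection_matrix g nabla e p (nabla p (Y p) X))
     + (connection_matrix g nabla e p (X p) ** connection_matrix g nabla e p (Y p)
        - connection_matrix g nabla e p (Y p) ** connection_matrix g nabla e p (X p))"

lemma curvature_matrix_swap: "curvature_matrix e Y X p = - curvature_matrix e X Y p"
  by (simp add: curvature_matrix_def)

lemma vderiv_component:
  fixes F :: "'a \<Rightarrow> real^'k^'l"
  shows "vderiv v F $ l $ k = v (\<lambda>q. F q $ l $ k)"
proof -
  have "axis l (axis k 1) \<in> (Basis :: (real^'k^'l) set)" by (auto simp: Basis_vec_def)
  from vderiv_inner[OF this, of v F] show ?thesis by (simp add: inner_axis)
qed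

text \<open>
  Compatibility with the metric splits \<open>X(g(\<nabla>_Y e_k, e_l))\<close> into a second covariant derivative and
  \<open>g(\<nabla>_Y e_k, \<nabla>_X e_l)\<close>.  Expanded in the frame, the latter is an entry of a product of connection matrices,
  with a minus sign because these are skew.
\<close>

lemma curvature_matrix_eq:
  assumes e: "local_frame A g U e" and X: "vector_field_on A U X" and Y: "vector_field_on A U Y"
    and p: "p \<in> U"
  shows "curvature_matrix e X Y p $ l $ k = g p (riemann_curvature A nabla X Y (e k) p) (e l p)"
proof -
  let ?w = "connection_matrix g nabla e p"
  note ek = frame_field[OF e] and b = frame_basis[OF e p]
  note el = basis_tangent[OF b, of l]
  have d: "vderiv (X p) (\<lambda>q. connection_matrix g nabla e q (Y q)) $ l $ k =
      g p (nabla p (X p) (\<lambda>q. nabla q (Y q) (e k))) (e l p) - (?w (X p) ** ?w (Y p)) $ l $ k"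
    if X: "vector_field_on A U X" and Y: "vector_field_on A U Y" for X Y
  proof -
    note Xp = vector_field_tangent[OF X p] and Yp = vector_field_tangent[OF Y p]
    have "vderiv (X p) (\<lambda>q. connection_matrix g nabla e q (Y q)) $ l $ k =
        X p (\<lambda>q. g q (nabla q (Y q) (e k)) (e l q))"
      by (simp add: vderiv_component connection_matrix_component)
    also have "\<dots> = g p (nabla p (X p) (\<lambda>q. nabla q (Y q) (e k))) (e l p) +
        g p (nabla p (Y p) (e k)) (nabla p (X p) (e l))"
      by (rule metric_compatible[OF nabla_field[OF Y ek] ek p Xp])
    also have "g p (nabla p (Y p) (e k)) (nabla p (X p) (e l)) =
        (\<Sum>s\<in>UNIV. g p (nabla p (Y p) (e k)) (e s p) * g p (nabla p (X p) (e l)) (e s p))"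
      by (intro g_basis_expansion[OF b] nabla_tangent[OF ek p] Xp Yp)
    also have "\<dots> = (\<Sum>s\<in>UNIV. ?w (Y p) $ s $ k * transpose (?w (X p)) $ l $ s)"
      by (simp add: connection_matrix_component transpose_def)
    also have "\<dots> = - (?w (X p) ** ?w (Y p)) $ l $ k"
      unfolding connection_matrix_skew[OF e p Xp]
      by (simp add: matrix_matrix_mult_def sum_negf mult.commute)
    finally show ?thesis by simp
  qed
  note Xp = vector_field_tangent[OF X p] and Yp = vector_field_tangent[OF Y p]
  have NXY: "nabla p (X p) Y \<in> tangent_space A p" "nabla p (Y p) X \<in> tangent_space A p"
    using nabla_tangent[OF Y p Xp] nabla_tangent[OF X p Yp] .
  have T: "torsion_bracket X Y p = (\<lambda>f. 1 * nabla p (X p) Y f + (-1) * nabla p (Y p) X f)"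
    by (simp add: torsion_bracket_def)
  have R: "nabla p (X p) (\<lambda>q. nabla q (Y q) (e k)) \<in> tangent_space A p"
    "nabla p (Y p) (\<lambda>q. nabla q (X q) (e k)) \<in> tangent_space A p"
    "nabla p (torsion_bracket X Y p) (e k) \<in> tangent_space A p"
    using nabla_tangent[OF nabla_field[OF Y ek] p Xp] nabla_tangent[OF nabla_field[OF X ek] p Yp]
      nabla_tangent[OF ek p vector_field_tangent[OF torsion_bracket_field[OF X Y] p]] .
  have "g p (riemann_curvature A nabla X Y (e k) p) (e l p) =
      g p (\<lambda>f. 1 * (1 * nabla p (X p) (\<lambda>q. nabla q (Y q) (e k)) f
      + (-1) * nabla p (Y p) (\<lambda>q. nabla q (X q) (e k)) f) + (-1) * nabla p (torsion_bracket X Y p) (e k) f) (e l p)"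
    by (simp add: riemann_curvature_eq[OF X Y p])
  also have "\<dots> = 1 * (1 * g p (nabla p (X p) (\<lambda>q. nabla q (Y q) (e k))) (e l p)
      + (-1) * g p (nabla p (Y p) (\<lambda>q. nabla q (X q) (e k))) (e l p))
      + (-1) * g p (nabla p (torsion_bracket X Y p) (e k)) (e l p)"
    unfolding g_combination[OF tangent_space_combination[OF R(1,2)] el R(3)] g_combination[OF R(1) el R(2)] ..
  also have "g p (nabla p (torsion_bracket X Y p) (e k)) (e l p) =
      ?w (nabla p (X p) Y) $ l $ k - ?w (nabla p (Y p) X) $ l $ k"
    using arg_cong[OF connection_matrix_combination[OF e p NXY, of 1 "-1"], of "\<lambda>M. M $ l $ k"]
    unfolding T[symmetric] by (simp add: connection_matrix_component)
  finally show ?thesis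
    unfolding curvature_matrix_def by (simp add: d[OF X Y] d[OF Y X])
qed

lemma curvature_matrix_skew:
  assumes e: "local_frame A g U e" and X: "vector_field_on A U X" and Y: "vector_field_on A U Y"
    and p: "p \<in> U"
  shows "transpose (curvature_matrix e X Y p) = - curvature_matrix e X Y p"
proof -
  let ?w = "connection_matrix g nabla e"
  note Xp = vector_field_tangent[OF X p] and Yp = vector_field_tangent[OF Y p]
  note lin = bounded_linear_transpose
  note tr = linear_diff[OF bounded_linear.linear[OF lin]] linear_add[OF bounded_linear.linear[OF lin]]
  have d: "transpose (vderiv (X p) (\<lambda>q. ?w q (Y q))) = - vderiv (X p) (\<lambda>q. ?w q (Y q))"
    if X: "vector_field_on A U X" and Y: "vector_field_on A U Y" for X Y
  proof -
    note sm = connection_matrix_smooth[OF e Y] and Xp = vector_field_tangent[OF X p]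
    have "transpose (vderiv (X p) (\<lambda>q. ?w q (Y q))) = vderiv (X p) (\<lambda>q. transpose (?w q (Y q)))"
      by (rule vderiv_bounded_linear[OF Xp lin sm p, symmetric])
    also have "\<dots> = vderiv (X p) (\<lambda>q. - ?w q (Y q))"
      by (rule vderiv_cong[OF Xp msmooth_bounded_linear[OF lin sm] p])
         (rule connection_matrix_skew[OF e _ vector_field_tangent[OF Y]])
    also have "\<dots> = - vderiv (X p) (\<lambda>q. ?w q (Y q))"
      by (rule vderiv_bounded_linear[OF Xp bounded_linear_minus[OF bounded_linear_ident] sm p])
    finally show ?thesis .
  qed
  note sk = connection_matrix_skew[OF e p Xp] connection_matrix_skew[OF e p Yp]
    connection_matrix_skew[OF e p nabla_tangent[OF Y p Xp]] connection_matrix_skew[OF e p nabla_tangent[OF X p Yp]]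
  show ?thesis
    unfolding curvature_matrix_def
    by (simp add: tr d[OF X Y] d[OF Y X] sk matrix_transpose_mul matrix_mult_linear)
qed

end

locale associated_bundle = riemannian A g nabla + so_representation \<pi>
  for A :: "('a::topological_space, 'n::finite) chart set"
    and g :: "'a \<Rightarrow> 'a tvec \<Rightarrow> 'a tvec \<Rightarrow> real"
    and nabla :: "'a \<Rightarrow> 'a tvec \<Rightarrow> 'a vfield \<Rightarrow> 'a tvec"
    and \<pi> :: "real^'n^'n \<Rightarrow> complex^'d^'d" +
  fixes D :: "'a \<Rightarrow> 'a tvec \<Rightarrow> ('a \<Rightarrow> ('a, 'n, 'd) assoc_pt) \<Rightarrow> ('a, 'n, 'd) assoc_pt"
  assumes connection: "induced_connection A g nabla \<pi> D"
begin

text \<open>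
  The group acts freely on frames, so a frame occurs in a class with at most one vector.
\<close>

lemma mem_assoc_class_iff:
  assumes b: "oriented_orthonormal_basis A g p b"
  shows "(b, w) \<in> assoc_class \<pi> b v \<longleftrightarrow> w = v"
proof
  assume "(b, w) \<in> assoc_class \<pi> b v"
  then obtain h where h: "h \<in> SO_group" "frame_act b h = b" "w = \<pi> h *v v"
    by (auto simp: assoc_class_def)
  have "h = mat 1"
    by (rule frame_act_inject[OF b]) (simp add: h(2) frame_act_one)
  then show "w = v" by (simp add: h(3) rep_one)
next
  assume "w = v"
  then show "(b, w) \<in> assoc_class \<pi> b v"
    unfolding assoc_class_def using frame_act_one[of b] rep_one
    by (auto intro!: exI[of _ "mat 1"])
qed

lemma frame_coord_assoc_class:
  "oriented_orthonormal_basis A g p b \<Longrightarrow> frame_coord b (assoc_class \<pi> b v) = v"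
  unfolding frame_coord_def by (simp add: mem_assoc_class_iff)

lemma assoc_diff_assoc_class:
  assumes b: "oriented_orthonormal_basis A g p b"
  shows "assoc_diff (assoc_class \<pi> b v) (assoc_class \<pi> b w) = assoc_class \<pi> b (v - w)"
proof -
  have eq: "h = k" if hk: "h \<in> SO_group" "k \<in> SO_group" "frame_act b' h = b" "frame_act b' k = b" for b' h k
  proof -
    have "frame_act b (transpose h) = b'" "frame_act b (transpose k) = b'"
      using hk frame_act_compose[of b' h "transpose h"] frame_act_compose[of b' k "transpose k"]
      by (simp_all add: SO_transpose_mult frame_act_one)
    then have "transpose h = transpose k" by (intro frame_act_inject[OF b]) (simp only:)
    then show ?thesis by (metis transpose_transpose)
  qed
  show ?thesis
  proof (intro equalityI subsetI)
    fix x assume "x \<in> assoc_diff (assoc_class \<pi> b v) (assoc_class \<pi> b w)"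
    then obtain b' h k where x: "x = (b', \<pi> h *v v - \<pi> k *v w)" "h \<in> SO_group" "k \<in> SO_group"
      "frame_act b' h = b" "frame_act b' k = b"
      by (auto simp: assoc_diff_def assoc_class_def)
    then have "x = (b', \<pi> h *v (v - w))"
      using eq[of h k b'] by (simp add: matrix_vector_mult_diff_distrib)
    then show "x \<in> assoc_class \<pi> b (v - w)"
      using x by (auto simp: assoc_class_def)
  next
    fix x assume "x \<in> assoc_class \<pi> b (v - w)"
    then obtain b' h where "x = (b', \<pi> h *v v - \<pi> h *v w)" "h \<in> SO_group" "frame_act b' h = b"
      by (auto simp: assoc_class_def matrix_vector_mult_diff_distrib)
    then show "x \<in> assoc_diff (assoc_class \<pi> b v) (assoc_class \<pi> b w)"
      unfolding assoc_diff_def assoc_class_def by blast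
  qed
qed

definition coords :: "('n \<Rightarrow> 'a vfield) \<Rightarrow> ('a \<Rightarrow> ('a, 'n, 'd) assoc_pt) \<Rightarrow> 'a \<Rightarrow> complex^'d" where
  "coords e \<psi> q = frame_coord (\<lambda>i. e i q) (\<psi> q)"

lemma section_smooth: "smooth_section A g \<pi> U \<psi> \<Longrightarrow> local_frame A g U e \<Longrightarrow> msmooth A U (coords e \<psi>)"
  unfolding smooth_section_def coords_def by blast

lemma section_subset: "smooth_section A g \<pi> U \<psi> \<Longrightarrow> open V \<Longrightarrow> V \<subseteq> U \<Longrightarrow> smooth_section A g \<pi> V \<psi>"
  unfolding smooth_section_def by blast

lemma covariant_derivative_eq:
  assumes "local_frame A g U e" "smooth_section A g \<pi> U \<psi>" "q \<in> U" "v \<in> tangent_space A q"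
  shows "D q v \<psi> = assoc_class \<pi> (\<lambda>i. e i q)
    (vderiv v (coords e \<psi>) + skew_rep (connection_matrix g nabla e q v) *v coords e \<psi> q)"
  using connection assms unfolding induced_connection_def
  by (simp add: Let_def tvec_deriv_eq_vderiv coords_def[abs_def]
      skew_rep_eq[OF connection_matrix_skew[OF assms(1,3,4)]])

lemma coords_covariant_derivative:
  assumes e: "local_frame A g U e" and \<psi>: "smooth_section A g \<pi> U \<psi>" and X: "vector_field_on A U X"
    and q: "q \<in> U"
  shows "coords e (\<lambda>q. D q (X q) \<psi>) q =
    vderiv (X q) (coords e \<psi>) + skew_rep (connection_matrix g nabla e q (X q)) *v coords e \<psi> q"
  unfolding coords_def[of e "\<lambda>q. D q (X q) \<psi>"]
    covariant_derivative_eq[OF e \<psi> q vector_field_tangent[OF X q]]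
  by (rule frame_coord_assoc_class[OF frame_basis[OF e q]])

text \<open>
  Smoothness has to be tested in every local frame on every smaller open set, and the formula for the
  covariant derivative is available in each of them.
\<close>

lemma covariant_derivative_smooth:
  assumes e: "local_frame A g U e" and \<psi>: "smooth_section A g \<pi> U \<psi>" and X: "vector_field_on A U X"
  shows "smooth_section A g \<pi> U (\<lambda>q. D q (X q) \<psi>)"
  unfolding smooth_section_def
proof (intro conjI ballI allI impI)
  show "open U" by (rule frame_open[OF e])
  show "D p (X p) \<psi> \<in> assoc_fibre A g \<pi> p" if p: "p \<in> U" for p
    unfolding assoc_fibre_def covariant_derivative_eq[OF e \<psi> p vector_field_tangent[OF X p]]
    using frame_basis[OF e p] by blast
  fix V e' assume "V \<subseteq> U \<and> local_frame A g V e'"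
  then have V: "V \<subseteq> U" and e': "local_frame A g V e'" by auto
  note \<psi>' = section_subset[OF \<psi> frame_open[OF e'] V]
  note X' = vector_field_on_subset[OF X frame_open[OF e'] V]
  have "msmooth A V (\<lambda>q. vderiv (X q) (coords e' \<psi>) +
      skew_rep (connection_matrix g nabla e' q (X q)) *v coords e' \<psi> q)"
    by (intro msmooth_add msmooth_bounded_bilinear[OF bounded_bilinear_matrix_vector_mult]
        msmooth_bounded_linear[OF bounded_linear_skew_rep] vector_field_msmooth_vderiv[OF X']
        connection_matrix_smooth[OF e' X'] section_smooth[OF \<psi>' e'])
  then have "msmooth A V (coords e' (\<lambda>q. D q (X q) \<psi>))"
    by (rule msmooth_cong) (simp add: coords_covariant_derivative[OF e' \<psi>' X'])
  then show "msmooth A V (\<lambda>q. frame_coord (\<lambda>i. e' i q) (D q (X q) \<psi>))"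
    by (simp add: coords_def[abs_def])
qed

lemma second_cov_eq:
  assumes e: "local_frame A g U e" and \<psi>: "smooth_section A g \<pi> U \<psi>"
    and X: "vector_field_on A U X" and Y: "vector_field_on A U Y" and p: "p \<in> U"
  defines "w \<equiv> connection_matrix g nabla e" and "\<phi> \<equiv> coords e \<psi>"
  shows "second_cov nabla D X Y \<psi> p = assoc_class \<pi> (\<lambda>i. e i p)
    (vderiv (X p) (\<lambda>q. vderiv (Y q) \<phi>) + skew_rep (vderiv (X p) (\<lambda>q. w q (Y q))) *v \<phi> p
     + skew_rep (w p (Y p)) *v vderiv (X p) \<phi> + skew_rep (w p (X p)) *v vderiv (Y p) \<phi>
     + (skew_rep (w p (X p)) ** skew_rep (w p (Y p))) *v \<phi> p
     - (vderiv (nabla p (X p) Y) \<phi> + skew_rep (w p (nabla p (X p) Y)) *v \<phi> p))"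
proof -
  note Xp = vector_field_tangent[OF X p]
  note sm\<phi> = section_smooth[OF \<psi> e, folded \<phi>_def]
  note smw = connection_matrix_smooth[OF e Y, folded w_def]
  note smL = msmooth_bounded_linear[OF bounded_linear_skew_rep smw]
  note smB = msmooth_bounded_bilinear[OF bounded_bilinear_matrix_vector_mult smL sm\<phi>]
  note smY = vector_field_msmooth_vderiv[OF Y sm\<phi>]
  have eq: "coords e (\<lambda>q. D q (Y q) \<psi>) q = vderiv (Y q) \<phi> + skew_rep (w q (Y q)) *v \<phi> q" if "q \<in> U" for q
    using coords_covariant_derivative[OF e \<psi> Y that] by (simp add: w_def \<phi>_def)
  have "vderiv (X p) (coords e (\<lambda>q. D q (Y q) \<psi>)) =
      vderiv (X p) (\<lambda>q. vderiv (Y q) \<phi> + skew_rep (w q (Y q)) *v \<phi> q)"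
    by (rule vderiv_cong[OF Xp msmooth_add[OF smY smB] p, symmetric]) (rule eq[symmetric])
  also have "\<dots> = vderiv (X p) (\<lambda>q. vderiv (Y q) \<phi>) +
      (skew_rep (vderiv (X p) (\<lambda>q. w q (Y q))) *v \<phi> p + skew_rep (w p (Y p)) *v vderiv (X p) \<phi>)"
    unfolding vderiv_add[OF Xp smY smB p]
      vderiv_bounded_bilinear[OF Xp bounded_bilinear_matrix_vector_mult smL sm\<phi> p]
      vderiv_bounded_linear[OF Xp bounded_linear_skew_rep smw p] ..
  finally have d: "vderiv (X p) (coords e (\<lambda>q. D q (Y q) \<psi>)) = \<dots>" .
  have "second_cov nabla D X Y \<psi> p = assoc_diff (assoc_class \<pi> (\<lambda>i. e i p)
      (vderiv (X p) (coords e (\<lambda>q. D q (Y q) \<psi>)) + skew_rep (w p (X p)) *v coords e (\<lambda>q. D q (Y q) \<psi>) p))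
      (assoc_class \<pi> (\<lambda>i. e i p) (vderiv (nabla p (X p) Y) \<phi> + skew_rep (w p (nabla p (X p) Y)) *v \<phi> p))"
    unfolding second_cov_def w_def \<phi>_def
      covariant_derivative_eq[OF e covariant_derivative_smooth[OF e \<psi> Y] p Xp]
      covariant_derivative_eq[OF e \<psi> p nabla_tangent[OF Y p Xp]] ..
  also have "\<dots> = assoc_class \<pi> (\<lambda>i. e i p)
      (vderiv (X p) (coords e (\<lambda>q. D q (Y q) \<psi>)) + skew_rep (w p (X p)) *v coords e (\<lambda>q. D q (Y q) \<psi>) p -
       (vderiv (nabla p (X p) Y) \<phi> + skew_rep (w p (nabla p (X p) Y)) *v \<phi> p))"
    by (rule assoc_diff_assoc_class[OF frame_basis[OF e p]])
  finally show ?thesis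
    unfolding d eq[OF p] by (simp add: matrix_vector_right_distrib matrix_vector_mul_assoc add.assoc)
qed

text \<open>The second derivatives of the components cancel because the connection is torsion-free.\<close>

lemma vderiv_commutator:
  assumes \<phi>: "msmooth A U (\<phi> :: 'a \<Rightarrow> 'b::euclidean_space)"
    and X: "vector_field_on A U X" and Y: "vector_field_on A U Y" and p: "p \<in> U"
  shows "vderiv (X p) (\<lambda>q. vderiv (Y q) \<phi>) - vderiv (Y p) (\<lambda>q. vderiv (X q) \<phi>) =
    vderiv (nabla p (X p) Y) \<phi> - vderiv (nabla p (Y p) X) \<phi>"
proof (rule euclidean_eqI)
  fix b :: 'b assume b: "b \<in> Basis"
  show "(vderiv (X p) (\<lambda>q. vderiv (Y q) \<phi>) - vderiv (Y p) (\<lambda>q. vderiv (X q) \<phi>)) \<bullet> b =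
    (vderiv (nabla p (X p) Y) \<phi> - vderiv (nabla p (Y p) X) \<phi>) \<bullet> b"
    using torsion_free_smooth[OF X Y p msmooth_imp_at[OF msmooth_inner[OF \<phi>, of b] p]]
    by (simp add: inner_diff_left vderiv_inner b)
qed

text \<open>
  The terms with one derivative of the components are symmetric in \<open>X\<close> and \<open>Y\<close> and cancel.  What remains
  is the image of the curvature form, because the differential of \<open>\<pi>\<close> preserves brackets.
\<close>

lemma frame_coord_bundle_curvature:
  assumes e: "local_frame A g U e" and \<psi>: "smooth_section A g \<pi> U \<psi>"
    and X: "vector_field_on A U X" and Y: "vector_field_on A U Y" and p: "p \<in> U"
  shows "frame_coord (\<lambda>i. e i p) (bundle_curvature nabla D X Y \<psi> p) =
    skew_rep (curvature_matrix e X Y p) *v frame_coord (\<lambda>i. e i p) (\<psi> p)"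
proof -
  define w where "w = connection_matrix g nabla e"
  define \<phi> where "\<phi> = coords e \<psi>"
  note Xp = vector_field_tangent[OF X p] and Yp = vector_field_tangent[OF Y p]
  note br = skew_rep_bracket[OF connection_matrix_skew[OF e p Xp] connection_matrix_skew[OF e p Yp],
      folded w_def]
  note comm = vderiv_commutator[OF section_smooth[OF \<psi> e, folded \<phi>_def] X Y p]
  have "frame_coord (\<lambda>i. e i p) (bundle_curvature nabla D X Y \<psi> p) =
     (vderiv (X p) (\<lambda>q. vderiv (Y q) \<phi>) + skew_rep (vderiv (X p) (\<lambda>q. w q (Y q))) *v \<phi> p
     + skew_rep (w p (Y p)) *v vderiv (X p) \<phi> + skew_rep (w p (X p)) *v vderiv (Y p) \<phi>
     + (skew_rep (w p (X p)) ** skew_rep (w p (Y p))) *v \<phi> p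
     - (vderiv (nabla p (X p) Y) \<phi> + skew_rep (w p (nabla p (X p) Y)) *v \<phi> p))
    - (vderiv (Y p) (\<lambda>q. vderiv (X q) \<phi>) + skew_rep (vderiv (Y p) (\<lambda>q. w q (X q))) *v \<phi> p
     + skew_rep (w p (X p)) *v vderiv (Y p) \<phi> + skew_rep (w p (Y p)) *v vderiv (X p) \<phi>
     + (skew_rep (w p (Y p)) ** skew_rep (w p (X p))) *v \<phi> p
     - (vderiv (nabla p (Y p) X) \<phi> + skew_rep (w p (nabla p (Y p) X)) *v \<phi> p))"
    unfolding bundle_curvature_def second_cov_eq[OF e \<psi> X Y p] second_cov_eq[OF e \<psi> Y X p]
      assoc_diff_assoc_class[OF frame_basis[OF e p]]
      frame_coord_assoc_class[OF frame_basis[OF e p]] w_def \<phi>_def ..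
  also have "\<dots> = (skew_rep (vderiv (X p) (\<lambda>q. w q (Y q))) - skew_rep (vderiv (Y p) (\<lambda>q. w q (X q)))
      - (skew_rep (w p (nabla p (X p) Y)) - skew_rep (w p (nabla p (Y p) X)))
      + (skew_rep (w p (X p)) ** skew_rep (w p (Y p)) - skew_rep (w p (Y p)) ** skew_rep (w p (X p)))) *v \<phi> p"
    using comm by (simp add: matrix_vector_mult_diff_rdistrib matrix_vector_mult_add_rdistrib algebra_simps)
  also have "\<dots> = skew_rep (curvature_matrix e X Y p) *v \<phi> p"
    unfolding curvature_matrix_def w_def[symmetric] skew_rep_linear(1,2) 
    by (simp only: br[unfolded skew_rep_linear(2)])
  finally show ?thesis by (simp add: \<phi>_def coords_def)
qed

end

section \<open>Contraction with the Weyl decomposition\<close>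

lemma sum_kdelta:
  fixes f :: "'n::finite \<Rightarrow> 'b::real_vector"
  shows "(\<Sum>l\<in>UNIV. (c l * kdelta j l) *\<^sub>R f l) = c j *\<^sub>R f j"
proof -
  have "(\<Sum>l\<in>UNIV. (c l * kdelta j l) *\<^sub>R f l) = (\<Sum>l\<in>UNIV. if j = l then c l *\<^sub>R f l else 0)"
    by (intro sum.cong) (auto simp: kdelta_def)
  then show ?thesis by simp
qed

text \<open>
  Contracting \<open>P i j ** a k l\<close> with a product of a symmetric tensor \<open>M\<close> and a Kronecker delta gives, up to sign,
  the contraction of \<open>M\<close> with \<open>C i k\<close>, the sum over \<open>j \<noteq> i\<close> of \<open>P i j ** a k j\<close>.  The symmetric part of \<open>C\<close> is \<open>-F\<close> times the identity,
  so only the trace of \<open>M\<close> matters.  The Einstein tensor has trace zero, which removes \<open>K\<close>; in \<open>S\<close> the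
  tensor \<open>M\<close> is a Kronecker delta, which gives the scalar curvature term.
\<close>

lemma weyl_contraction:
  fixes R :: "'n::finite \<Rightarrow> 'n \<Rightarrow> 'n \<Rightarrow> 'n \<Rightarrow> real" and P a :: "'n \<Rightarrow> 'n \<Rightarrow> complex^'d^'d"
  assumes n: "CARD('n) > 2"
    and ricci_sym: "\<And>i j. ricci R i j = ricci R j i"
    and P_skew: "\<And>i j. i \<noteq> j \<Longrightarrow> P j i = - P i j" and a_skew: "\<And>i j. a j i = - a i j"
    and diag: "\<And>i. (\<Sum>j\<in>UNIV - {i}. P i j ** a i j) = - F"
    and off_diag: "\<And>i k. i \<noteq> k \<Longrightarrow>
      (\<Sum>j\<in>UNIV - {i}. P i j ** a k j) = - (\<Sum>j\<in>UNIV - {k}. P k j ** a i j)"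
  shows "(1 / 2) *\<^sub>R (\<Sum>i\<in>UNIV. \<Sum>j\<in>UNIV. \<Sum>k\<in>UNIV. \<Sum>l\<in>UNIV. R i j k l *\<^sub>R (P i j ** a k l)) =
    (1 / 2) *\<^sub>R (\<Sum>i\<in>UNIV. \<Sum>j\<in>UNIV. \<Sum>k\<in>UNIV. \<Sum>l\<in>UNIV. weyl R i j k l *\<^sub>R (P i j ** a k l)) +
    (scalar_curv R / (real CARD('n) - 1)) *\<^sub>R F"
proof -
  let ?n = "real CARD('n)"
  define Q where "Q i j = (if i = j then 0 else P i j)" for i j
  define C where "C i k = (\<Sum>j\<in>UNIV. Q i j ** a k j)" for i k
  define contr where "contr T = (\<Sum>i\<in>UNIV. \<Sum>j\<in>UNIV. \<Sum>k\<in>UNIV. \<Sum>l\<in>UNIV. T i j k l *\<^sub>R (Q i j ** a k l))"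
    for T :: "'n \<Rightarrow> 'n \<Rightarrow> 'n \<Rightarrow> 'n \<Rightarrow> real"
  define tot where "tot T = (\<Sum>i\<in>UNIV. \<Sum>j\<in>UNIV. \<Sum>k\<in>UNIV. \<Sum>l\<in>UNIV. T i j k l *\<^sub>R (P i j ** a k l))"
    for T :: "'n \<Rightarrow> 'n \<Rightarrow> 'n \<Rightarrow> 'n \<Rightarrow> real"
  define \<Phi> where "\<Phi> M = (\<Sum>i\<in>UNIV. \<Sum>k\<in>UNIV. M i k *\<^sub>R C i k)" for M :: "'n \<Rightarrow> 'n \<Rightarrow> real"
  have Q_skew: "Q j i = - Q i j" for i j
    using P_skew[of i j] by (cases "i = j") (auto simp: Q_def)
  have C_eq: "C i k = (\<Sum>j\<in>UNIV - {i}. P i j ** a k j)" for i k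
  proof -
    have "C i k = (\<Sum>j\<in>UNIV - {i}. Q i j ** a k j)"
      unfolding C_def
      by (rule sum.mono_neutral_right)
        (auto simp: Q_def bounded_bilinear.zero_left[OF bounded_bilinear_matrix_mult])
    also have "\<dots> = (\<Sum>j\<in>UNIV - {i}. P i j ** a k j)"
      by (intro sum.cong) (auto simp: Q_def)
    finally show ?thesis .
  qed
  have CC: "C i k + C k i = (if i = k then (-2) *\<^sub>R F else 0)" for i k
    using diag[of i] off_diag[of i k] by (auto simp: C_eq scaleR_2)
  \<comment> \<open>A symmetric coefficient matrix sees only the symmetric part of \<open>C\<close>, a multiple of the identity.\<close>
  have \<Phi>: "\<Phi> M = - ((\<Sum>i\<in>UNIV. M i i) *\<^sub>R F)" if sym: "\<And>i k. M i k = M k i" for M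
  proof -
    have "\<Phi> M = (\<Sum>i\<in>UNIV. \<Sum>k\<in>UNIV. M i k *\<^sub>R C k i)"
      unfolding \<Phi>_def by (subst sum.swap) (simp add: sym)
    then have "\<Phi> M + \<Phi> M = (\<Sum>i\<in>UNIV. \<Sum>k\<in>UNIV. M i k *\<^sub>R (C i k + C k i))"
      by (simp add: \<Phi>_def scaleR_add_right sum.distrib)
    also have "\<dots> = (\<Sum>i\<in>UNIV. \<Sum>k\<in>UNIV. if i = k then (-2) *\<^sub>R (M i i *\<^sub>R F) else 0)"
      unfolding CC by (intro sum.cong) auto
    also have "\<dots> = (-2) *\<^sub>R ((\<Sum>i\<in>UNIV. M i i) *\<^sub>R F)"
      by (simp add: scaleR_sum_left scaleR_sum_right)
    finally have "2 *\<^sub>R \<Phi> M = 2 *\<^sub>R (- ((\<Sum>i\<in>UNIV. M i i) *\<^sub>R F))"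
      by (simp add: scaleR_2)
    then show ?thesis unfolding scaleR_cancel_left by simp
  qed
  have c1: "contr (\<lambda>i j k l. M i k * kdelta j l) = \<Phi> M" for M
  proof -
    have "contr (\<lambda>i j k l. M i k * kdelta j l) =
        (\<Sum>i\<in>UNIV. \<Sum>j\<in>UNIV. \<Sum>k\<in>UNIV. M i k *\<^sub>R (Q i j ** a k j))"
      unfolding contr_def by (simp only: sum_kdelta)
    also have "\<dots> = (\<Sum>i\<in>UNIV. \<Sum>k\<in>UNIV. \<Sum>j\<in>UNIV. M i k *\<^sub>R (Q i j ** a k j))"
      by (intro sum.cong refl sum.swap)
    finally show ?thesis by (simp add: \<Phi>_def C_def scaleR_sum_right)
  qed
  have c2: "contr (\<lambda>i j k l. M i l * kdelta j k) = - \<Phi> M" for M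
  proof -
    have "contr (\<lambda>i j k l. M i l * kdelta j k) =
        (\<Sum>i\<in>UNIV. \<Sum>j\<in>UNIV. \<Sum>l\<in>UNIV. \<Sum>k\<in>UNIV. (M i l * kdelta j k) *\<^sub>R (Q i j ** a k l))"
      unfolding contr_def by (intro sum.cong refl sum.swap)
    also have "\<dots> = (\<Sum>i\<in>UNIV. \<Sum>j\<in>UNIV. \<Sum>l\<in>UNIV. M i l *\<^sub>R (Q i j ** a j l))"
      by (simp only: sum_kdelta)
    also have "\<dots> = (\<Sum>i\<in>UNIV. \<Sum>l\<in>UNIV. \<Sum>j\<in>UNIV. M i l *\<^sub>R (Q i j ** a j l))"
      by (intro sum.cong refl sum.swap)
    also have "\<dots> = - \<Phi> M"
      unfolding \<Phi>_def C_def
      by (subst a_skew) (simp add: matrix_mult_linear sum_negf scaleR_sum_right)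
    finally show ?thesis .
  qed
  \<comment> \<open>Renaming the first two indices, \<open>Q\<close> being skew, reduces two of the terms of \<open>K\<close> to the other two.\<close>
  have c_swap: "contr (\<lambda>i j k l. T j i k l) = - contr T" for T
  proof -
    have "contr (\<lambda>i j k l. T j i k l) =
        (\<Sum>j\<in>UNIV. \<Sum>i\<in>UNIV. \<Sum>k\<in>UNIV. \<Sum>l\<in>UNIV. T j i k l *\<^sub>R (Q i j ** a k l))"
      unfolding contr_def by (rule sum.swap)
    also have "\<dots> = - contr T"
      unfolding contr_def by (subst Q_skew) (simp add: matrix_mult_linear sum_negf)
    finally show ?thesis .
  qed
  have contr_lin: "contr (\<lambda>i j k l. T i j k l + T' i j k l) = contr T + contr T'"
    "contr (\<lambda>i j k l. T i j k l - T' i j k l) = contr T - contr T'"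
    "contr (\<lambda>i j k l. c * T i j k l) = c *\<^sub>R contr T" for T T' c
    by (simp_all add: contr_def scaleR_add_left scaleR_diff_left sum.distrib sum_subtractf scaleR_sum_right)
  let ?E = "einstein R"
  have E: "\<Phi> ?E = 0"
  proof -
    have "(\<Sum>i\<in>UNIV. ?E i i) = 1 / (?n - 2) * (\<Sum>i\<in>UNIV. scalar_curv R / ?n - ricci R i i)"
      by (simp add: einstein_def kdelta_def sum_distrib_left)
    also have "\<dots> = 0" by (simp add: sum_subtractf scalar_curv_def)
    finally show ?thesis
      by (subst \<Phi>) (auto simp: einstein_def kdelta_def ricci_sym)
  qed
  have "contr (\<lambda>i j k l. K_tensor R i j k l) =
      contr (\<lambda>i j k l. ?E i k * kdelta j l) + contr (\<lambda>i j k l. ?E j l * kdelta i k)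
      - contr (\<lambda>i j k l. ?E i l * kdelta j k) - contr (\<lambda>i j k l. ?E j k * kdelta i l)"
    unfolding K_tensor_def contr_lin ..
  also have "\<dots> = 0"
    using c_swap[of "\<lambda>i j k l. ?E i l * kdelta j k"] c_swap[of "\<lambda>i j k l. ?E i k * kdelta j l"]
    by (simp add: c1 c2 E)
  finally have K: "contr (\<lambda>i j k l. K_tensor R i j k l) = 0" .
  have \<delta>: "\<Phi> kdelta = - (?n *\<^sub>R F)"
    by (subst \<Phi>) (auto simp: kdelta_def)
  have "contr (\<lambda>i j k l. S_tensor R i j k l) = (scalar_curv R / (?n * (?n - 1))) *\<^sub>R
      (contr (\<lambda>i j k l. kdelta i l * kdelta j k) - contr (\<lambda>i j k l. kdelta i k * kdelta j l))"
    unfolding S_tensor_def contr_lin ..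
  also have "\<dots> = (2 * (scalar_curv R / (?n - 1))) *\<^sub>R F"
    using n by (simp add: c1 c2 \<delta> field_simps flip: scaleR_2)
  finally have S: "contr (\<lambda>i j k l. S_tensor R i j k l) = (2 * (scalar_curv R / (?n - 1))) *\<^sub>R F" .
  \<comment> \<open>On the diagonal, where \<open>P\<close> and \<open>Q\<close> differ, both \<open>K\<close> and \<open>S\<close> vanish.\<close>
  have "tot R - tot (weyl R) = tot (\<lambda>i j k l. K_tensor R i j k l + S_tensor R i j k l)"
    unfolding tot_def by (simp add: weyl_def scaleR_diff_left scaleR_add_left sum_subtractf sum.distrib)
  also have "\<dots> = contr (\<lambda>i j k l. K_tensor R i j k l + S_tensor R i j k l)"
    unfolding tot_def contr_def
    by (intro sum.cong refl) (auto simp: Q_def K_tensor_def S_tensor_def)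
  also have "\<dots> = (2 * (scalar_curv R / (?n - 1))) *\<^sub>R F"
    unfolding contr_lin K S by simp
  finally have "tot R = tot (weyl R) + (2 * (scalar_curv R / (?n - 1))) *\<^sub>R F"
    by (simp add: algebra_simps)
  then show ?thesis
    unfolding tot_def[symmetric] by (simp add: scaleR_add_right)
qed

lemma skew_matrix_expansion:
  fixes M :: "real^'n^'n"
  assumes "transpose M = - M"
  shows "M = (1 / 2) *\<^sub>R (\<Sum>k\<in>UNIV. \<Sum>l\<in>UNIV. M $ l $ k *\<^sub>R re_part (e_mat k l))"
proof -
  have skew: "M $ y $ x = - M $ x $ y" for x y
    using arg_cong[OF assms, of "\<lambda>Z. Z $ x $ y"] by (simp add: transpose_def)
  have entry: "re_part (e_mat k l) $ x $ y = (if x = l then if y = k then 1 else 0 else 0)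
      - (if x = k then if y = l then 1 else 0 else 0)" for k l x y
    unfolding re_part_def e_mat_def vec_lambda_beta minus_complex.sel if_distrib[of Re]
      zero_complex.sel one_complex.sel by auto
  have "(\<Sum>k\<in>UNIV. \<Sum>l\<in>UNIV. M $ l $ k * re_part (e_mat k l) $ x $ y) = 2 * M $ x $ y" for x y
  proof -
    have "(\<Sum>k\<in>UNIV. \<Sum>l\<in>UNIV. M $ l $ k * re_part (e_mat k l) $ x $ y) =
        (\<Sum>k\<in>UNIV. \<Sum>l\<in>UNIV. if x = l then if y = k then M $ l $ k else 0 else 0) -
        (\<Sum>k\<in>UNIV. \<Sum>l\<in>UNIV. if y = l then if x = k then M $ l $ k else 0 else 0)"
      unfolding sum_subtractf[symmetric] entry by (intro sum.cong refl) auto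
    also have "\<dots> = M $ x $ y - M $ y $ x" by simp
    finally show ?thesis using skew[of y x] by simp
  qed
  then show ?thesis by (simp add: vec_eq_iff)
qed

context associated_bundle
begin

lemma curv_comp_eq:
  assumes e: "local_frame A g U e" and p: "p \<in> U"
  shows "curv_comp A g nabla e p i j k l = curvature_matrix e (e i) (e j) p $ l $ k"
  unfolding curv_comp_def by (rule curvature_matrix_eq[OF e frame_field[OF e] frame_field[OF e] p, symmetric])

text \<open>
  In the Bianchi identity for \<open>R_ijkk\<close>, summed over \<open>k\<close>, the first term vanishes by skew-symmetry and the
  other two are the entries of the Ricci tensor, up to sign.
\<close>

lemma ricci_symmetric:
  assumes e: "local_frame A g U e" and p: "p \<in> U"
  shows "ricci (curv_comp A g nabla e p) i j = ricci (curv_comp A g nabla e p) j i"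
proof -
  let ?R = "curv_comp A g nabla e p"
  note ek = frame_field[OF e]
  have skew12: "?R j i k l = - ?R i j k l" for i j k l
    unfolding curv_comp_eq[OF e p] curvature_matrix_swap[of e "e i" "e j"] by simp
  have skew34: "?R i j l k = - ?R i j k l" for i j k l
    using arg_cong[OF curvature_matrix_skew[OF e ek ek p], of "\<lambda>Z. Z $ l $ k" i j]
    unfolding curv_comp_eq[OF e p] by (simp add: transpose_def)
  have bianchi: "?R i j k l + ?R j k i l + ?R k i j l = 0" for i j k l
  proof -
    let ?r = "\<lambda>i j k. riemann_curvature A nabla (e i) (e j) (e k) p"
    note rt = riemann_curvature_tangent[OF ek ek ek p] and el = basis_tangent[OF frame_basis[OF e p], of l]
    have "(\<lambda>f. 1 * (1 * ?r i j k f + 1 * ?r j k i f) + 1 * ?r k i j f) = (\<lambda>f. 0 * ?r i j k f + 0 * ?r i j k f)"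
      using first_bianchi[OF ek ek ek p] by simp
    then have "g p (\<lambda>f. 1 * (1 * ?r i j k f + 1 * ?r j k i f) + 1 * ?r k i j f) (e l p) =
        g p (\<lambda>f. 0 * ?r i j k f + 0 * ?r i j k f) (e l p)" by (rule arg_cong)
    then show ?thesis
      unfolding g_combination[OF tangent_space_combination[OF rt rt] el rt] g_combination[OF rt el rt]
      by (simp add: curv_comp_def)
  qed
  have "?R i k k j - ?R j k k i = ?R i j k k + ?R j k i k + ?R k i j k" for k
    using skew34[of i j k k] skew34[of j k k i] skew12[of k i j k] skew34[of i k k j] by simp
  then have "(\<Sum>k\<in>UNIV. ?R i k k j - ?R j k k i) = 0"
    using bianchi by simp
  then show ?thesis by (simp add: ricci_def sum_subtractf)
qed

lemma frame_coord_curvature: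
  assumes e: "local_frame A g U e" and \<psi>: "smooth_section A g \<pi> U \<psi>" and p: "p \<in> U"
  shows "frame_coord (\<lambda>i. e i p) (bundle_curvature nabla D (e i) (e j) \<psi> p) =
    ((1 / 2) *\<^sub>R (\<Sum>k\<in>UNIV. \<Sum>l\<in>UNIV. curv_comp A g nabla e p i j k l *\<^sub>R uea_rep \<pi> (e_uea k l))) *v
    frame_coord (\<lambda>i. e i p) (\<psi> p)"
proof -
  note ek = frame_field[OF e]
  let ?M = "curvature_matrix e (e i) (e j) p"
  have "skew_rep ?M = skew_rep ((1 / 2) *\<^sub>R (\<Sum>k\<in>UNIV. \<Sum>l\<in>UNIV. ?M $ l $ k *\<^sub>R re_part (e_mat k l)))"
    using skew_matrix_expansion[OF curvature_matrix_skew[OF e ek ek p]] by simp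
  also have "\<dots> = (1 / 2) *\<^sub>R (\<Sum>k\<in>UNIV. \<Sum>l\<in>UNIV. ?M $ l $ k *\<^sub>R skew_rep (re_part (e_mat k l)))"
    by (simp only: skew_rep_linear(3) linear_sum[OF bounded_linear.linear[OF bounded_linear_skew_rep]])
  finally show ?thesis
    unfolding frame_coord_bundle_curvature[OF e \<psi> ek ek p] curv_comp_eq[OF e p] uea_rep_e by simp
qed

end

theorem proposition6p3:
  fixes A :: "('a::{t2_space,second_countable_topology}, 'n::{finite,linorder}) chart set"
    and g :: "'a \<Rightarrow> 'a tvec \<Rightarrow> 'a tvec \<Rightarrow> real"
    and nabla :: "'a \<Rightarrow> 'a tvec \<Rightarrow> 'a vfield \<Rightarrow> 'a tvec"
    and \<pi> :: "real^('n::{finite,linorder})^('n::{finite,linorder}) \<Rightarrow> complex^'d^'d"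
    and D :: "'a \<Rightarrow> 'a tvec \<Rightarrow> ('a \<Rightarrow> ('a, 'n, 'd) assoc_pt) \<Rightarrow> ('a, 'n, 'd) assoc_pt"
    and e :: "'n \<Rightarrow> 'a vfield"
    and \<psi> :: "'a \<Rightarrow> ('a, 'n, 'd) assoc_pt"
    and m :: nat
  assumes dim: "CARD('n) = 2 * m" "2 * m \<ge> 4"
    and manifold: "oriented_riemannian_manifold A g"
    and levi_civita: "levi_civita A g nabla"
    and rep: "irreducible_unitary_rep \<pi>"
    and connection: "induced_connection A g nabla \<pi> D"
    and frame: "local_frame A g U e"
    and sect: "smooth_section A g \<pi> U \<psi>"
    and "p \<in> U"
    and R_def: "R = curv_comp A g nabla e p"
  shows "pf_curvature nabla \<pi> D e \<psi> p =
    assoc_class \<pi> (\<lambda>i. e i p)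
      (((1 / 2) *\<^sub>R (\<Sum>i\<in>UNIV. \<Sum>j\<in>UNIV. \<Sum>k\<in>UNIV. \<Sum>l\<in>UNIV.
            weyl R i j k l *\<^sub>R uea_rep \<pi> (pf_elem i j * e_uea k l))
        + (scalar_curv R / (real CARD('n) - 1)) *\<^sub>R uea_rep \<pi> pf)
       *v frame_coord (\<lambda>i. e i p) (\<psi> p))"
proof -
  interpret associated_bundle A g nabla \<pi> D
    using manifold levi_civita rep connection
    by unfold_locales (auto simp: oriented_riemannian_manifold_def oriented_atlas_def)
  let ?P = "\<lambda>i j. uea_rep \<pi> (pf_elem i j :: 'n uea)" and ?a = "\<lambda>k l. uea_rep \<pi> (e_uea k l :: 'n uea)"
  let ?v = "frame_coord (\<lambda>i. e i p) (\<psi> p)"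
  have diag: "(\<Sum>j\<in>UNIV - {i}. ?P i j ** ?a i j) = - uea_rep \<pi> pf" for i
    using arg_cong[OF pf_row_diag[OF dim(1), of i], of "uea_rep \<pi>"]
    by (simp add: uea_rep_sum uea_rep_mult uea_rep_minus)
  have off_diag: "(\<Sum>j\<in>UNIV - {i}. ?P i j ** ?a k j) = - (\<Sum>j\<in>UNIV - {k}. ?P k j ** ?a i j)"
    if "i \<noteq> k" for i k
    using arg_cong[OF pf_row_antisym[OF dim(1) that], of "uea_rep \<pi>"]
    by (simp add: uea_rep_sum uea_rep_mult uea_rep_minus)
  have P_skew: "?P j i = - ?P i j" if "i \<noteq> j" for i j
    using that by (auto simp: pf_elem_def uea_rep_minus)
  have a_skew: "?a j i = - ?a i j" for i j
    using e_uea_swap[of i j] by (simp add: uea_rep_minus)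
  have "CARD('n) > 2" using dim by simp
  note contraction = weyl_contraction[OF this ricci_symmetric[OF frame \<open>p \<in> U\<close>], where P = ?P and a = ?a,
      OF P_skew a_skew diag off_diag, folded R_def]
  have "(\<Sum>i\<in>UNIV. \<Sum>j\<in>UNIV. ?P i j *v frame_coord (\<lambda>i. e i p) (bundle_curvature nabla D (e i) (e j) \<psi> p)) =
      (\<Sum>i\<in>UNIV. \<Sum>j\<in>UNIV. ((1 / 2) *\<^sub>R (\<Sum>k\<in>UNIV. \<Sum>l\<in>UNIV. R i j k l *\<^sub>R (?P i j ** ?a k l))) *v ?v)"
    by (simp add: frame_coord_curvature[OF frame sect \<open>p \<in> U\<close>] R_def matrix_vector_mul_assoc
        matrix_mult_linear bounded_bilinear.sum_right[OF bounded_bilinear_matrix_mult])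
  also have "\<dots> = ((1 / 2) *\<^sub>R (\<Sum>i\<in>UNIV. \<Sum>j\<in>UNIV. \<Sum>k\<in>UNIV. \<Sum>l\<in>UNIV. R i j k l *\<^sub>R (?P i j ** ?a k l))) *v ?v"
    by (simp add: bounded_bilinear.sum_left[OF bounded_bilinear_matrix_vector_mult] scaleR_sum_right)
  also note contraction
  finally show ?thesis unfolding pf_curvature_def uea_rep_mult by (rule arg_cong)
qed

end
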